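(* Let $\Gamma$ be a countable discrete residually finite group such that $Wh^{\mathbb{F}_p}(\Gamma)$ is a torsion group. Then there is a unique group homomorphism $\log_p\det_\Gamma:K_1(c_0(\Gamma,\mathbb{Z}_p))\to\mathbb{Q}_p$ such that (a) for every $r\ge1$, the composition $1+pM_r(c_0(\Gamma,\mathbb{Z}_p))\hookrightarrow\mathrm{GL}_r(c_0(\Gamma,\mathbb{Z}_p))\to K_1(c_0(\Gamma,\mathbb{Z}_p))\xrightarrow{\log_p\det_\Gamma}\mathbb{Q}_p$ equals the map $u\mapsto\mathrm{tr}_\Gamma(\log u)$; (b) $\log_p\det_\Gamma$ vanishes on the image of $\Gamma$ in $K_1(c_0(\Gamma,\mathbb{Z}_p))$.
   Context: $c_0(\Gamma)$ is the $\mathbb{Q}_p$-algebra of formal series $\sum x_\gamma\gamma$, $x_\gamma\in\mathbb{Q}_p$, $|x_\gamma|_p\to0$ as $\gamma\to\infty$, with convolution product and norm $\max|x_\gamma|_p$; $c_0(\Gamma,\mathbb{Z}_p)$ is the subring of elements of norm $\le1$. $\mathrm{tr}_\Gamma:M_r(c_0(\Gamma))\to\mathbb{Q}_p$ sends $(f_{ij})$ to $\sum_i$(coefficient of $e$ in $f_{ii}$); for $u\in1+pM_r(c_0(\Gamma,\mathbb{Z}_p))$, $\log u=-\sum_{\nu\ge1}(1-u)^\nu/\nu$. For a unital ring $R$, $\mathrm{GL}_\infty(R)=\bigcup_r\mathrm{GL}_r(R)$ via $a\mapsto\mathrm{diag}(a,1)$, $E_r(R)$ is the subgroup generated by matrices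 with $1$'s on the diagonal and at most one other nonzero entry, $E_\infty(R)=\bigcup_rE_r(R)$, $K_1(R)=\mathrm{GL}_\infty(R)/E_\infty(R)$; $\Gamma$ maps to $K_1$ of group-ring-type algebras via $\gamma\mapsto$ class of the $1\times1$ matrix $(\gamma)$. $Wh^{\mathbb{F}_p}(\Gamma)=K_1(\mathbb{F}_p\Gamma)/\langle\Gamma\rangle$, $\langle\Gamma\rangle$ the image of $\Gamma$. *)

theory Defs
  imports "HOL-Algebra.Algebra" "HOL-Computational_Algebra.Factorial_Ring"
begin

type_synonym qp = "(nat \<Rightarrow> rat) set"

definition padic_abs :: "nat \<Rightarrow> rat \<Rightarrow> real" where
  "padic_abs p q = (if q = 0 then 0 else
     (case quotient_of q of (a, b) \<Rightarrow>
        real p ^ multiplicity (int p) b / real p ^ multiplicity (int p) a))"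

definition qp_cauchy :: "nat \<Rightarrow> (nat \<Rightarrow> rat) \<Rightarrow> bool" where
  "qp_cauchy p a \<longleftrightarrow> (\<forall>e>0. \<exists>N. \<forall>m\<ge>N. \<forall>n\<ge>N. padic_abs p (a m - a n) < e)"

definition qp_class :: "nat \<Rightarrow> (nat \<Rightarrow> rat) \<Rightarrow> (nat \<Rightarrow> rat) set" where
  "qp_class p a = {b. qp_cauchy p b \<and> (\<lambda>n. padic_abs p (a n - b n)) \<longlonglongrightarrow> 0}"

definition Qp_set :: "nat \<Rightarrow> (nat \<Rightarrow> rat) set set" where
  "Qp_set p = {qp_class p a | a. qp_cauchy p a}"

definition qp_rep :: "(nat \<Rightarrow> rat) set \<Rightarrow> nat \<Rightarrow> rat" where
  "qp_rep xq = (SOME a. a \<in> xq)"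

definition Qp :: "nat \<Rightarrow> (nat \<Rightarrow> rat) set ring" where
  "Qp p = \<lparr> carrier = Qp_set p,
            monoid.mult = (\<lambda>xq yq. qp_class p (\<lambda>n. qp_rep xq n * qp_rep yq n)),
            one = qp_class p (\<lambda>_. 1),
            ring.zero = qp_class p (\<lambda>_. 0),
            ring.add = (\<lambda>xq yq. qp_class p (\<lambda>n. qp_rep xq n + qp_rep yq n)) \<rparr>"

definition qp_of_rat :: "nat \<Rightarrow> rat \<Rightarrow> (nat \<Rightarrow> rat) set" where
  "qp_of_rat p q = qp_class p (\<lambda>_. q)"

definition qp_norm :: "nat \<Rightarrow> (nat \<Rightarrow> rat) set \<Rightarrow> real" where
  "qp_norm p xq = lim (\<lambda>n. padic_abs p (qp_rep xq n))"

definition qp_has_sum :: "nat \<Rightarrow> ('i \<Rightarrow> (nat \<Rightarrow> rat) set) \<Rightarrow> 'i set \<Rightarrow> (nat \<Rightarrow> rat) set \<Rightarrow> bool" where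
  "qp_has_sum p F S L \<longleftrightarrow> L \<in> Qp_set p \<and>
     (\<forall>e>0. \<exists>A. finite A \<and> A \<subseteq> S \<and>
        (\<forall>B. finite B \<and> A \<subseteq> B \<and> B \<subseteq> S \<longrightarrow>
             qp_norm p (finsum (Qp p) F B \<ominus>\<^bsub>Qp p\<^esub> L) < e))"

definition qp_sum :: "nat \<Rightarrow> ('i \<Rightarrow> (nat \<Rightarrow> rat) set) \<Rightarrow> 'i set \<Rightarrow> (nat \<Rightarrow> rat) set" where
  "qp_sum p F S = (THE L. qp_has_sum p F S L)"

definition c0_set :: "nat \<Rightarrow> ('g, 'b) monoid_scheme \<Rightarrow> ('g \<Rightarrow> qp) set" where
  "c0_set p G = {f. (\<forall>g\<in>carrier G. f g \<in> Qp_set p)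
                 \<and> (\<forall>g. g \<notin> carrier G \<longrightarrow> f g = \<zero>\<^bsub>Qp p\<^esub>)
                 \<and> (\<forall>e>0. finite {g\<in>carrier G. qp_norm p (f g) \<ge> e})}"

definition delta :: "('a, 'm) ring_scheme \<Rightarrow> 'g \<Rightarrow> 'g \<Rightarrow> 'a" where
  "delta R x = (\<lambda>g. if g = x then \<one>\<^bsub>R\<^esub> else \<zero>\<^bsub>R\<^esub>)"

definition c0 :: "nat \<Rightarrow> ('g, 'b) monoid_scheme \<Rightarrow> ('g \<Rightarrow> qp) ring" where
  "c0 p G = \<lparr> carrier = c0_set p G,
              monoid.mult = (\<lambda>f h x. if x \<in> carrier G
                         then qp_sum p (\<lambda>g. f g \<otimes>\<^bsub>Qp p\<^esub> h (inv\<^bsub>G\<^esub> g \<otimes>\<^bsub>G\<^esub> x)) (carrier G)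
                         else \<zero>\<^bsub>Qp p\<^esub>),
              one = delta (Qp p) \<one>\<^bsub>G\<^esub>,
              ring.zero = (\<lambda>_. \<zero>\<^bsub>Qp p\<^esub>),
              ring.add = (\<lambda>f h x. if x \<in> carrier G then f x \<oplus>\<^bsub>Qp p\<^esub> h x else \<zero>\<^bsub>Qp p\<^esub>) \<rparr>"

definition c0_norm :: "nat \<Rightarrow> ('g, 'b) monoid_scheme \<Rightarrow> ('g \<Rightarrow> qp) \<Rightarrow> real" where
  "c0_norm p G f = Sup ((\<lambda>g. qp_norm p (f g)) ` carrier G)"

definition c0Z :: "nat \<Rightarrow> ('g, 'b) monoid_scheme \<Rightarrow> ('g \<Rightarrow> qp) ring" where
  "c0Z p G = (c0 p G) \<lparr> carrier := {f \<in> c0_set p G. c0_norm p G f \<le> 1} \<rparr>"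

definition c0_smul :: "nat \<Rightarrow> ('g, 'b) monoid_scheme \<Rightarrow> rat \<Rightarrow> ('g \<Rightarrow> qp) \<Rightarrow> ('g \<Rightarrow> qp)" where
  "c0_smul p G q f = (\<lambda>g. if g \<in> carrier G then qp_of_rat p q \<otimes>\<^bsub>Qp p\<^esub> f g else \<zero>\<^bsub>Qp p\<^esub>)"

definition FpG :: "nat \<Rightarrow> ('g, 'b) monoid_scheme \<Rightarrow> ('g \<Rightarrow> int) ring" where
  "FpG p G = \<lparr> carrier = {f. (\<forall>g. 0 \<le> f g \<and> f g < int p) \<and> (\<forall>g. g \<notin> carrier G \<longrightarrow> f g = 0)
                            \<and> finite {g. f g \<noteq> 0}},
               monoid.mult = (\<lambda>f h x. if x \<in> carrier G
                          then (\<Sum>g\<in>{g\<in>carrier G. f g \<noteq> 0}. f g * h (inv\<^bsub>G\<^esub> g \<otimes>\<^bsub>G\<^esub> x)) mod int p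
                          else 0),
               one = (\<lambda>g. if g = \<one>\<^bsub>G\<^esub> then 1 else 0),
               ring.zero = (\<lambda>_. 0),
               ring.add = (\<lambda>f h x. (f x + h x) mod int p) \<rparr>"

text \<open>r x r matrices are functions nat => nat => 'a, only entries i,j < r matter.\<close>
definition mat_one :: "('a, 'm) ring_scheme \<Rightarrow> nat \<Rightarrow> nat \<Rightarrow> 'a" where
  "mat_one R = (\<lambda>i j. if i = j then \<one>\<^bsub>R\<^esub> else \<zero>\<^bsub>R\<^esub>)"

definition mat_mult :: "('a, 'm) ring_scheme \<Rightarrow> nat \<Rightarrow> (nat \<Rightarrow> nat \<Rightarrow> 'a) \<Rightarrow> (nat \<Rightarrow> nat \<Rightarrow> 'a) \<Rightarrow> nat \<Rightarrow> nat \<Rightarrow> 'a" where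
  "mat_mult R r A B = (\<lambda>i j. finsum R (\<lambda>k. A i k \<otimes>\<^bsub>R\<^esub> B k j) {..<r})"

primrec mat_pow :: "('a, 'm) ring_scheme \<Rightarrow> nat \<Rightarrow> (nat \<Rightarrow> nat \<Rightarrow> 'a) \<Rightarrow> nat \<Rightarrow> nat \<Rightarrow> nat \<Rightarrow> 'a" where
  "mat_pow R r A 0 = mat_one R"
| "mat_pow R r A (Suc n) = mat_mult R r (mat_pow R r A n) A"

text \<open>Infinite matrices that agree with the identity outside a finite block:
  GL_infinity(R) = union of GL_r(R) via a |-> diag(a,1).\<close>
definition finitary :: "('a, 'm) ring_scheme \<Rightarrow> (nat \<Rightarrow> nat \<Rightarrow> 'a) \<Rightarrow> bool" where
  "finitary R A \<longleftrightarrow> (\<forall>i j. A i j \<in> carrier R) \<and>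
     (\<exists>r. \<forall>i j. r \<le> i \<or> r \<le> j \<longrightarrow> A i j = mat_one R i j)"

definition inf_mult :: "('a, 'm) ring_scheme \<Rightarrow> (nat \<Rightarrow> nat \<Rightarrow> 'a) \<Rightarrow> (nat \<Rightarrow> nat \<Rightarrow> 'a) \<Rightarrow> nat \<Rightarrow> nat \<Rightarrow> 'a" where
  "inf_mult R A B = (\<lambda>i j. finsum R (\<lambda>k. A i k \<otimes>\<^bsub>R\<^esub> B k j) {k. A i k \<noteq> \<zero>\<^bsub>R\<^esub>})"

definition GLinf :: "('a, 'm) ring_scheme \<Rightarrow> (nat \<Rightarrow> nat \<Rightarrow> 'a) monoid" where
  "GLinf R = \<lparr> carrier = {A. finitary R A \<and> (\<exists>B. finitary R B \<and>
                     inf_mult R A B = mat_one R \<and> inf_mult R B A = mat_one R)},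
               monoid.mult = inf_mult R,
               one = mat_one R \<rparr>"

definition elementary :: "('a, 'm) ring_scheme \<Rightarrow> (nat \<Rightarrow> nat \<Rightarrow> 'a) set" where
  "elementary R = {(\<lambda>k l. if k = i \<and> l = j then a else mat_one R k l) | i j a. i \<noteq> j \<and> a \<in> carrier R}"

definition Einf :: "('a, 'm) ring_scheme \<Rightarrow> (nat \<Rightarrow> nat \<Rightarrow> 'a) set" where
  "Einf R = generate (GLinf R) (elementary R)"

definition K1 :: "('a, 'm) ring_scheme \<Rightarrow> (nat \<Rightarrow> nat \<Rightarrow> 'a) set monoid" where
  "K1 R = GLinf R Mod Einf R"

definition K1_class :: "('a, 'm) ring_scheme \<Rightarrow> (nat \<Rightarrow> nat \<Rightarrow> 'a) \<Rightarrow> (nat \<Rightarrow> nat \<Rightarrow> 'a) set" where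
  "K1_class R A = Einf R #>\<^bsub>GLinf R\<^esub> A"

definition one_by_one :: "('a, 'm) ring_scheme \<Rightarrow> 'a \<Rightarrow> nat \<Rightarrow> nat \<Rightarrow> 'a" where
  "one_by_one R x = (\<lambda>i j. if i = 0 \<and> j = 0 then x else mat_one R i j)"

definition Gamma_image :: "('a, 'm) ring_scheme \<Rightarrow> ('g, 'b) monoid_scheme \<Rightarrow> ('g \<Rightarrow> 'a) \<Rightarrow> (nat \<Rightarrow> nat \<Rightarrow> 'a) set set" where
  "Gamma_image R G emb = {K1_class R (one_by_one R (emb \<gamma>)) | \<gamma>. \<gamma> \<in> carrier G}"

definition Fp_elt :: "'g \<Rightarrow> 'g \<Rightarrow> int" where
  "Fp_elt \<gamma> = (\<lambda>g. if g = \<gamma> then 1 else 0)"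

definition c0_elt :: "nat \<Rightarrow> 'g \<Rightarrow> 'g \<Rightarrow> qp" where
  "c0_elt p \<gamma> = delta (Qp p) \<gamma>"

definition Wh_Fp :: "nat \<Rightarrow> ('g, 'b) monoid_scheme \<Rightarrow> (nat \<Rightarrow> nat \<Rightarrow> 'g \<Rightarrow> int) set set monoid" where
  "Wh_Fp p G = K1 (FpG p G) Mod Gamma_image (FpG p G) G Fp_elt"

definition torsion_group :: "('a, 'b) monoid_scheme \<Rightarrow> bool" where
  "torsion_group H \<longleftrightarrow> (\<forall>x\<in>carrier H. \<exists>n::nat. n > 0 \<and> x [^]\<^bsub>H\<^esub> n = \<one>\<^bsub>H\<^esub>)"

definition residually_finite :: "('g, 'b) monoid_scheme \<Rightarrow> bool" where
  "residually_finite G \<longleftrightarrow> (\<forall>g\<in>carrier G. g \<noteq> \<one>\<^bsub>G\<^esub> \<longrightarrow>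
      (\<exists>N. N \<lhd> G \<and> finite (rcosets\<^bsub>G\<^esub> N) \<and> g \<notin> N))"

text \<open>Elements u of 1 + p M_r(c_0(Gamma,Z_p)), embedded into GL_infinity via diag(u,1).\<close>
definition one_plus_pM :: "nat \<Rightarrow> ('g, 'b) monoid_scheme \<Rightarrow> nat \<Rightarrow> (nat \<Rightarrow> nat \<Rightarrow> 'g \<Rightarrow> qp) set" where
  "one_plus_pM p G r = {(\<lambda>i j. if i < r \<and> j < r
          then mat_one (c0 p G) i j \<oplus>\<^bsub>c0 p G\<^esub> c0_smul p G (of_nat p) (m i j)
          else mat_one (c0 p G) i j)
       | m. \<forall>i<r. \<forall>j<r. m i j \<in> carrier (c0Z p G)}"

definition log_partial :: "nat \<Rightarrow> ('g, 'b) monoid_scheme \<Rightarrow> nat \<Rightarrow> (nat \<Rightarrow> nat \<Rightarrow> 'g \<Rightarrow> qp) \<Rightarrow> nat \<Rightarrow> nat \<Rightarrow> nat \<Rightarrow> 'g \<Rightarrow> qp" where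
  "log_partial p G r u N = (\<lambda>i j. \<ominus>\<^bsub>c0 p G\<^esub> finsum (c0 p G)
      (\<lambda>\<nu>. c0_smul p G (1 / of_nat \<nu>)
              (mat_pow (c0 p G) r (\<lambda>k l. mat_one (c0 p G) k l \<ominus>\<^bsub>c0 p G\<^esub> u k l) \<nu> i j)) {1..N})"

definition mat_log :: "nat \<Rightarrow> ('g, 'b) monoid_scheme \<Rightarrow> nat \<Rightarrow> (nat \<Rightarrow> nat \<Rightarrow> 'g \<Rightarrow> qp) \<Rightarrow> nat \<Rightarrow> nat \<Rightarrow> 'g \<Rightarrow> qp" where
  "mat_log p G r u = (THE L. (\<forall>i j. (i < r \<and> j < r \<longrightarrow> L i j \<in> c0_set p G) \<and>
                                  (\<not> (i < r \<and> j < r) \<longrightarrow> L i j = \<zero>\<^bsub>c0 p G\<^esub>)) \<and>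
      (\<forall>i<r. \<forall>j<r. (\<lambda>N. c0_norm p G (log_partial p G r u N i j \<ominus>\<^bsub>c0 p G\<^esub> L i j)) \<longlonglongrightarrow> 0))"

definition tr_Gamma :: "nat \<Rightarrow> ('g, 'b) monoid_scheme \<Rightarrow> nat \<Rightarrow> (nat \<Rightarrow> nat \<Rightarrow> 'g \<Rightarrow> qp) \<Rightarrow> qp" where
  "tr_Gamma p G r L = finsum (Qp p) (\<lambda>i. L i i \<one>\<^bsub>G\<^esub>) {..<r}"

end

theory Submission
  imports Defs "Jordan_Normal_Form.Determinant" "HOL-Number_Theory.Residues"
begin

text \<open>
  Let \<open>\<rho>\<^sub>N\<close> be the regular representation of \<open>\<Gamma>/N\<close> for a normal subgroup \<open>N\<close> of finite index. The maps
  \<open>A \<mapsto> [\<Gamma> : N]\<^sup>-\<^sup>1 log\<^sub>p det \<rho>\<^sub>N(A)\<close> on \<open>GL\<^sub>\<infinity>\<close> are homomorphisms which vanish on elementary matrices and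
  on \<open>\<Gamma>\<close> (where the determinant is \<open>\<plusminus>1\<close>). For \<open>u\<close> in \<open>1 + p M\<^sub>r\<close> they converge to \<open>tr\<^sub>\<Gamma>(log u)\<close> as \<open>N\<close> shrinks
  to the identity: \<open>p\<^sup>-\<^sup>k (u\<^bsup>p\<^sup>k\<^esup> - 1)\<close> tends to \<open>log u\<close>, and \<open>det (1 + c Y) \<equiv> 1 + c tr Y\<close> modulo \<open>c\<^sup>2\<close> for
  \<open>c = p\<^bsup>k + 1\<^esup>\<close>. Torsion of the Whitehead group yields \<open>A\<^sup>m = E \<gamma> u\<close> with \<open>E\<close> elementary for every \<open>A\<close>, so the
  limit exists everywhere, is a homomorphism, and is determined by its values on \<open>\<Gamma>\<close> and on \<open>1 + p M\<^sub>r\<close>.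
  Only residues are ever needed: all determinants are those of integer matrices modulo a power of \<open>p\<close>, and
  \<open>c\<^sub>0(\<Gamma>, Z\<^sub>p)\<close> is handled through its reductions to the group rings \<open>(Z/p\<^sup>M)\<Gamma>\<close>.
\<close>

section \<open>The field of p-adic numbers\<close>

text \<open>The link to \<open>tr_Gamma\<close>: the normalised trace of the regular representation
  of a finite quotient sums the coefficients over all of \<open>N\<close>, whereas
  \<open>tr_Gamma\<close> keeps only the one at the identity. An element of \<open>c0\<close> is
  small off a finite set, so \<open>N\<close> only has to miss finitely many elements; residual
  finiteness provides such \<open>N\<close> and thereby also makes the limit unique. For a general
  matrix nothing compares the determinants at different \<open>N\<close>, so convergence is never
  attacked directly: it is known for three kinds of matrices and passes to products and to
  \<open>m\<close>-th roots, \<open>m\<close> being invertible in the p-adic field. The index may be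
  divisible by \<open>p\<close>, so dividing by it can amplify errors by up to the index itself.
  Hence the double limit: \<open>k\<close> grows for fixed \<open>N\<close>, and only then
  \<open>N\<close> shrinks. The logarithm of a determinant is replaced by a first-order quotient
  whose exponent is the order of the unit group modulo \<open>p ^ (k + 1)\<close>; it makes sense
  for every p-adic unit, and the neglected terms are multiples of the square of
  \<open>p ^ (k + 1)\<close>, which is why determinants are reduced modulo
  \<open>p ^ (2 * k + 2)\<close>.\<close>

locale padic =
  fixes p :: nat
  assumes prime_p: "Factorial_Ring.prime p"
begin

abbreviation "pabs \<equiv> padic_abs p"
abbreviation "K \<equiv> Qp p"
abbreviation "cls \<equiv> qp_class p"
abbreviation "nrm \<equiv> qp_norm p"
abbreviation "emb \<equiv> qp_of_rat p"

section \<open>The p-adic absolute value on the rationals\<close>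

lemma p_gt_1: "p > 1" and p_gt_0 [simp]: "p > 0"
  using prime_p prime_gt_1_nat prime_gt_0_nat by blast+

lemma prime_int_p: "Factorial_Ring.prime (int p)"
  using prime_p by simp

lemma multiplicity_mult:
  "a \<noteq> 0 \<Longrightarrow> b \<noteq> 0 \<Longrightarrow> multiplicity (int p) (a * b) = multiplicity (int p) a + multiplicity (int p) b"
  using prime_elem_multiplicity_mult_distrib prime_int_p by blast

lemma pabs_0 [simp]: "pabs 0 = 0"
  by (simp add: padic_abs_def)

text \<open>\<open>padic_abs\<close> reads off the reduced fraction; cross-multiplying with an
  arbitrary one and using additivity of multiplicities frees later arguments from reduced
  form.\<close>

lemma pabs_frac:
  assumes "a \<noteq> 0" "b \<noteq> 0"
  shows "pabs (of_int a / of_int b) = real p ^ multiplicity (int p) b / real p ^ multiplicity (int p) a"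
proof -
  define q where "q = (of_int a / of_int b :: rat)"
  obtain a' b' where q': "quotient_of q = (a', b')" by fastforce
  have q: "q = of_int a' / of_int b'" using quotient_of_div[OF q'] .
  have b': "b' \<noteq> 0" using quotient_of_denom_pos[OF q'] by simp
  have "q \<noteq> 0" using assms by (simp add: q_def)
  hence a': "a' \<noteq> 0" using q by auto
  have "of_int (a * b') = (of_int (a' * b) :: rat)"
    using q assms b' unfolding q_def by (simp add: field_simps)
  hence "a * b' = a' * b" using of_int_eq_iff by blast
  hence "multiplicity (int p) a + multiplicity (int p) b' = multiplicity (int p) a' + multiplicity (int p) b"
    using multiplicity_mult assms a' b' by metis
  hence "real p ^ multiplicity (int p) a * real p ^ multiplicity (int p) b'
       = real p ^ multiplicity (int p) a' * real p ^ multiplicity (int p) b"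
    by (metis power_add)
  thus ?thesis using \<open>q \<noteq> 0\<close> q' p_gt_0
    unfolding padic_abs_def q_def[symmetric]
    by (simp add: field_simps)
qed

lemma rat_frac: obtains a b where "(q::rat) = of_int a / of_int b" "b \<noteq> (0::int)"
  by (metis quotient_of_denom_pos' quotient_of_div less_irrefl surj_pair snd_conv)

lemma pabs_mult: "pabs (x * y) = pabs x * pabs y"
proof (cases "x = 0 \<or> y = 0")
  case False
  obtain a b where x: "x = of_int a / of_int b" "b \<noteq> 0" by (rule rat_frac)
  obtain c d where y: "y = of_int c / of_int d" "d \<noteq> 0" by (rule rat_frac)
  have ac: "a \<noteq> 0" "c \<noteq> 0" using False x y by auto
  have "x * y = of_int (a * c) / of_int (b * d)" using x y by simp
  thus ?thesis using pabs_frac[of "a * c" "b * d"] pabs_frac[of a b] pabs_frac[of c d] x y ac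
    by (simp add: multiplicity_mult power_add)
qed auto

lemma pabs_nonneg [simp]: "pabs x \<ge> 0"
  by (cases "quotient_of x") (simp add: padic_abs_def)

lemma pabs_pos: "x \<noteq> 0 \<Longrightarrow> pabs x > 0"
  using p_gt_0 by (cases "quotient_of x") (simp add: padic_abs_def)

lemma pabs_eq_0_iff [simp]: "pabs x = 0 \<longleftrightarrow> x = 0"
  using pabs_pos[of x] by (cases "x = 0") auto

lemma pabs_int: "a \<noteq> 0 \<Longrightarrow> pabs (of_int a) = 1 / real p ^ multiplicity (int p) a"
  using pabs_frac[of a 1] by simp

lemma pabs_1 [simp]: "pabs 1 = 1"
  using pabs_int[of 1] by simp

lemma pabs_minus [simp]: "pabs (- x) = pabs x"
proof -
  have "pabs (-1) * pabs (-1) = 1" by (metis pabs_mult pabs_1 mult_minus1 minus_minus)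
  hence "pabs (-1) = 1" using pabs_nonneg[of "-1"]
    by (metis abs_of_nonneg abs_mult_self_eq power2_eq_square power2_eq_1_iff zero_le_one
        neg_0_le_iff_le not_one_le_zero)
  thus ?thesis using pabs_mult[of "-1" x] by simp
qed

text \<open>The bridge between the analytic and the arithmetic side: estimates by
  \<open>1 / real p ^ M\<close> are turned into congruences and back through this
  equivalence.\<close>

lemma pabs_int_le_iff: "pabs (of_int a) \<le> 1 / real p ^ M \<longleftrightarrow> int p ^ M dvd a"
proof (cases "a = 0")
  case False
  have u: "\<not> is_unit (int p)" using p_gt_1 by simp
  have "pabs (of_int a) \<le> 1 / real p ^ M \<longleftrightarrow> real p ^ M \<le> real p ^ multiplicity (int p) a"
    using p_gt_0 by (simp add: pabs_int[OF False] field_simps)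
  also have "\<dots> \<longleftrightarrow> M \<le> multiplicity (int p) a" using p_gt_1 by simp
  also have "\<dots> \<longleftrightarrow> int p ^ M dvd a" using power_dvd_iff_le_multiplicity[of a "int p" M] False u by auto
  finally show ?thesis .
qed auto

lemma pabs_int_le_1: "pabs (of_int a) \<le> 1"
  using pabs_int_le_iff[of a 0] by simp

lemma pabs_ultra_int: "pabs (of_int (a + b)) \<le> max (pabs (of_int a)) (pabs (of_int b))"
proof (cases "a = 0 \<or> b = 0")
  case False
  define m where "m = min (multiplicity (int p) a) (multiplicity (int p) b)"
  have "int p ^ m dvd a" "int p ^ m dvd b"
    unfolding m_def by (auto intro: multiplicity_dvd')
  hence "pabs (of_int (a + b)) \<le> 1 / real p ^ m" unfolding pabs_int_le_iff by (rule dvd_add)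
  also have "\<dots> \<le> max (pabs (of_int a)) (pabs (of_int b))"
    using False by (auto simp: pabs_int m_def min_def)
  finally show ?thesis .
qed auto

text \<open>Scaling by a common denominator reduces to integers, where both summands are divisible
  by the smaller of the two powers of \<open>p\<close>.\<close>

lemma pabs_ultra: "pabs (x + y) \<le> max (pabs x) (pabs y)"
proof -
  obtain a b where x: "x = of_int a / of_int b" "b \<noteq> 0" by (rule rat_frac)
  obtain c d where y: "y = of_int c / of_int d" "d \<noteq> 0" by (rule rat_frac)
  define t where "t = (of_int (b * d) :: rat)"
  have t: "t \<noteq> 0" using x y by (simp add: t_def)
  have "t * x = of_int (a * d)" "t * y = of_int (c * b)" "t * (x + y) = of_int (a * d + c * b)"
    using x y by (auto simp: t_def field_simps)
  hence "pabs (t * (x + y)) \<le> max (pabs (t * x)) (pabs (t * y))"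
    using pabs_ultra_int[of "a * d" "c * b"] by simp
  thus ?thesis using pabs_pos[OF t] by (simp add: pabs_mult max_def split: if_splits)
qed

lemma pabs_diff_commute: "pabs (x - y) = pabs (y - x)"
  by (metis pabs_minus minus_diff_eq)

lemma pabs_add_le: "pabs (x + y) \<le> pabs x + pabs y"
  using pabs_ultra[of x y] pabs_nonneg[of x] pabs_nonneg[of y] by linarith

lemma pabs_abs_diff: "\<bar>pabs x - pabs y\<bar> \<le> pabs (x - y)"
  using pabs_add_le[of "x-y" y] pabs_add_le[of "y-x" x] pabs_diff_commute[of x y] by auto

lemma pabs_divide: "pabs (x / y) = pabs x / pabs y"
proof (cases "y = 0")
  case False
  hence "pabs x = pabs (x / y) * pabs y" by (simp add: pabs_mult[symmetric])
  thus ?thesis using pabs_pos[OF False] by (simp add: field_simps)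
qed simp

lemma pabs_power: "pabs (x ^ n) = pabs x ^ n"
  by (induction n) (auto simp: pabs_mult)

lemma pabs_p: "pabs (of_nat p) = 1 / real p"
proof -
  have "multiplicity (int p) (int p) = 1"
    using prime_int_p by (metis multiplicity_self not_prime_0 not_prime_unit)
  thus ?thesis using pabs_int[of "int p"] p_gt_0 by simp
qed

text \<open>A power of \<open>p\<close> dividing \<open>n\<close> is at most \<open>n\<close>. The
  bound limits the loss when a p-adic quantity is divided by an index or by an exponent
  \<open>m\<close>.\<close>

lemma pabs_nat_ge: "n > 0 \<Longrightarrow> 1 / real n \<le> pabs (of_nat n)"
proof -
  assume n: "n > 0"
  have "int p ^ multiplicity (int p) (int n) dvd int n" by (rule multiplicity_dvd)
  hence "int p ^ multiplicity (int p) (int n) \<le> int n" using n by (intro zdvd_imp_le) auto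
  hence "real p ^ multiplicity (int p) (int n) \<le> real n"
    by (metis of_int_le_iff of_int_of_nat_eq of_int_power)
  thus ?thesis using pabs_int[of "int n"] n p_gt_0 by (simp add: frac_le)
qed

section \<open>Cauchy sequences of rationals modulo null sequences\<close>

lemma qp_cauchy_const [simp]: "qp_cauchy p (\<lambda>_. q)"
  by (simp add: qp_cauchy_def)

lemma qp_cauchy_uminus: "qp_cauchy p a \<Longrightarrow> qp_cauchy p (\<lambda>n. - a n)"
  unfolding qp_cauchy_def by (simp add: pabs_diff_commute)

lemma qp_cauchy_add:
  assumes "qp_cauchy p a" "qp_cauchy p b" shows "qp_cauchy p (\<lambda>n. a n + b n)"
  unfolding qp_cauchy_def
proof (intro allI impI)
  fix e :: real assume "e > 0"
  then obtain N N' where N: "\<forall>m\<ge>N. \<forall>n\<ge>N. pabs (a m - a n) < e" "\<forall>m\<ge>N'. \<forall>n\<ge>N'. pabs (b m - b n) < e"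
    using assms unfolding qp_cauchy_def by meson
  have "pabs (a m + b m - (a n + b n)) < e" if "m \<ge> max N N'" "n \<ge> max N N'" for m n
  proof -
    have "a m + b m - (a n + b n) = (a m - a n) + (b m - b n)" by simp
    thus ?thesis using pabs_ultra[of "a m - a n" "b m - b n"] N that
      by (metis max.bounded_iff max_less_iff_conj order_le_less_trans)
  qed
  thus "\<exists>N. \<forall>m\<ge>N. \<forall>n\<ge>N. pabs (a m + b m - (a n + b n)) < e" by blast
qed

lemma qp_cauchy_diff:
  assumes "qp_cauchy p a" "qp_cauchy p b" shows "qp_cauchy p (\<lambda>n. a n - b n)"
  using qp_cauchy_add[OF assms(1) qp_cauchy_uminus[OF assms(2)]] by simp

lemma Cauchy_pabs: "qp_cauchy p a \<Longrightarrow> Cauchy (\<lambda>n. pabs (a n))"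
  unfolding qp_cauchy_def Cauchy_def dist_real_def
  by (meson order_le_less_trans pabs_abs_diff)

lemma qp_cauchy_bounded:
  assumes "qp_cauchy p a" obtains B where "B > 0" "\<And>n. pabs (a n) \<le> B"
proof -
  have "Bseq (\<lambda>n. pabs (a n))" using Cauchy_pabs[OF assms] Cauchy_Bseq by blast
  thus ?thesis using that by (elim BseqE) auto
qed

lemma qp_cauchy_mult:
  assumes "qp_cauchy p a" "qp_cauchy p b" shows "qp_cauchy p (\<lambda>n. a n * b n)"
  unfolding qp_cauchy_def
proof (intro allI impI)
  fix e :: real assume e: "e > 0"
  obtain A where A: "A > 0" "\<And>n. pabs (a n) \<le> A" using qp_cauchy_bounded assms by blast
  obtain B where B: "B > 0" "\<And>n. pabs (b n) \<le> B" using qp_cauchy_bounded assms by blast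
  have "e / B > 0" "e / A > 0" using e A B by auto
  then obtain N N' where N: "\<forall>m\<ge>N. \<forall>n\<ge>N. pabs (a m - a n) < e / B" "\<forall>m\<ge>N'. \<forall>n\<ge>N'. pabs (b m - b n) < e / A"
    using assms unfolding qp_cauchy_def by meson
  have "pabs (a m * b m - (a n * b n)) < e" if "m \<ge> max N N'" "n \<ge> max N N'" for m n
  proof -
    have eq: "a m * b m - (a n * b n) = (a m - a n) * b m + a n * (b m - b n)"
      by (simp add: algebra_simps)
    have "pabs ((a m - a n) * b m) \<le> pabs (a m - a n) * B" using B by (simp add: pabs_mult mult_left_mono)
    also have "\<dots> < e" using N that B by (simp add: pos_less_divide_eq)
    finally have 1: "pabs ((a m - a n) * b m) < e" .
    have "pabs (a n * (b m - b n)) \<le> A * pabs (b m - b n)" using A by (simp add: pabs_mult mult_right_mono)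
    also have "\<dots> < e" using N that A by (simp add: pos_less_divide_eq mult.commute)
    finally have 2: "pabs (a n * (b m - b n)) < e" .
    show ?thesis unfolding eq using 1 2 pabs_ultra by (metis max_less_iff_conj order_le_less_trans)
  qed
  thus "\<exists>N. \<forall>m\<ge>N. \<forall>n\<ge>N. pabs (a m * b m - a n * b n) < e" by blast
qed

definition null :: "(nat \<Rightarrow> rat) \<Rightarrow> bool" where
  "null a \<longleftrightarrow> (\<lambda>n. pabs (a n)) \<longlonglongrightarrow> 0"

lemma null_0 [simp]: "null (\<lambda>_. 0)" by (simp add: null_def)

lemma null_uminus: "null a \<Longrightarrow> null (\<lambda>n. - a n)" by (simp add: null_def)

lemma null_add: "null a \<Longrightarrow> null b \<Longrightarrow> null (\<lambda>n. a n + b n)"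
  unfolding null_def by (rule tendsto_sandwich[of "\<lambda>_. 0" _ _ "\<lambda>n. pabs (a n) + pabs (b n)"])
    (auto intro: tendsto_add_zero always_eventually pabs_add_le)

lemma null_diff: "null a \<Longrightarrow> null b \<Longrightarrow> null (\<lambda>n. a n - b n)"
  using null_add[OF _ null_uminus, of a b] by simp

lemma null_mult:
  assumes "null a" "qp_cauchy p b" shows "null (\<lambda>n. a n * b n)"
proof -
  obtain B where B: "B > 0" "\<And>n. pabs (b n) \<le> B" using qp_cauchy_bounded assms by blast
  have "(\<lambda>n. pabs (a n) * B) \<longlonglongrightarrow> 0" using assms(1) unfolding null_def by (rule tendsto_mult_left_zero)
  thus ?thesis unfolding null_def
    by (rule tendsto_sandwich[of "\<lambda>_. 0", rotated 3]) (auto simp: pabs_mult B mult_left_mono)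
qed

lemma mem_cls: "b \<in> cls a \<longleftrightarrow> qp_cauchy p b \<and> null (\<lambda>n. a n - b n)"
  by (simp add: qp_class_def null_def)

lemma self_mem_cls: "qp_cauchy p a \<Longrightarrow> a \<in> cls a"
  by (simp add: mem_cls)

lemma cls_eq_iff:
  assumes "qp_cauchy p a" "qp_cauchy p b"
  shows "cls a = cls b \<longleftrightarrow> null (\<lambda>n. a n - b n)"
proof
  assume "cls a = cls b"
  thus "null (\<lambda>n. a n - b n)" using self_mem_cls[OF assms(2)] mem_cls by auto
next
  assume n: "null (\<lambda>n. a n - b n)"
  show "cls a = cls b"
  proof (rule Set.set_eqI)
    fix c
    have "null (\<lambda>n. a n - c n) \<longleftrightarrow> null (\<lambda>n. b n - c n)"
      using null_diff[OF _ n, of "\<lambda>n. a n - c n"] null_add[OF _ n, of "\<lambda>n. b n - c n"] by auto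
    thus "c \<in> cls a \<longleftrightarrow> c \<in> cls b" by (auto simp: mem_cls)
  qed
qed

lemma carrier_K: "carrier K = Qp_set p" by (simp add: Qp_def)

lemma cls_closed [simp]: "qp_cauchy p a \<Longrightarrow> cls a \<in> carrier K"
  by (auto simp: Qp_def Qp_set_def)

lemma carrier_K_cases: assumes "x \<in> carrier K" obtains a where "qp_cauchy p a" "x = cls a"
  using assms by (auto simp: Qp_def Qp_set_def)

text \<open>\<open>Qp\<close> computes with a representative chosen by \<open>SOME\<close>. It
  differs from any given one by a null sequence, which lets \<open>cls_add\<close> and
  \<open>cls_mult\<close> work with arbitrary representatives.\<close>

lemma rep_cls:
  assumes "qp_cauchy p a"
  shows "qp_cauchy p (qp_rep (cls a))" "null (\<lambda>n. a n - qp_rep (cls a) n)"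
proof -
  have "qp_rep (cls a) \<in> cls a" unfolding qp_rep_def by (rule someI[of _ a]) (rule self_mem_cls[OF assms])
  thus "qp_cauchy p (qp_rep (cls a))" "null (\<lambda>n. a n - qp_rep (cls a) n)" by (auto simp: mem_cls)
qed

lemma cls_add:
  assumes "qp_cauchy p a" "qp_cauchy p b"
  shows "cls a \<oplus>\<^bsub>K\<^esub> cls b = cls (\<lambda>n. a n + b n)"
proof -
  have "null (\<lambda>n. (qp_rep (cls a) n + qp_rep (cls b) n) - (a n + b n))"
    using null_uminus[OF null_add[OF rep_cls(2)[OF assms(1)] rep_cls(2)[OF assms(2)]]]
    by (simp add: algebra_simps)
  thus ?thesis using assms by (simp add: Qp_def cls_eq_iff rep_cls qp_cauchy_add)
qed

lemma cls_mult:
  assumes "qp_cauchy p a" "qp_cauchy p b"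
  shows "cls a \<otimes>\<^bsub>K\<^esub> cls b = cls (\<lambda>n. a n * b n)"
proof -
  define a' b' where "a' = qp_rep (cls a)" "b' = qp_rep (cls b)"
  note r = rep_cls[OF assms(1), folded a'_b'_def(1)] rep_cls[OF assms(2), folded a'_b'_def(2)]
  have "null (\<lambda>n. (a n - a' n) * b' n + (b n - b' n) * a n)"
    by (intro null_add null_mult r assms)
  from null_uminus[OF this] have "null (\<lambda>n. a' n * b' n - a n * b n)"
    by (simp add: algebra_simps)
  thus ?thesis using assms r a'_b'_def by (simp add: Qp_def cls_eq_iff qp_cauchy_mult)
qed

lemma K_zero: "\<zero>\<^bsub>K\<^esub> = cls (\<lambda>_. 0)" and K_one: "\<one>\<^bsub>K\<^esub> = cls (\<lambda>_. 1)"
  by (simp_all add: Qp_def)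

lemma cring_K: "cring K"
proof (rule cringI)
  show "abelian_group K"
  proof (rule abelian_groupI)
    fix x assume "x \<in> carrier K"
    then obtain a where a: "qp_cauchy p a" "x = cls a" by (rule carrier_K_cases)
    show "\<exists>y\<in>carrier K. y \<oplus>\<^bsub>K\<^esub> x = \<zero>\<^bsub>K\<^esub>"
      by (rule bexI[of _ "cls (\<lambda>n. - a n)"]) (simp_all add: a cls_add K_zero qp_cauchy_uminus)
  qed (auto elim!: carrier_K_cases simp: cls_add K_zero qp_cauchy_add add_ac)
next
  show "Group.comm_monoid K"
    by (rule Group.comm_monoidI) (auto elim!: carrier_K_cases simp: cls_mult K_one qp_cauchy_mult mult_ac)
qed (auto elim!: carrier_K_cases simp: cls_mult cls_add qp_cauchy_mult qp_cauchy_add algebra_simps)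

end

sublocale padic \<subseteq> K: cring "Qp p" by (rule cring_K)

context padic begin

section \<open>Norm, density of the rationals and completeness of the p-adic field\<close>

lemma cls_uminus: "qp_cauchy p a \<Longrightarrow> \<ominus>\<^bsub>K\<^esub> cls a = cls (\<lambda>n. - a n)"
  by (rule K.add.inv_equality) (simp_all add: cls_add K_zero qp_cauchy_uminus)

lemma cls_diff: "qp_cauchy p a \<Longrightarrow> qp_cauchy p b \<Longrightarrow> cls a \<ominus>\<^bsub>K\<^esub> cls b = cls (\<lambda>n. a n - b n)"
  by (simp add: a_minus_def cls_uminus cls_add qp_cauchy_uminus)

text \<open>The absolute values along a Cauchy sequence converge, and a null difference does not
  change their limit, so \<open>qp_norm\<close> may be read off any representative.\<close>

lemma nrm_cls:
  assumes "qp_cauchy p a" shows "(\<lambda>n. pabs (a n)) \<longlonglongrightarrow> nrm (cls a)"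
proof -
  define a' where "a' = qp_rep (cls a)"
  note r = rep_cls[OF assms, folded a'_def]
  have c: "(\<lambda>n. pabs (a' n)) \<longlonglongrightarrow> nrm (cls a)"
    unfolding qp_norm_def a'_def[symmetric] using Cauchy_pabs[OF r(1)]
    by (simp add: Cauchy_convergent_iff convergent_LIMSEQ_iff)
  have "(\<lambda>n. pabs (a n) - pabs (a' n)) \<longlonglongrightarrow> 0"
    by (rule tendsto_rabs_zero_cancel, rule tendsto_sandwich[OF _ _ tendsto_const r(2)[unfolded null_def]])
      (auto simp: pabs_abs_diff)
  from tendsto_add[OF this c] show ?thesis by simp
qed

lemma nrm_nonneg: "x \<in> carrier K \<Longrightarrow> nrm x \<ge> 0"
  by (elim carrier_K_cases) (auto intro!: LIMSEQ_le_const[OF nrm_cls])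

lemma nrm_zero [simp]: "nrm \<zero>\<^bsub>K\<^esub> = 0"
  using nrm_cls[of "\<lambda>_. 0"] by (simp add: K_zero LIMSEQ_const_iff)

lemma nrm_eq_0D: "x \<in> carrier K \<Longrightarrow> nrm x = 0 \<Longrightarrow> x = \<zero>\<^bsub>K\<^esub>"
proof (elim carrier_K_cases)
  fix a assume *: "nrm x = 0" "qp_cauchy p a" "x = cls a"
  show ?thesis using nrm_cls[OF *(2)] * by (simp add: K_zero cls_eq_iff null_def)
qed

lemma nrm_mult: "x \<in> carrier K \<Longrightarrow> y \<in> carrier K \<Longrightarrow> nrm (x \<otimes>\<^bsub>K\<^esub> y) = nrm x * nrm y"
proof (elim carrier_K_cases)
  fix a b assume *: "qp_cauchy p a" "qp_cauchy p b" "x = cls a" "y = cls b"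
  show ?thesis using tendsto_mult[OF nrm_cls[OF *(1)] nrm_cls[OF *(2)]]
      nrm_cls[OF qp_cauchy_mult[OF *(1,2)]] * LIMSEQ_unique by (simp add: cls_mult pabs_mult)
qed

lemma nrm_add: "x \<in> carrier K \<Longrightarrow> y \<in> carrier K \<Longrightarrow> nrm (x \<oplus>\<^bsub>K\<^esub> y) \<le> max (nrm x) (nrm y)"
proof (elim carrier_K_cases)
  fix a b assume *: "qp_cauchy p a" "qp_cauchy p b" "x = cls a" "y = cls b"
  show ?thesis using tendsto_le[OF _ tendsto_max[OF nrm_cls[OF *(1)] nrm_cls[OF *(2)]]
      nrm_cls[OF qp_cauchy_add[OF *(1,2)]]] * by (simp add: cls_add pabs_ultra)
qed

lemma nrm_uminus: "x \<in> carrier K \<Longrightarrow> nrm (\<ominus>\<^bsub>K\<^esub> x) = nrm x"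
proof (elim carrier_K_cases)
  fix a assume *: "qp_cauchy p a" "x = cls a"
  show ?thesis using nrm_cls[OF *(1)] nrm_cls[OF qp_cauchy_uminus[OF *(1)]] * LIMSEQ_unique
    by (simp add: cls_uminus)
qed

lemma nrm_diff: "x \<in> carrier K \<Longrightarrow> y \<in> carrier K \<Longrightarrow> nrm (x \<ominus>\<^bsub>K\<^esub> y) \<le> max (nrm x) (nrm y)"
  using nrm_add[of x "\<ominus>\<^bsub>K\<^esub> y"] by (simp add: a_minus_def nrm_uminus)

lemma nrm_diff_commute: "x \<in> carrier K \<Longrightarrow> y \<in> carrier K \<Longrightarrow> nrm (x \<ominus>\<^bsub>K\<^esub> y) = nrm (y \<ominus>\<^bsub>K\<^esub> x)"
proof -
  assume *: "x \<in> carrier K" "y \<in> carrier K"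
  hence "y \<ominus>\<^bsub>K\<^esub> x = \<ominus>\<^bsub>K\<^esub> (x \<ominus>\<^bsub>K\<^esub> y)"
    by (simp add: a_minus_def K.minus_add K.a_comm)
  thus ?thesis using * by (simp add: nrm_uminus)
qed

lemma K_diff_trans: "x \<in> carrier K \<Longrightarrow> y \<in> carrier K \<Longrightarrow> z \<in> carrier K \<Longrightarrow>
   x \<ominus>\<^bsub>K\<^esub> z = (x \<ominus>\<^bsub>K\<^esub> y) \<oplus>\<^bsub>K\<^esub> (y \<ominus>\<^bsub>K\<^esub> z)"
  by (simp add: a_minus_def K.a_assoc K.r_neg1)

lemma nrm_diff_trans: "x \<in> carrier K \<Longrightarrow> y \<in> carrier K \<Longrightarrow> z \<in> carrier K \<Longrightarrow>
   nrm (x \<ominus>\<^bsub>K\<^esub> z) \<le> max (nrm (x \<ominus>\<^bsub>K\<^esub> y)) (nrm (y \<ominus>\<^bsub>K\<^esub> z))"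
  using nrm_add[of "x \<ominus>\<^bsub>K\<^esub> y" "y \<ominus>\<^bsub>K\<^esub> z"] K_diff_trans[of x y z] by simp

lemma K_eqI: "x \<in> carrier K \<Longrightarrow> y \<in> carrier K \<Longrightarrow> (\<And>e. e > 0 \<Longrightarrow> nrm (x \<ominus>\<^bsub>K\<^esub> y) \<le> e) \<Longrightarrow> x = y"
proof -
  assume *: "x \<in> carrier K" "y \<in> carrier K" "\<And>e. e > 0 \<Longrightarrow> nrm (x \<ominus>\<^bsub>K\<^esub> y) \<le> e"
  have "nrm (x \<ominus>\<^bsub>K\<^esub> y) = 0" using *(3) nrm_nonneg[of "x \<ominus>\<^bsub>K\<^esub> y"] *(1,2)
    by (metis K.minus_closed field_le_epsilon add_0 order_antisym)
  hence "x \<ominus>\<^bsub>K\<^esub> y = \<zero>\<^bsub>K\<^esub>" using *(1,2) nrm_eq_0D by simp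
  thus ?thesis using * by simp
qed

lemma emb_closed [simp]: "emb q \<in> carrier K" by (simp add: qp_of_rat_def)
lemma emb_add: "emb (a + b) = emb a \<oplus>\<^bsub>K\<^esub> emb b" by (simp add: qp_of_rat_def cls_add)
lemma emb_mult: "emb (a * b) = emb a \<otimes>\<^bsub>K\<^esub> emb b" by (simp add: qp_of_rat_def cls_mult)
lemma emb_diff: "emb (a - b) = emb a \<ominus>\<^bsub>K\<^esub> emb b" by (simp add: qp_of_rat_def cls_diff)
lemma emb_0 [simp]: "emb 0 = \<zero>\<^bsub>K\<^esub>" by (simp add: qp_of_rat_def K_zero)
lemma emb_1 [simp]: "emb 1 = \<one>\<^bsub>K\<^esub>" by (simp add: qp_of_rat_def K_one)
lemma nrm_emb [simp]: "nrm (emb a) = pabs a"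
  using nrm_cls[of "\<lambda>_. a"] by (simp add: qp_of_rat_def LIMSEQ_const_iff)
lemma nrm_one [simp]: "nrm \<one>\<^bsub>K\<^esub> = 1" using nrm_emb[of 1] by simp

lemma emb_sum: "emb (sum f A) = finsum K (\<lambda>i. emb (f i)) A"
  by (induction A rule: infinite_finite_induct) (auto simp: emb_add)

lemma emb_dense: assumes "x \<in> carrier K" "e > 0" obtains q where "nrm (x \<ominus>\<^bsub>K\<^esub> emb q) < e"
proof -
  obtain a where a: "qp_cauchy p a" "x = cls a" using assms carrier_K_cases by blast
  have "e / 2 > 0" using assms by simp
  then obtain N where N: "\<forall>m\<ge>N. \<forall>n\<ge>N. pabs (a m - a n) < e / 2" using a unfolding qp_cauchy_def by blast
  have l: "(\<lambda>n. pabs (a n - a N)) \<longlonglongrightarrow> nrm (x \<ominus>\<^bsub>K\<^esub> emb (a N))"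
    unfolding a(2) qp_of_rat_def cls_diff[OF a(1) qp_cauchy_const]
    by (rule nrm_cls) (intro qp_cauchy_diff a qp_cauchy_const)
  have "nrm (x \<ominus>\<^bsub>K\<^esub> emb (a N)) \<le> e / 2"
    by (rule LIMSEQ_le_const2[OF l]) (use N in \<open>auto intro!: exI[of _ N] less_imp_le\<close>)
  thus ?thesis using that[of "a N"] assms by simp
qed

text \<open>Diagonal argument: \<open>Y n\<close> is replaced by a rational \<open>q n\<close> at
  distance below \<open>1 / Suc n\<close>; the sequence \<open>q\<close> is itself Cauchy and its
  class is the limit.\<close>

lemma K_complete:
  fixes Y :: "nat \<Rightarrow> qp"
  assumes Y: "\<And>n. Y n \<in> carrier K"
    and C: "\<And>e. e > 0 \<Longrightarrow> \<exists>N. \<forall>m\<ge>N. \<forall>n\<ge>N. nrm (Y m \<ominus>\<^bsub>K\<^esub> Y n) < e"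
  obtains L where "L \<in> carrier K" "(\<lambda>n. nrm (Y n \<ominus>\<^bsub>K\<^esub> L)) \<longlonglongrightarrow> 0"
proof -
  have "\<exists>q. \<forall>n. nrm (Y n \<ominus>\<^bsub>K\<^esub> emb (q n)) < 1 / Suc n"
  proof (rule choice, rule allI)
    fix n show "\<exists>q. nrm (Y n \<ominus>\<^bsub>K\<^esub> emb q) < 1 / Suc n"
      by (rule emb_dense[OF Y, of "1 / Suc n" n]) auto
  qed
  then obtain q where q: "\<And>n. nrm (Y n \<ominus>\<^bsub>K\<^esub> emb (q n)) < 1 / Suc n" by blast
  have small: "\<exists>N. \<forall>n\<ge>N. 1 / Suc n < e" if "e > 0" for e :: real
  proof -
    obtain N where "1 / Suc N < e" using nat_approx_posE[OF \<open>e > 0\<close>] by blast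
    moreover have "1 / real (Suc n) \<le> 1 / Suc N" if "n \<ge> N" for n using that by (intro frac_le) auto
    ultimately show ?thesis by (meson order_le_less_trans)
  qed
  have qc: "qp_cauchy p q" unfolding qp_cauchy_def
  proof (intro allI impI)
    fix e :: real assume e: "e > 0"
    obtain N where N: "\<forall>m\<ge>N. \<forall>n\<ge>N. nrm (Y m \<ominus>\<^bsub>K\<^esub> Y n) < e" using C e by blast
    obtain N' where N': "\<forall>n\<ge>N'. 1 / Suc n < e" using small e by blast
    have "pabs (q m - q n) < e" if "m \<ge> max N N'" "n \<ge> max N N'" for m n
    proof -
      have "nrm (emb (q m) \<ominus>\<^bsub>K\<^esub> Y m) < e" "nrm (Y n \<ominus>\<^bsub>K\<^esub> emb (q n)) < e" "nrm (Y m \<ominus>\<^bsub>K\<^esub> Y n) < e"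
        using q[of m] q[of n] N' N that nrm_diff_commute[of "Y m" "emb (q m)"] Y by (auto intro: order.strict_trans)
      hence "nrm (emb (q m) \<ominus>\<^bsub>K\<^esub> emb (q n)) < e"
        using nrm_diff_trans[of "emb (q m)" "Y m" "emb (q n)"]
          nrm_diff_trans[of "Y m" "Y n" "emb (q n)"] Y by fastforce
      thus ?thesis by (simp flip: emb_diff)
    qed
    thus "\<exists>N. \<forall>m\<ge>N. \<forall>n\<ge>N. pabs (q m - q n) < e" by blast
  qed
  have "(\<lambda>n. nrm (Y n \<ominus>\<^bsub>K\<^esub> cls q)) \<longlonglongrightarrow> 0"
  proof (rule LIMSEQ_I)
    fix e :: real assume e: "e > 0"
    obtain N where N: "\<forall>m\<ge>N. \<forall>n\<ge>N. pabs (q m - q n) < e / 2" using qc e unfolding qp_cauchy_def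
      by (meson half_gt_zero)
    obtain N' where N': "\<forall>n\<ge>N'. 1 / Suc n < e" using small e by blast
    have "nrm (Y n \<ominus>\<^bsub>K\<^esub> cls q) < e" if n: "n \<ge> max N N'" for n
    proof -
      have l: "(\<lambda>m. pabs (q n - q m)) \<longlonglongrightarrow> nrm (emb (q n) \<ominus>\<^bsub>K\<^esub> cls q)"
        unfolding qp_of_rat_def cls_diff[OF qp_cauchy_const qc]
        by (rule nrm_cls) (intro qp_cauchy_diff qc qp_cauchy_const)
      have "nrm (emb (q n) \<ominus>\<^bsub>K\<^esub> cls q) \<le> e / 2"
        by (rule LIMSEQ_le_const2[OF l]) (use N n in \<open>auto intro!: exI[of _ N] less_imp_le\<close>)
      moreover have "nrm (Y n \<ominus>\<^bsub>K\<^esub> emb (q n)) < e" using q[of n] N' n by (auto intro: order.strict_trans)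
      ultimately show ?thesis using nrm_diff_trans[of "Y n" "emb (q n)" "cls q"] Y qc e by auto
    qed
    thus "\<exists>no. \<forall>n\<ge>no. norm (nrm (Y n \<ominus>\<^bsub>K\<^esub> cls q) - 0) < e"
      using nrm_nonneg Y qc by (intro exI[of _ "max N N'"]) auto
  qed
  thus ?thesis by (rule that[OF cls_closed[OF qc]])
qed

end

section \<open>Row-finite matrices and the group K1\<close>

text \<open>Finitary matrices are not closed under addition. The row-finite ones form a ring under
  \<open>inf_mult\<close>, in which computations with \<open>1 + Z\<close> can be carried out.\<close>
definition rfm :: "('a, 'm) ring_scheme \<Rightarrow> (nat \<Rightarrow> nat \<Rightarrow> 'a) ring" where
  "rfm R = \<lparr> carrier = {A. (\<forall>i j. A i j \<in> carrier R) \<and> (\<forall>i. finite {k. A i k \<noteq> \<zero>\<^bsub>R\<^esub>})},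
             monoid.mult = inf_mult R, one = mat_one R,
             ring.zero = (\<lambda>i j. \<zero>\<^bsub>R\<^esub>), ring.add = (\<lambda>A B i j. A i j \<oplus>\<^bsub>R\<^esub> B i j) \<rparr>"

definition supported_below :: "('a, 'm) ring_scheme \<Rightarrow> nat \<Rightarrow> (nat \<Rightarrow> nat \<Rightarrow> 'a) \<Rightarrow> bool" where
  "supported_below R r A \<longleftrightarrow> (\<forall>i j. A i j \<in> carrier R) \<and> (\<forall>i j. r \<le> i \<or> r \<le> j \<longrightarrow> A i j = mat_one R i j)"

definition elem_mat :: "('a, 'm) ring_scheme \<Rightarrow> nat \<Rightarrow> nat \<Rightarrow> 'a \<Rightarrow> nat \<Rightarrow> nat \<Rightarrow> 'a" where
  "elem_mat R i j a = (\<lambda>k l. if k = i \<and> l = j then a else mat_one R k l)"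

definition unit_mat :: "('a, 'm) ring_scheme \<Rightarrow> nat \<Rightarrow> nat \<Rightarrow> 'a \<Rightarrow> nat \<Rightarrow> nat \<Rightarrow> 'a" where
  "unit_mat R i j a = (\<lambda>k l. if k = i \<and> l = j then a else \<zero>\<^bsub>R\<^esub>)"

lemma finitary_iff: "finitary R A \<longleftrightarrow> (\<exists>r. supported_below R r A)"
  by (auto simp: finitary_def supported_below_def)

lemma supported_below_mono: "supported_below R r A \<Longrightarrow> r \<le> s \<Longrightarrow> supported_below R s A"
  by (auto simp: supported_below_def)

lemma elementary_eq: "elementary R = {elem_mat R i j a | i j a. i \<noteq> j \<and> a \<in> carrier R}"
  by (simp add: elementary_def elem_mat_def)

lemma rfm_simps:
  "\<zero>\<^bsub>rfm R\<^esub> = (\<lambda>i j. \<zero>\<^bsub>R\<^esub>)" "\<one>\<^bsub>rfm R\<^esub> = mat_one R" "monoid.mult (rfm R) = inf_mult R"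
  "A \<oplus>\<^bsub>rfm R\<^esub> B = (\<lambda>i j. A i j \<oplus>\<^bsub>R\<^esub> B i j)"
  by (simp_all add: rfm_def)

lemma rfm_closedD: "A \<in> carrier (rfm R) \<Longrightarrow> A i j \<in> carrier R"
  and rfm_finite_row: "A \<in> carrier (rfm R) \<Longrightarrow> finite {k. A i k \<noteq> \<zero>\<^bsub>R\<^esub>}"
  by (auto simp: rfm_def)

lemma rfmI: "(\<And>i j. A i j \<in> carrier R) \<Longrightarrow> (\<And>i. finite {k. A i k \<noteq> \<zero>\<^bsub>R\<^esub>}) \<Longrightarrow> A \<in> carrier (rfm R)"
  by (auto simp: rfm_def)

context ring begin

text \<open>The defining sum runs over the support of a row of \<open>A\<close>. Replacing it by any
  finite set that carries the nonzero products makes sums over different rows comparable.\<close>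

lemma inf_mult_eq:
  assumes "\<And>i j. A i j \<in> carrier R" "\<And>i j. B i j \<in> carrier R"
    "finite S" "\<And>k. k \<notin> S \<Longrightarrow> A i k = \<zero> \<or> B k j = \<zero>"  "finite {k. A i k \<noteq> \<zero>}"
  shows "inf_mult R A B i j = (\<Oplus>k\<in>S. A i k \<otimes> B k j)"
  unfolding inf_mult_def
  by (rule add.finprod_mono_neutral_cong) (use assms in \<open>auto dest: assms(4)\<close>)

lemma rfm_mult_closed:
  assumes "A \<in> carrier (rfm R)" "B \<in> carrier (rfm R)"
  shows "inf_mult R A B \<in> carrier (rfm R)"
proof (rule rfmI)
  fix i j show "inf_mult R A B i j \<in> carrier R"
    unfolding inf_mult_def by (rule finsum_closed) (auto intro: rfm_closedD assms)
next
  fix i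
  have "inf_mult R A B i j = \<zero>" if "j \<notin> (\<Union>k\<in>{k. A i k \<noteq> \<zero>}. {j. B k j \<noteq> \<zero>})" for j
    unfolding inf_mult_def by (rule add.finprod_one_eqI) (use that rfm_closedD[OF assms(1)] in auto)
  hence "{j. inf_mult R A B i j \<noteq> \<zero>} \<subseteq> (\<Union>k\<in>{k. A i k \<noteq> \<zero>}. {j. B k j \<noteq> \<zero>})" by blast
  moreover have "finite (\<Union>k\<in>{k. A i k \<noteq> \<zero>}. {j. B k j \<noteq> \<zero>})"
    using assms by (auto intro: rfm_finite_row)
  ultimately show "finite {j. inf_mult R A B i j \<noteq> \<zero>}" by (rule finite_subset)
qed

lemma inf_mult_rfm:
  assumes "A \<in> carrier (rfm R)" "B \<in> carrier (rfm R)" "finite S" "\<And>k. k \<notin> S \<Longrightarrow> A i k = \<zero> \<or> B k j = \<zero>"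
  shows "inf_mult R A B i j = (\<Oplus>k\<in>S. A i k \<otimes> B k j)"
  by (rule inf_mult_eq) (use assms in \<open>auto intro: rfm_closedD rfm_finite_row\<close>)

lemma inf_mult_assoc:
  assumes A: "A \<in> carrier (rfm R)" and B: "B \<in> carrier (rfm R)" and C: "C \<in> carrier (rfm R)"
  shows "inf_mult R (inf_mult R A B) C = inf_mult R A (inf_mult R B C)"
proof (intro ext)
  fix i j
  note cl = rfm_closedD[OF A] rfm_closedD[OF B] rfm_closedD[OF C]
  note AB = rfm_mult_closed[OF A B] and BC = rfm_mult_closed[OF B C]
  define S where "S = {k. A i k \<noteq> \<zero>}"
  \<comment> \<open>\<open>T\<close> collects the columns reachable from row \<open>i\<close> in two
    steps, so both iterated sums live on the finite rectangle \<open>S\<close> times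
    \<open>T\<close> and may be swapped.\<close>
  define T where "T = (\<Union>k\<in>S. {j. B k j \<noteq> \<zero>})"
  have fin: "finite S" "finite T" using A B by (auto simp: S_def T_def intro: rfm_finite_row)
  have AB_eq: "inf_mult R A B i l = (\<Oplus>k\<in>S. A i k \<otimes> B k l)" for l
    by (simp add: inf_mult_def S_def)
  have AB0: "inf_mult R A B i l = \<zero>" if "l \<notin> T" for l
    unfolding AB_eq by (rule add.finprod_one_eqI) (use that cl in \<open>auto simp: T_def\<close>)
  have "inf_mult R (inf_mult R A B) C i j = (\<Oplus>l\<in>T. inf_mult R A B i l \<otimes> C l j)"
    by (rule inf_mult_rfm[OF AB C]) (use fin AB0 in auto)
  also have "\<dots> = (\<Oplus>l\<in>T. \<Oplus>k\<in>S. A i k \<otimes> (B k l \<otimes> C l j))"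
    by (rule finsum_cong') (use fin cl in \<open>auto simp: AB_eq finsum_ldistr Pi_def m_assoc intro!: finsum_closed\<close>)
  also have "\<dots> = (\<Oplus>k\<in>S. \<Oplus>l\<in>T. A i k \<otimes> (B k l \<otimes> C l j))"
    by (rule finsum_finsum_swap) (use fin cl in auto)
  also have "\<dots> = (\<Oplus>k\<in>S. A i k \<otimes> (\<Oplus>l\<in>T. B k l \<otimes> C l j))"
    by (rule finsum_cong') (use fin cl in \<open>auto simp: finsum_rdistr Pi_def intro!: finsum_closed\<close>)
  also have "\<dots> = (\<Oplus>k\<in>S. A i k \<otimes> inf_mult R B C k j)"
  proof (rule finsum_cong')
    fix k assume k: "k \<in> S"
    have "inf_mult R B C k j = (\<Oplus>l\<in>T. B k l \<otimes> C l j)"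
      by (rule inf_mult_rfm[OF B C]) (use fin k in \<open>auto simp: T_def\<close>)
    thus "A i k \<otimes> (\<Oplus>l\<in>T. B k l \<otimes> C l j) = A i k \<otimes> inf_mult R B C k j" by simp
  qed (use cl rfm_closedD[OF BC] in auto)
  also have "\<dots> = inf_mult R A (inf_mult R B C) i j"
    by (rule inf_mult_rfm[OF A BC, symmetric]) (use fin in \<open>auto simp: S_def\<close>)
  finally show "inf_mult R (inf_mult R A B) C i j = inf_mult R A (inf_mult R B C) i j" .
qed

lemma mat_one_closed: "mat_one R i j \<in> carrier R"
  by (simp add: mat_one_def)

lemma mat_one_rfm: "mat_one R \<in> carrier (rfm R)"
  by (rule rfmI) (auto simp: mat_one_def intro: finite_subset[of _ "{i}" for i])

lemma inf_mult_one_left: assumes "A \<in> carrier (rfm R)" shows "inf_mult R (mat_one R) A = A"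
proof (intro ext)
  fix i j
  have "inf_mult R (mat_one R) A i j = (\<Oplus>k\<in>{i}. mat_one R i k \<otimes> A k j)"
    by (rule inf_mult_rfm[OF mat_one_rfm assms]) (auto simp: mat_one_def)
  thus "inf_mult R (mat_one R) A i j = A i j" using rfm_closedD[OF assms]
    by (simp add: mat_one_def)
qed

lemma inf_mult_one_right: assumes "A \<in> carrier (rfm R)" shows "inf_mult R A (mat_one R) = A"
proof (intro ext)
  fix i j
  have "inf_mult R A (mat_one R) i j = (\<Oplus>k\<in>{j}. A i k \<otimes> mat_one R k j)"
    by (rule inf_mult_rfm[OF assms mat_one_rfm]) (auto simp: mat_one_def)
  thus "inf_mult R A (mat_one R) i j = A i j" using rfm_closedD[OF assms]
    by (simp add: mat_one_def)
qed

lemma rfm_add_closed: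
  assumes "A \<in> carrier (rfm R)" "B \<in> carrier (rfm R)"
  shows "(\<lambda>i j. A i j \<oplus> B i j) \<in> carrier (rfm R)"
proof (rule rfmI)
  fix i
  have "{k. A i k \<oplus> B i k \<noteq> \<zero>} \<subseteq> {k. A i k \<noteq> \<zero>} \<union> {k. B i k \<noteq> \<zero>}" by auto
  thus "finite {k. A i k \<oplus> B i k \<noteq> \<zero>}" using assms
    by (auto elim!: finite_subset intro: rfm_finite_row)
qed (use assms in \<open>auto intro: rfm_closedD\<close>)

lemma rfm_uminus_closed:
  assumes "A \<in> carrier (rfm R)" shows "(\<lambda>i j. \<ominus> A i j) \<in> carrier (rfm R)"
proof (rule rfmI)
  fix i
  have "{k. \<ominus> A i k \<noteq> \<zero>} \<subseteq> {k. A i k \<noteq> \<zero>}" by auto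
  thus "finite {k. \<ominus> A i k \<noteq> \<zero>}" using assms by (auto elim!: finite_subset intro: rfm_finite_row)
qed (use assms in \<open>auto intro: rfm_closedD\<close>)

lemma ring_rfm: "ring (rfm R)"
proof (rule ringI)
  show "abelian_group (rfm R)"
  proof (rule abelian_groupI)
    fix A assume A: "A \<in> carrier (rfm R)"
    show "\<exists>y\<in>carrier (rfm R). y \<oplus>\<^bsub>rfm R\<^esub> A = \<zero>\<^bsub>rfm R\<^esub>"
      by (rule bexI[OF _ rfm_uminus_closed[OF A]]) (use rfm_closedD[OF A] in \<open>auto simp: rfm_simps l_neg\<close>)
  next
    show "\<zero>\<^bsub>rfm R\<^esub> \<in> carrier (rfm R)" by (auto simp: rfm_simps intro: rfmI)
  qed (auto simp: rfm_simps rfm_add_closed rfm_closedD a_ac)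
next
  show "Group.monoid (rfm R)"
    by (rule Group.monoidI) (auto simp: rfm_simps rfm_mult_closed mat_one_rfm inf_mult_assoc
        inf_mult_one_left inf_mult_one_right)
next
  fix A B C assume A: "A \<in> carrier (rfm R)" and B: "B \<in> carrier (rfm R)" and C: "C \<in> carrier (rfm R)"
  note cl = rfm_closedD[OF A] rfm_closedD[OF B] rfm_closedD[OF C]
  show "(A \<oplus>\<^bsub>rfm R\<^esub> B) \<otimes>\<^bsub>rfm R\<^esub> C = A \<otimes>\<^bsub>rfm R\<^esub> C \<oplus>\<^bsub>rfm R\<^esub> B \<otimes>\<^bsub>rfm R\<^esub> C"
    unfolding rfm_simps
  proof (intro ext)
    fix i j
    define S where "S = {k. A i k \<noteq> \<zero>} \<union> {k. B i k \<noteq> \<zero>}"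
    have fin: "finite S" using A B by (auto simp: S_def intro: rfm_finite_row)
    have 1: "inf_mult R (\<lambda>i j. A i j \<oplus> B i j) C i j = (\<Oplus>k\<in>S. (A i k \<oplus> B i k) \<otimes> C k j)"
      by (rule inf_mult_rfm[OF rfm_add_closed[OF A B] C fin]) (auto simp: S_def)
    have 2: "inf_mult R A C i j = (\<Oplus>k\<in>S. A i k \<otimes> C k j)"
      by (rule inf_mult_rfm[OF A C fin]) (auto simp: S_def)
    have 3: "inf_mult R B C i j = (\<Oplus>k\<in>S. B i k \<otimes> C k j)"
      by (rule inf_mult_rfm[OF B C fin]) (auto simp: S_def)
    show "inf_mult R (\<lambda>i j. A i j \<oplus> B i j) C i j = inf_mult R A C i j \<oplus> inf_mult R B C i j"
      unfolding 1 2 3 using cl by (simp add: l_distr finsum_addf Pi_def)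
  qed
  show "C \<otimes>\<^bsub>rfm R\<^esub> (A \<oplus>\<^bsub>rfm R\<^esub> B) = C \<otimes>\<^bsub>rfm R\<^esub> A \<oplus>\<^bsub>rfm R\<^esub> C \<otimes>\<^bsub>rfm R\<^esub> B"
    unfolding rfm_simps
  proof (intro ext)
    fix i j
    show "inf_mult R C (\<lambda>i j. A i j \<oplus> B i j) i j = inf_mult R C A i j \<oplus> inf_mult R C B i j"
      unfolding inf_mult_def using cl by (simp add: r_distr finsum_addf Pi_def)
  qed
qed

lemma supported_below_rfm: assumes "supported_below R r A" shows "A \<in> carrier (rfm R)"
proof (rule rfmI)
  fix i
  have "{k. A i k \<noteq> \<zero>} \<subseteq> {..<r} \<union> {i}" using assms
    by (auto simp: supported_below_def mat_one_def) (metis not_le_imp_less)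
  thus "finite {k. A i k \<noteq> \<zero>}" by (rule finite_subset) auto
qed (use assms in \<open>auto simp: supported_below_def\<close>)

lemma supported_below_one: "supported_below R r (mat_one R)"
  by (simp add: supported_below_def mat_one_closed)

text \<open>Outside the block one factor has a row or a column of the identity, which leaves a
  single summand; inside, this is the usual matrix product.\<close>

lemma inf_mult_supported:
  assumes A: "supported_below R r A" and B: "supported_below R r B"
  shows "inf_mult R A B i j = (if i < r \<and> j < r then \<Oplus>k\<in>{..<r}. A i k \<otimes> B k j else mat_one R i j)"
proof -
  note rA = supported_below_rfm[OF A] and rB = supported_below_rfm[OF B]
  note cl = rfm_closedD[OF rA] rfm_closedD[OF rB]
  consider "i < r \<and> j < r" | "r \<le> i" | "r \<le> j" by linarith
  thus ?thesis
  proof cases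
    case 1
    thus ?thesis using inf_mult_rfm[OF rA rB, of "{..<r}" i j] A by (auto simp: supported_below_def mat_one_def)
  next
    case 2
    have "inf_mult R A B i j = (\<Oplus>k\<in>{i}. A i k \<otimes> B k j)"
      by (rule inf_mult_rfm[OF rA rB]) (use A 2 in \<open>auto simp: supported_below_def mat_one_def\<close>)
    thus ?thesis using A B 2 cl by (auto simp: supported_below_def mat_one_def)
  next
    case 3
    have "inf_mult R A B i j = (\<Oplus>k\<in>{j}. A i k \<otimes> B k j)"
      by (rule inf_mult_rfm[OF rA rB]) (use B 3 in \<open>auto simp: supported_below_def mat_one_def\<close>)
    thus ?thesis using A B 3 cl by (auto simp: supported_below_def mat_one_def)
  qed
qed

lemma supported_below_mult:
  assumes A: "supported_below R r A" and B: "supported_below R r B"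
  shows "supported_below R r (inf_mult R A B)"
  using inf_mult_supported[OF assms]
    rfm_closedD[OF rfm_mult_closed[OF supported_below_rfm[OF A] supported_below_rfm[OF B]]]
  by (auto simp: supported_below_def)

lemma supported_below_pow:
  "supported_below R r A \<Longrightarrow> supported_below R r (A [^]\<^bsub>rfm R\<^esub> (n::nat))"
  by (induction n) (auto simp: supported_below_one rfm_simps supported_below_mult)

lemma finitary_mult: "finitary R A \<Longrightarrow> finitary R B \<Longrightarrow> finitary R (inf_mult R A B)"
  unfolding finitary_iff by (meson supported_below_mult supported_below_mono nat_le_linear)

lemma finitary_rfm: "finitary R A \<Longrightarrow> A \<in> carrier (rfm R)"
  unfolding finitary_iff using supported_below_rfm by blast

lemma finitary_one: "finitary R (mat_one R)"
  unfolding finitary_iff using supported_below_one by blast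

lemma GLinf_I:
  "finitary R A \<Longrightarrow> finitary R B \<Longrightarrow> inf_mult R A B = mat_one R \<Longrightarrow> inf_mult R B A = mat_one R \<Longrightarrow> A \<in> carrier (GLinf R)"
  by (auto simp: GLinf_def)

lemma GLinf_E:
  assumes "A \<in> carrier (GLinf R)"
  obtains B where "finitary R A" "finitary R B" "inf_mult R A B = mat_one R" "inf_mult R B A = mat_one R"
  using assms by (auto simp: GLinf_def)

lemma GLinf_simps: "monoid.mult (GLinf R) = inf_mult R" "\<one>\<^bsub>GLinf R\<^esub> = mat_one R"
  by (simp_all add: GLinf_def)

lemma GLinf_finitary: "A \<in> carrier (GLinf R) \<Longrightarrow> finitary R A"
  by (auto simp: GLinf_def)

lemma group_GLinf: "group (GLinf R)"
proof (rule groupI)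
  interpret M: ring "rfm R" by (rule ring_rfm)
  fix A B assume A: "A \<in> carrier (GLinf R)" and B: "B \<in> carrier (GLinf R)"
  obtain A' where A': "finitary R A" "finitary R A'" "inf_mult R A A' = mat_one R" "inf_mult R A' A = mat_one R"
    using GLinf_E[OF A] .
  obtain B' where B': "finitary R B" "finitary R B'" "inf_mult R B B' = mat_one R" "inf_mult R B' B = mat_one R"
    using GLinf_E[OF B] .
  note r = A'(1,2)[THEN finitary_rfm] B'(1,2)[THEN finitary_rfm]
  have "A \<otimes>\<^bsub>rfm R\<^esub> B \<otimes>\<^bsub>rfm R\<^esub> (B' \<otimes>\<^bsub>rfm R\<^esub> A') = A \<otimes>\<^bsub>rfm R\<^esub> (B \<otimes>\<^bsub>rfm R\<^esub> B') \<otimes>\<^bsub>rfm R\<^esub> A'"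
    using r by (simp add: M.m_assoc)
  also have "\<dots> = mat_one R" using A' B' r by (simp add: rfm_simps inf_mult_one_right)
  finally have 1: "inf_mult R (inf_mult R A B) (inf_mult R B' A') = mat_one R" by (simp add: rfm_simps)
  have "B' \<otimes>\<^bsub>rfm R\<^esub> A' \<otimes>\<^bsub>rfm R\<^esub> (A \<otimes>\<^bsub>rfm R\<^esub> B) = B' \<otimes>\<^bsub>rfm R\<^esub> (A' \<otimes>\<^bsub>rfm R\<^esub> A) \<otimes>\<^bsub>rfm R\<^esub> B"
    using r by (simp add: M.m_assoc)
  also have "\<dots> = mat_one R" using A' B' r by (simp add: rfm_simps inf_mult_one_right)
  finally have 2: "inf_mult R (inf_mult R B' A') (inf_mult R A B) = mat_one R" by (simp add: rfm_simps)
  show "A \<otimes>\<^bsub>GLinf R\<^esub> B \<in> carrier (GLinf R)" unfolding GLinf_simps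
    by (rule GLinf_I[OF _ _ 1 2]) (use A' B' finitary_mult in auto)
next
  show "\<one>\<^bsub>GLinf R\<^esub> \<in> carrier (GLinf R)" unfolding GLinf_simps
    by (rule GLinf_I[of _ "mat_one R"]) (auto simp: finitary_one inf_mult_one_left mat_one_rfm)
next
  fix A assume A: "A \<in> carrier (GLinf R)"
  show "\<one>\<^bsub>GLinf R\<^esub> \<otimes>\<^bsub>GLinf R\<^esub> A = A"
    using GLinf_finitary[OF A] by (simp add: GLinf_simps inf_mult_one_left finitary_rfm)
  obtain A' where A': "finitary R A" "finitary R A'" "inf_mult R A A' = mat_one R" "inf_mult R A' A = mat_one R"
    using GLinf_E[OF A] .
  show "\<exists>y\<in>carrier (GLinf R). y \<otimes>\<^bsub>GLinf R\<^esub> A = \<one>\<^bsub>GLinf R\<^esub>"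
    by (rule bexI[of _ A']) (use A' in \<open>auto simp: GLinf_simps intro: GLinf_I\<close>)
qed (auto simp: GLinf_simps inf_mult_assoc GLinf_finitary finitary_rfm)

end

section \<open>Elementary matrices, their normality, and \<open>K1\<close>\<close>

locale matrix_ring = ring + M: ring "rfm R" + GL: group "GLinf R"

lemma (in ring) matrix_ring: "matrix_ring R"
  by (intro matrix_ring.intro ring_axioms ring_rfm group_GLinf)

context matrix_ring begin

lemma GL_pow: "A [^]\<^bsub>GLinf R\<^esub> (n::nat) = A [^]\<^bsub>rfm R\<^esub> n"
  by (induction n) (auto simp: GLinf_simps rfm_simps)

lemma GLinf_rfm: "A \<in> carrier (GLinf R) \<Longrightarrow> A \<in> carrier (rfm R)"
  by (simp add: GLinf_finitary finitary_rfm)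

lemma unit_mat_rfm: "a \<in> carrier R \<Longrightarrow> unit_mat R i j a \<in> carrier (rfm R)"
proof (rule rfmI)
  fix k show "finite {l. unit_mat R i j a k l \<noteq> \<zero>}"
    by (rule finite_subset[of _ "{j}"]) (auto simp: unit_mat_def)
qed (auto simp: unit_mat_def)

lemma elem_mat_eq:
  "i \<noteq> j \<Longrightarrow> a \<in> carrier R \<Longrightarrow> elem_mat R i j a = \<one>\<^bsub>rfm R\<^esub> \<oplus>\<^bsub>rfm R\<^esub> unit_mat R i j a"
  by (auto simp: elem_mat_def rfm_simps unit_mat_def mat_one_def fun_eq_iff)

lemma inf_mult_zeroI:
  assumes "A \<in> carrier (rfm R)" "B \<in> carrier (rfm R)" "\<And>i k j. A i k = \<zero> \<or> B k j = \<zero>"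
  shows "A \<otimes>\<^bsub>rfm R\<^esub> B = \<zero>\<^bsub>rfm R\<^esub>"
  unfolding rfm_simps
proof (intro ext)
  fix i j show "inf_mult R A B i j = \<zero>"
    using inf_mult_rfm[OF assms(1,2), of "{}" i j] assms(3) by auto
qed

lemma elem_mat_supported:
  "i < r \<Longrightarrow> j < r \<Longrightarrow> a \<in> carrier R \<Longrightarrow> supported_below R r (elem_mat R i j a)"
  by (auto simp: supported_below_def elem_mat_def mat_one_def)

lemma elem_mat_finitary: "a \<in> carrier R \<Longrightarrow> finitary R (elem_mat R i j a)"
  unfolding finitary_iff by (rule exI[of _ "Suc (max i j)"]) (rule elem_mat_supported, auto)

text \<open>Two unit matrices at the same off-diagonal place multiply to zero, so multiplying the
  elementary matrices adds the entries.\<close>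

lemma elem_mat_mult_uminus:
  assumes "i \<noteq> j" "a \<in> carrier R"
  shows "inf_mult R (elem_mat R i j a) (elem_mat R i j (\<ominus> a)) = mat_one R"
proof -
  let ?U = "unit_mat R i j a" and ?V = "unit_mat R i j (\<ominus> a)"
  have U: "?U \<in> carrier (rfm R)" and V: "?V \<in> carrier (rfm R)" using assms by (auto intro: unit_mat_rfm)
  have UV: "?U \<otimes>\<^bsub>rfm R\<^esub> ?V = \<zero>\<^bsub>rfm R\<^esub>" using assms
    by (intro inf_mult_zeroI U V) (auto simp: unit_mat_def)
  have s: "?U \<oplus>\<^bsub>rfm R\<^esub> ?V = \<zero>\<^bsub>rfm R\<^esub>" using assms by (auto simp: unit_mat_def rfm_simps r_neg fun_eq_iff)
  have "(\<one>\<^bsub>rfm R\<^esub> \<oplus>\<^bsub>rfm R\<^esub> ?U) \<otimes>\<^bsub>rfm R\<^esub> (\<one>\<^bsub>rfm R\<^esub> \<oplus>\<^bsub>rfm R\<^esub> ?V) = \<one>\<^bsub>rfm R\<^esub> \<oplus>\<^bsub>rfm R\<^esub> (?U \<oplus>\<^bsub>rfm R\<^esub> ?V)"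
    using U V UV by (simp add: M.l_distr M.r_distr M.a_ac)
  hence "elem_mat R i j a \<otimes>\<^bsub>rfm R\<^esub> elem_mat R i j (\<ominus> a) = \<one>\<^bsub>rfm R\<^esub>"
    using assms U V by (simp add: elem_mat_eq s)
  thus ?thesis by (simp add: rfm_simps)
qed

lemma elem_mat_GL:
  assumes "i \<noteq> j" "a \<in> carrier R" shows "elem_mat R i j a \<in> carrier (GLinf R)"
  by (rule GLinf_I[OF elem_mat_finitary elem_mat_finitary elem_mat_mult_uminus])
    (use assms elem_mat_mult_uminus[OF assms(1), of "\<ominus> a"] in auto)

lemma inv_elem_mat:
  assumes "i \<noteq> j" "a \<in> carrier R" shows "inv\<^bsub>GLinf R\<^esub> elem_mat R i j a = elem_mat R i j (\<ominus> a)"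
  by (rule GL.inv_equality) (use assms elem_mat_GL elem_mat_mult_uminus[OF assms(1), of "\<ominus> a"] in \<open>auto simp: GLinf_simps\<close>)

lemma elementary_GL: "elementary R \<subseteq> carrier (GLinf R)"
  by (auto simp: elementary_eq elem_mat_GL)

lemma Einf_subgroup: "subgroup (Einf R) (GLinf R)"
  unfolding Einf_def by (rule GL.generate_is_subgroup[OF elementary_GL])

lemma elem_mat_Einf: "i \<noteq> j \<Longrightarrow> a \<in> carrier R \<Longrightarrow> elem_mat R i j a \<in> Einf R"
  unfolding Einf_def by (rule generate.incl) (auto simp: elementary_eq)

lemma Einf_mult: "A \<in> Einf R \<Longrightarrow> B \<in> Einf R \<Longrightarrow> A \<otimes>\<^bsub>rfm R\<^esub> B \<in> Einf R"
  using subgroup.m_closed[OF Einf_subgroup] by (simp add: GLinf_simps rfm_simps)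

text \<open>\<open>generate\<close> has a case for inverses; it disappears because the inverse of an
  elementary matrix is elementary, by \<open>inv_elem_mat\<close>.\<close>

lemma Einf_induct [consumes 1, case_names one elem mult]:
  assumes "A \<in> Einf R" "P (mat_one R)" "\<And>i j a. i \<noteq> j \<Longrightarrow> a \<in> carrier R \<Longrightarrow> P (elem_mat R i j a)"
    "\<And>A B. A \<in> Einf R \<Longrightarrow> B \<in> Einf R \<Longrightarrow> P A \<Longrightarrow> P B \<Longrightarrow> P (inf_mult R A B)"
  shows "P A"
  using assms(1) unfolding Einf_def
proof (induction rule: generate.induct)
  case one thus ?case using assms(2) by (simp add: GLinf_simps)
next
  case (incl h) thus ?case using assms(3) by (auto simp: elementary_eq)
next
  case (inv h)
  then obtain i j a where "h = elem_mat R i j a" "i \<noteq> j" "a \<in> carrier R" by (auto simp: elementary_eq)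
  thus ?case using assms(3)[of i j "\<ominus> a"] by (simp add: inv_elem_mat)
next
  case (eng h1 h2) thus ?case using assms(4) by (simp add: GLinf_simps Einf_def)
qed

lemma column_Einf:
  assumes "\<And>k. v k \<in> carrier R" "n \<le> m"
  shows "\<one>\<^bsub>rfm R\<^esub> \<oplus>\<^bsub>rfm R\<^esub> (\<lambda>k l. if l = m \<and> k < n then v k else \<zero>) \<in> Einf R"
  using assms(2)
proof (induction n)
  case 0
  have "(\<lambda>k l. if l = m \<and> k < 0 then v k else \<zero>) = \<zero>\<^bsub>rfm R\<^esub>" by (simp add: rfm_simps)
  thus ?case using subgroup.one_closed[OF Einf_subgroup] by (simp only: M.r_zero[OF M.one_closed]) (simp add: GLinf_simps rfm_simps)
next
  case (Suc n)
  let ?U = "\<lambda>n k l. if l = m \<and> k < n then v k else \<zero>"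
  let ?E = "unit_mat R n m (v n)"
  have U: "?U n \<in> carrier (rfm R)" for n
    by (rule rfmI) (use assms in \<open>auto intro: finite_subset[of _ "{m}"]\<close>)
  have E: "?E \<in> carrier (rfm R)" using assms by (simp add: unit_mat_rfm)
  have "?U n \<otimes>\<^bsub>rfm R\<^esub> ?E = \<zero>\<^bsub>rfm R\<^esub>" using Suc.prems by (intro inf_mult_zeroI U E) (auto simp: unit_mat_def)
  hence "(\<one>\<^bsub>rfm R\<^esub> \<oplus>\<^bsub>rfm R\<^esub> ?U n) \<otimes>\<^bsub>rfm R\<^esub> (\<one>\<^bsub>rfm R\<^esub> \<oplus>\<^bsub>rfm R\<^esub> ?E) = \<one>\<^bsub>rfm R\<^esub> \<oplus>\<^bsub>rfm R\<^esub> (?U n \<oplus>\<^bsub>rfm R\<^esub> ?E)"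
    using U[of n] E by (simp add: M.l_distr M.r_distr M.a_ac)
  also have "?U n \<oplus>\<^bsub>rfm R\<^esub> ?E = ?U (Suc n)" using assms by (auto simp: rfm_simps unit_mat_def fun_eq_iff)
  finally have "\<one>\<^bsub>rfm R\<^esub> \<oplus>\<^bsub>rfm R\<^esub> ?U (Suc n) = (\<one>\<^bsub>rfm R\<^esub> \<oplus>\<^bsub>rfm R\<^esub> ?U n) \<otimes>\<^bsub>rfm R\<^esub> elem_mat R n m (v n)"
    using Suc.prems assms by (simp add: elem_mat_eq)
  thus ?case using Suc elem_mat_Einf[of n m "v n"] assms by (simp add: Einf_mult)
qed

text \<open>Transposed counterpart of \<open>column_Einf\<close>: the columns in use stay below
  \<open>m\<close>, so again no cross terms appear.\<close>

lemma row_Einf: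
  assumes "\<And>k. v k \<in> carrier R" "n \<le> m"
  shows "\<one>\<^bsub>rfm R\<^esub> \<oplus>\<^bsub>rfm R\<^esub> (\<lambda>k l. if k = m \<and> l < n then v l else \<zero>) \<in> Einf R"
  using assms(2)
proof (induction n)
  case 0
  have "(\<lambda>k l. if k = m \<and> l < 0 then v l else \<zero>) = \<zero>\<^bsub>rfm R\<^esub>" by (simp add: rfm_simps)
  thus ?case using subgroup.one_closed[OF Einf_subgroup] by (simp only: M.r_zero[OF M.one_closed]) (simp add: GLinf_simps rfm_simps)
next
  case (Suc n)
  let ?U = "\<lambda>n k l. if k = m \<and> l < n then v l else \<zero>"
  let ?E = "unit_mat R m n (v n)"
  have U: "?U n \<in> carrier (rfm R)" for n
    by (rule rfmI) (use assms in \<open>auto intro: finite_subset[of _ "{..<n}"]\<close>)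
  have E: "?E \<in> carrier (rfm R)" using assms by (simp add: unit_mat_rfm)
  have "?U n \<otimes>\<^bsub>rfm R\<^esub> ?E = \<zero>\<^bsub>rfm R\<^esub>" using Suc.prems by (intro inf_mult_zeroI U E) (auto simp: unit_mat_def)
  hence "(\<one>\<^bsub>rfm R\<^esub> \<oplus>\<^bsub>rfm R\<^esub> ?U n) \<otimes>\<^bsub>rfm R\<^esub> (\<one>\<^bsub>rfm R\<^esub> \<oplus>\<^bsub>rfm R\<^esub> ?E) = \<one>\<^bsub>rfm R\<^esub> \<oplus>\<^bsub>rfm R\<^esub> (?U n \<oplus>\<^bsub>rfm R\<^esub> ?E)"
    using U[of n] E by (simp add: M.l_distr M.r_distr M.a_ac)
  also have "?U n \<oplus>\<^bsub>rfm R\<^esub> ?E = ?U (Suc n)" using assms by (auto simp: rfm_simps unit_mat_def fun_eq_iff)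
  finally have "\<one>\<^bsub>rfm R\<^esub> \<oplus>\<^bsub>rfm R\<^esub> ?U (Suc n) = (\<one>\<^bsub>rfm R\<^esub> \<oplus>\<^bsub>rfm R\<^esub> ?U n) \<otimes>\<^bsub>rfm R\<^esub> elem_mat R m n (v n)"
    using Suc.prems assms by (simp add: elem_mat_eq)
  thus ?case using Suc elem_mat_Einf[of m n "v n"] assms by (simp add: Einf_mult)
qed

end

lemma (in ring) one_by_one_supported: "a \<in> carrier R \<Longrightarrow> r > 0 \<Longrightarrow> supported_below R r (one_by_one R a)"
  using mat_one_closed by (auto simp: supported_below_def one_by_one_def)

lemma (in ring) one_by_one_mult:
  assumes "a \<in> carrier R" "b \<in> carrier R"
  shows "inf_mult R (one_by_one R a) (one_by_one R b) = one_by_one R (a \<otimes> b)"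
  by (intro ext, subst inf_mult_supported[of 1])
    (use assms in \<open>auto simp: one_by_one_supported\<close>, auto simp: one_by_one_def lessThan_Suc mat_one_def)

lemma (in ring) one_by_one_one: "one_by_one R \<one> = mat_one R"
  by (auto simp: one_by_one_def mat_one_def fun_eq_iff)

text \<open>Of the words of length two in \<open>V\<close> and \<open>W\<close> only
  \<open>V W\<close> survives, and every word of length three contains a vanishing one.\<close>

lemma (in ring) commutator_square_zero:
  assumes V: "V \<in> carrier R" and W: "W \<in> carrier R"
    and "V \<otimes> V = \<zero>" "W \<otimes> W = \<zero>" "W \<otimes> V = \<zero>"
  shows "(\<one> \<oplus> V) \<otimes> (\<one> \<oplus> W) \<otimes> (\<one> \<oplus> \<ominus> V) \<otimes> (\<one> \<oplus> \<ominus> W) = \<one> \<oplus> V \<otimes> W"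
proof -
  have WVY: "W \<otimes> (V \<otimes> Y) = \<zero>" "V \<otimes> (V \<otimes> Y) = \<zero>" "W \<otimes> (W \<otimes> Y) = \<zero>" if "Y \<in> carrier R" for Y
    using assms that by (simp_all flip: m_assoc)
  have "(\<one> \<oplus> V) \<otimes> (\<one> \<oplus> W) \<otimes> (\<one> \<oplus> \<ominus> V) = \<one> \<oplus> W \<oplus> V \<otimes> W \<oplus> (V \<oplus> \<ominus> V)"
    using assms WVY by (simp add: l_distr r_distr l_minus r_minus m_assoc a_ac r_neg del: r_neg)
  also have "\<dots> = \<one> \<oplus> W \<oplus> V \<otimes> W" using assms by (simp add: r_neg)
  also have "\<dots> \<otimes> (\<one> \<oplus> \<ominus> W) = \<one> \<oplus> V \<otimes> W \<oplus> (W \<oplus> \<ominus> W)"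
    using assms WVY by (simp add: l_distr r_distr l_minus r_minus m_assoc a_ac r_neg del: r_neg)
  also have "\<dots> = \<one> \<oplus> V \<otimes> W" using assms by (simp add: r_neg)
  finally show ?thesis .
qed

context matrix_ring begin

text \<open>For a matrix unit \<open>e\<close>, the product \<open>g e g\<^sup>-\<^sup>1\<close> is a column \<open>v\<close> times a row \<open>w\<close> with \<open>w v = 0\<close>;
  moving both through a fresh index turns \<open>1 + v w\<close> into a commutator of elements of \<open>Einf\<close>.\<close>
lemma Einf_conj_elem:
  assumes g: "g \<in> carrier (GLinf R)" and ij: "i \<noteq> j" and a: "a \<in> carrier R"
  shows "g \<otimes>\<^bsub>GLinf R\<^esub> elem_mat R i j a \<otimes>\<^bsub>GLinf R\<^esub> inv\<^bsub>GLinf R\<^esub> g \<in> Einf R"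
proof -
  define h where "h = inv\<^bsub>GLinf R\<^esub> g"
  have h: "h \<in> carrier (GLinf R)" using g by (simp add: h_def)
  note gr = GLinf_rfm[OF g] and hr = GLinf_rfm[OF h]
  note cl = rfm_closedD[OF gr] rfm_closedD[OF hr]
  have hg: "inf_mult R h g = mat_one R" and gh: "inf_mult R g h = mat_one R"
    using GL.l_inv[OF g] GL.r_inv[OF g] by (simp_all add: h_def GLinf_simps)
  obtain r1 r2 where r12: "supported_below R r1 g" "supported_below R r2 h"
    using GLinf_finitary[OF g] GLinf_finitary[OF h] unfolding finitary_iff by blast
  \<comment> \<open>\<open>Suc (max i j)\<close> forces \<open>i\<close> and \<open>j\<close> into
    the block, so that \<open>r\<close> is an index untouched by \<open>g\<close> and
    \<open>h\<close> and different from both.\<close>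
  define r where "r = max (max r1 r2) (Suc (max i j))"
  have sg: "supported_below R r g" and sh: "supported_below R r h" and ir: "i < r" and jr: "j < r"
    using r12 by (auto simp: r_def intro: supported_below_mono)
  define V where "V = (\<lambda>k l. if l = r \<and> k < r then g k i \<otimes> a else \<zero>)"
  define V' where "V' = (\<lambda>k l. if l = r \<and> k < r then \<ominus> (g k i \<otimes> a) else \<zero>)"
  define W where "W = (\<lambda>k l. if k = r \<and> l < r then h j l else \<zero>)"
  define W' where "W' = (\<lambda>k l. if k = r \<and> l < r then \<ominus> h j l else \<zero>)"
  define U where "U = unit_mat R i j a"
  have Ur: "U \<in> carrier (rfm R)" using a by (simp add: U_def unit_mat_rfm)
  have E: "\<one>\<^bsub>rfm R\<^esub> \<oplus>\<^bsub>rfm R\<^esub> V \<in> Einf R" "\<one>\<^bsub>rfm R\<^esub> \<oplus>\<^bsub>rfm R\<^esub> V' \<in> Einf R"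
    "\<one>\<^bsub>rfm R\<^esub> \<oplus>\<^bsub>rfm R\<^esub> W \<in> Einf R" "\<one>\<^bsub>rfm R\<^esub> \<oplus>\<^bsub>rfm R\<^esub> W' \<in> Einf R"
    unfolding V_def V'_def W_def W'_def by (auto intro!: column_Einf row_Einf simp: cl a)
  have Vr: "V \<in> carrier (rfm R)" and V'r: "V' \<in> carrier (rfm R)" and Wr: "W \<in> carrier (rfm R)"
    and W'r: "W' \<in> carrier (rfm R)"
    by (rule rfmI; use cl a in \<open>auto simp: V_def V'_def W_def W'_def
        intro: finite_subset[of _ "{r}"] finite_subset[of _ "{..<r}"]\<close>)+
  have V': "V' = \<ominus>\<^bsub>rfm R\<^esub> V"
    by (rule M.minus_equality[symmetric, OF _ Vr V'r]) (use cl a in \<open>auto simp: rfm_simps V_def V'_def fun_eq_iff l_neg\<close>)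
  have W': "W' = \<ominus>\<^bsub>rfm R\<^esub> W"
    by (rule M.minus_equality[symmetric, OF _ Wr W'r]) (use cl a in \<open>auto simp: rfm_simps W_def W'_def fun_eq_iff l_neg\<close>)
  have VV: "V \<otimes>\<^bsub>rfm R\<^esub> V = \<zero>\<^bsub>rfm R\<^esub>" by (intro inf_mult_zeroI Vr) (auto simp: V_def)
  have WW: "W \<otimes>\<^bsub>rfm R\<^esub> W = \<zero>\<^bsub>rfm R\<^esub>" by (intro inf_mult_zeroI Wr) (auto simp: W_def)
  have "inf_mult R W V k l = \<zero>" for k l
  proof -
    have "inf_mult R W V k l = (\<Oplus>s\<in>{..<r}. W k s \<otimes> V s l)"
      by (rule inf_mult_rfm[OF Wr Vr]) (auto simp: V_def)
    also have "\<dots> = \<zero>"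
    proof (cases "k = r \<and> l = r")
      \<comment> \<open>At \<open>(r, r)\<close> the product is the entry \<open>(j, i)\<close> of
        \<open>h g\<close> times \<open>a\<close>, and that is an off-diagonal entry of the
        identity.\<close>
      case True
      have "(\<Oplus>s\<in>{..<r}. W k s \<otimes> V s l) = (\<Oplus>s\<in>{..<r}. (h j s \<otimes> g s i) \<otimes> a)"
        by (rule finsum_cong') (use True cl a in \<open>auto simp: V_def W_def m_assoc\<close>)
      also have "\<dots> = (\<Oplus>s\<in>{..<r}. h j s \<otimes> g s i) \<otimes> a"
        using cl a by (simp add: finsum_ldistr Pi_def)
      also have "(\<Oplus>s\<in>{..<r}. h j s \<otimes> g s i) = inf_mult R h g j i"
        using inf_mult_supported[OF sh sg] ir jr by simp
      finally show ?thesis using hg ij a by (simp add: mat_one_def)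
    next
      case False
      show ?thesis by (rule add.finprod_one_eqI) (use False rfm_closedD[OF Vr] rfm_closedD[OF Wr] cl a in \<open>auto simp: V_def W_def\<close>)
    qed
    finally show ?thesis .
  qed
  hence WV: "W \<otimes>\<^bsub>rfm R\<^esub> V = \<zero>\<^bsub>rfm R\<^esub>" by (simp add: rfm_simps fun_eq_iff)
  have VW: "V \<otimes>\<^bsub>rfm R\<^esub> W = g \<otimes>\<^bsub>rfm R\<^esub> (U \<otimes>\<^bsub>rfm R\<^esub> h)"
    unfolding rfm_simps
  proof (intro ext)
    fix k l
    have "inf_mult R V W k l = (\<Oplus>s\<in>{r}. V k s \<otimes> W s l)"
      by (rule inf_mult_rfm[OF Vr Wr]) (auto simp: V_def)
    hence 1: "inf_mult R V W k l = V k r \<otimes> W r l" using rfm_closedD[OF Vr] rfm_closedD[OF Wr] by simp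
    have "inf_mult R U h i l = (\<Oplus>s\<in>{j}. U i s \<otimes> h s l)"
      by (rule inf_mult_rfm[OF Ur hr]) (auto simp: U_def unit_mat_def)
    hence 2: "inf_mult R U h i l = a \<otimes> h j l" using cl a by (simp add: U_def unit_mat_def)
    have 3: "inf_mult R U h k l = \<zero>" if "k \<noteq> i" for k
      using inf_mult_rfm[OF Ur hr, of "{}" k l] that by (simp add: U_def unit_mat_def)
    have "inf_mult R g (inf_mult R U h) k l = (\<Oplus>s\<in>{i}. g k s \<otimes> inf_mult R U h s l)"
      by (rule inf_mult_rfm[OF gr rfm_mult_closed[OF Ur hr]]) (use 3 in auto)
    hence 4: "inf_mult R g (inf_mult R U h) k l = g k i \<otimes> a \<otimes> h j l" using cl a 2 by (simp add: m_assoc)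
    \<comment> \<open>\<open>V\<close> and \<open>W\<close> were cut off at \<open>r\<close>.
      Nothing is lost: beyond the block, column \<open>i\<close> of \<open>g\<close> and row
      \<open>j\<close> of \<open>h\<close> are those of the identity and hence zero.\<close>
    have "g k i = \<zero>" if "r \<le> k" using sg that ir by (auto simp: supported_below_def mat_one_def)
    moreover have "h j l = \<zero>" if "r \<le> l" using sh that jr by (auto simp: supported_below_def mat_one_def)
    ultimately show "inf_mult R V W k l = inf_mult R g (inf_mult R U h) k l"
      unfolding 1 4 using cl a by (auto simp: V_def W_def not_less)
  qed
  have "g \<otimes>\<^bsub>rfm R\<^esub> (\<one>\<^bsub>rfm R\<^esub> \<oplus>\<^bsub>rfm R\<^esub> U) \<otimes>\<^bsub>rfm R\<^esub> h = g \<otimes>\<^bsub>rfm R\<^esub> h \<oplus>\<^bsub>rfm R\<^esub> g \<otimes>\<^bsub>rfm R\<^esub> (U \<otimes>\<^bsub>rfm R\<^esub> h)"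
    using gr hr Ur by (simp add: M.l_distr M.r_distr M.m_assoc)
  also have "\<dots> = \<one>\<^bsub>rfm R\<^esub> \<oplus>\<^bsub>rfm R\<^esub> V \<otimes>\<^bsub>rfm R\<^esub> W" unfolding VW using gh by (simp add: rfm_simps(2,3))
  also have "\<dots> \<in> Einf R"
    unfolding M.commutator_square_zero[OF Vr Wr VV WW WV, symmetric] V'[symmetric] W'[symmetric]
    by (intro Einf_mult E)
  finally show ?thesis using a ij by (simp add: elem_mat_eq U_def h_def GLinf_simps rfm_simps(3))
qed

text \<open>Conjugation is multiplicative, so \<open>Einf_conj_elem\<close> on the generators
  suffices. Normality is what makes the quotient defining \<open>K1\<close> a group.\<close>

lemma Einf_normal: "Einf R \<lhd> GLinf R"
proof -
  have "g \<otimes>\<^bsub>GLinf R\<^esub> A \<otimes>\<^bsub>GLinf R\<^esub> inv\<^bsub>GLinf R\<^esub> g \<in> Einf R" if g: "g \<in> carrier (GLinf R)" and A: "A \<in> Einf R" for g A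
    using A
  proof (induction rule: Einf_induct)
    case one thus ?case using g subgroup.one_closed[OF Einf_subgroup]
      by (simp flip: GLinf_simps(2))
  next
    case (elem i j a) thus ?case by (rule Einf_conj_elem[OF g])
  next
    case (mult A B)
    have AB: "A \<in> carrier (GLinf R)" "B \<in> carrier (GLinf R)"
      using mult subgroup.subset[OF Einf_subgroup] by auto
    have "g \<otimes>\<^bsub>GLinf R\<^esub> inf_mult R A B \<otimes>\<^bsub>GLinf R\<^esub> inv\<^bsub>GLinf R\<^esub> g =
      (g \<otimes>\<^bsub>GLinf R\<^esub> A \<otimes>\<^bsub>GLinf R\<^esub> inv\<^bsub>GLinf R\<^esub> g) \<otimes>\<^bsub>GLinf R\<^esub> (g \<otimes>\<^bsub>GLinf R\<^esub> B \<otimes>\<^bsub>GLinf R\<^esub> inv\<^bsub>GLinf R\<^esub> g)"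
      using AB g by (simp add: GL.m_assoc GL.inv_solve_left' flip: GLinf_simps(1))
        (simp add: GL.m_assoc[symmetric])
    thus ?case using mult subgroup.m_closed[OF Einf_subgroup] by simp
  qed
  thus ?thesis unfolding GL.normal_inv_iff using Einf_subgroup by blast
qed

lemma group_K1: "group (K1 R)"
  unfolding K1_def by (rule normal.factorgroup_is_group[OF Einf_normal])

lemma K1_class_hom: "K1_class R \<in> hom (GLinf R) (K1 R)"
  using normal.r_coset_hom_Mod[OF Einf_normal] by (simp add: K1_def K1_class_def[abs_def])

lemma K1_class_Einf: "A \<in> Einf R \<Longrightarrow> K1_class R A = \<one>\<^bsub>K1 R\<^esub>"
  using GL.coset_join2[OF _ Einf_subgroup] subgroup.subset[OF Einf_subgroup]
  by (auto simp: K1_class_def K1_def)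

lemma K1_cases: assumes "x \<in> carrier (K1 R)" obtains A where "A \<in> carrier (GLinf R)" "x = K1_class R A"
  using assms by (auto simp: K1_def FactGroup_def RCOSETS_def K1_class_def)

lemma mem_K1_class: "Y \<in> K1_class R A \<longleftrightarrow> (\<exists>E\<in>Einf R. Y = inf_mult R E A)"
  by (auto simp: K1_class_def r_coset_def GLinf_simps)

end

section \<open>Functoriality of matrices under ring homomorphisms\<close>

lemma (in ring) hom_finsum_additive:
  assumes "ring S" "\<And>x y. x \<in> carrier R \<Longrightarrow> y \<in> carrier R \<Longrightarrow> h (x \<oplus> y) = h x \<oplus>\<^bsub>S\<^esub> h y"
    "\<And>x. x \<in> carrier R \<Longrightarrow> h x \<in> carrier S" "h \<zero> = \<zero>\<^bsub>S\<^esub>" "\<And>i. i \<in> A \<Longrightarrow> f i \<in> carrier R"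
  shows "h (finsum R f A) = finsum S (\<lambda>i. h (f i)) A"
proof -
  interpret S: ring S by fact
  show ?thesis using assms(5)
  proof (induction A rule: infinite_finite_induct)
    case (insert x F)
    thus ?case using assms(2-4) by (simp add: Pi_def)
  qed (simp_all add: assms)
qed

definition map_entries :: "('a \<Rightarrow> 'b) \<Rightarrow> (nat \<Rightarrow> nat \<Rightarrow> 'a) \<Rightarrow> nat \<Rightarrow> nat \<Rightarrow> 'b" where
  "map_entries h A = (\<lambda>i j. h (A i j))"

locale matrix_ring_hom = R?: matrix_ring R + S?: matrix_ring S + ring_hom_ring R S h
  for R (structure) and S (structure) and h

lemma (in ring_hom_ring) matrix_ring_hom: "matrix_ring_hom R S h"
  by (intro matrix_ring_hom.intro R.matrix_ring S.matrix_ring ring_hom_ring_axioms)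

context matrix_ring_hom begin

lemma map_entries_one: "map_entries h (mat_one R) = mat_one S"
  by (auto simp: map_entries_def mat_one_def fun_eq_iff)

lemma map_entries_supported: "supported_below R r A \<Longrightarrow> supported_below S r (map_entries h A)"
  using map_entries_one by (auto simp: supported_below_def map_entries_def fun_eq_iff)

lemma map_entries_finitary: "finitary R A \<Longrightarrow> finitary S (map_entries h A)"
  unfolding finitary_iff using map_entries_supported by blast

lemma map_entries_rfm: assumes "A \<in> carrier (rfm R)" shows "map_entries h A \<in> carrier (rfm S)"
proof (rule rfmI)
  fix i
  have "{k. map_entries h A i k \<noteq> \<zero>\<^bsub>S\<^esub>} \<subseteq> {k. A i k \<noteq> \<zero>}" by (auto simp: map_entries_def)
  thus "finite {k. map_entries h A i k \<noteq> \<zero>\<^bsub>S\<^esub>}" using rfm_finite_row[OF assms] by (rule finite_subset)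
qed (use rfm_closedD[OF assms] in \<open>auto simp: map_entries_def\<close>)

lemma map_entries_mult:
  assumes A: "A \<in> carrier (rfm R)" and B: "B \<in> carrier (rfm R)"
  shows "map_entries h (inf_mult R A B) = inf_mult S (map_entries h A) (map_entries h B)"
proof (intro ext)
  fix i j
  define T where "T = {k. A i k \<noteq> \<zero>}"
  have fin: "finite T" using rfm_finite_row[OF A] by (simp add: T_def)
  note cl = rfm_closedD[OF A] rfm_closedD[OF B]
  have "map_entries h (inf_mult R A B) i j = h (\<Oplus>k\<in>T. A i k \<otimes> B k j)"
    by (simp add: map_entries_def inf_mult_def T_def)
  also have "\<dots> = (\<Oplus>\<^bsub>S\<^esub>k\<in>T. h (A i k \<otimes> B k j))"
    by (rule R.hom_finsum_additive) (use cl S.ring_axioms in auto)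
  also have "\<dots> = (\<Oplus>\<^bsub>S\<^esub>k\<in>T. map_entries h A i k \<otimes>\<^bsub>S\<^esub> map_entries h B k j)"
    by (rule S.finsum_cong') (use cl in \<open>auto simp: map_entries_def\<close>)
  also have "\<dots> = inf_mult S (map_entries h A) (map_entries h B) i j"
    by (rule S.inf_mult_rfm[symmetric]) (use fin A B in \<open>auto simp: map_entries_rfm\<close>, auto simp: T_def map_entries_def)
  finally show "map_entries h (inf_mult R A B) i j = inf_mult S (map_entries h A) (map_entries h B) i j" .
qed

lemma map_entries_GL: assumes "A \<in> carrier (GLinf R)" shows "map_entries h A \<in> carrier (GLinf S)"
proof -
  obtain B where B: "finitary R A" "finitary R B" "inf_mult R A B = mat_one R" "inf_mult R B A = mat_one R"
    using R.GLinf_E[OF assms] .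
  show ?thesis
    by (rule S.GLinf_I[of _ "map_entries h B"])
      (use B in \<open>simp_all add: map_entries_finitary R.finitary_rfm map_entries_one flip: map_entries_mult\<close>)
qed

lemma map_entries_hom: "map_entries h \<in> hom (GLinf R) (GLinf S)"
  by (rule homI) (auto simp: map_entries_GL R.GLinf_simps S.GLinf_simps map_entries_mult R.GLinf_rfm)

lemma map_entries_elem: "map_entries h (elem_mat R i j a) = elem_mat S i j (h a)"
  using map_entries_one by (auto simp: map_entries_def elem_mat_def fun_eq_iff)

text \<open>Generators lift entry by entry. In \<open>torsion_decomposition\<close> this moves the
  elementary matrix that witnesses an equality in \<open>K1\<close> of the residue ring up to the
  p-adic ring.\<close>

lemma Einf_lift:
  assumes "h ` carrier R = carrier S" "E \<in> Einf S"
  shows "\<exists>E'\<in>Einf R. map_entries h E' = E"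
  using assms(2)
proof (induction rule: S.Einf_induct)
  case one thus ?case using subgroup.one_closed[OF R.Einf_subgroup] map_entries_one
    by (auto simp: R.GLinf_simps)
next
  case (elem i j a)
  then obtain b where "b \<in> carrier R" "h b = a" using assms(1) by (metis imageE)
  thus ?case using R.elem_mat_Einf[of i j b] map_entries_elem elem by auto
next
  case (mult A B)
  then obtain A' B' where *: "A' \<in> Einf R" "map_entries h A' = A" "B' \<in> Einf R" "map_entries h B' = B" by blast
  hence "A' \<in> carrier (rfm R)" "B' \<in> carrier (rfm R)"
    using subgroup.subset[OF R.Einf_subgroup] R.GLinf_rfm by auto
  thus ?case using * R.Einf_mult by (metis map_entries_mult rfm_simps(3))
qed

end

section \<open>Group rings modulo an integer\<close>

locale group_ring_mod = group G for G :: "('g, 'b) monoid_scheme" (structure) +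
  fixes n :: nat
  assumes n_gt_1: "n > 1"
begin

abbreviation "\<F> \<equiv> FpG n G"

abbreviation "supp f \<equiv> {g \<in> carrier G. f g \<noteq> (0::int)}"

lemma FpG_simps:
  "\<zero>\<^bsub>\<F>\<^esub> = (\<lambda>_. 0)" "\<one>\<^bsub>\<F>\<^esub> = Fp_elt \<one>" "f \<oplus>\<^bsub>\<F>\<^esub> h = (\<lambda>x. (f x + h x) mod int n)"
  by (simp_all add: FpG_def Fp_elt_def)

lemma FpG_I: "(\<And>g. 0 \<le> f g) \<Longrightarrow> (\<And>g. f g < int n) \<Longrightarrow> (\<And>g. g \<notin> carrier G \<Longrightarrow> f g = 0) \<Longrightarrow>
    finite (supp f) \<Longrightarrow> f \<in> carrier \<F>"
proof -
  assume *: "\<And>g. 0 \<le> f g" "\<And>g. f g < int n" "\<And>g. g \<notin> carrier G \<Longrightarrow> f g = 0" "finite (supp f)"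
  have "{g. f g \<noteq> 0} = supp f" using *(3) by auto
  thus ?thesis using * by (simp add: FpG_def)
qed

lemma FpG_range: "f \<in> carrier \<F> \<Longrightarrow> 0 \<le> f g \<and> f g < int n"
  and FpG_outside: "f \<in> carrier \<F> \<Longrightarrow> g \<notin> carrier G \<Longrightarrow> f g = 0"
  and FpG_finite: "f \<in> carrier \<F> \<Longrightarrow> finite (supp f)"
  by (auto simp: FpG_def)

lemma FpG_mod [simp]: "f \<in> carrier \<F> \<Longrightarrow> f g mod int n = f g"
  using FpG_range by simp

lemma FpG_mult_eq:
  assumes "finite S" "S \<subseteq> carrier G" "supp f \<subseteq> S" "x \<in> carrier G"
  shows "(f \<otimes>\<^bsub>\<F>\<^esub> h) x = (\<Sum>g\<in>S. f g * h (inv g \<otimes> x)) mod int n"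
proof -
  have "(\<Sum>g\<in>supp f. f g * h (inv g \<otimes> x)) = (\<Sum>g\<in>S. f g * h (inv g \<otimes> x))"
    by (rule sum.mono_neutral_left) (use assms in auto)
  thus ?thesis using assms by (simp add: FpG_def)
qed

lemma FpG_mult_outside: "x \<notin> carrier G \<Longrightarrow> (f \<otimes>\<^bsub>\<F>\<^esub> h) x = 0"
  by (simp add: FpG_def)

definition prod_supp :: "('g \<Rightarrow> int) \<Rightarrow> ('g \<Rightarrow> int) \<Rightarrow> 'g set" where
  "prod_supp f h = (\<lambda>(a, b). a \<otimes> b) ` (supp f \<times> supp h)"

lemma prod_supp:
  assumes "f \<in> carrier \<F>" "h \<in> carrier \<F>"
  shows "finite (prod_supp f h)" "prod_supp f h \<subseteq> carrier G" "supp (f \<otimes>\<^bsub>\<F>\<^esub> h) \<subseteq> prod_supp f h"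
proof -
  show "finite (prod_supp f h)" using assms by (auto simp: prod_supp_def FpG_finite)
  show "prod_supp f h \<subseteq> carrier G" by (auto simp: prod_supp_def)
  show "supp (f \<otimes>\<^bsub>\<F>\<^esub> h) \<subseteq> prod_supp f h"
  proof
    fix x assume x: "x \<in> supp (f \<otimes>\<^bsub>\<F>\<^esub> h)"
    have "\<exists>g\<in>supp f. h (inv g \<otimes> x) \<noteq> 0"
    proof (rule ccontr)
      assume "\<not> (\<exists>g\<in>supp f. h (inv g \<otimes> x) \<noteq> 0)"
      hence "(\<Sum>g\<in>supp f. f g * h (inv g \<otimes> x)) = 0" by (intro sum.neutral) auto
      hence "(f \<otimes>\<^bsub>\<F>\<^esub> h) x = 0"
        using x FpG_mult_eq[of "supp f" f x h] assms by (simp add: FpG_finite)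
      thus False using x by auto
    qed
    then obtain g where g: "g \<in> supp f" "h (inv g \<otimes> x) \<noteq> 0" by blast
    have "x = g \<otimes> (inv g \<otimes> x)" using x g m_assoc[of g "inv g" x] by auto
    thus "x \<in> prod_supp f h" unfolding prod_supp_def using g x
      by (intro image_eqI[of _ _ "(g, inv g \<otimes> x)"]) auto
  qed
qed

lemma FpG_mult_closed:
  assumes "f \<in> carrier \<F>" "h \<in> carrier \<F>" shows "f \<otimes>\<^bsub>\<F>\<^esub> h \<in> carrier \<F>"
proof (rule FpG_I)
  fix g
  show "0 \<le> (f \<otimes>\<^bsub>\<F>\<^esub> h) g" "(f \<otimes>\<^bsub>\<F>\<^esub> h) g < int n" using n_gt_1 by (auto simp: FpG_def)
qed (use prod_supp[OF assms] in \<open>auto simp: FpG_mult_outside intro: finite_subset\<close>)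

text \<open>The substitution \<open>c = a b\<close> in a convolution paired with a weight
  \<open>\<phi>\<close>. With \<open>\<phi> c = k (inv c x)\<close> it gives associativity, with the
  indicator of a fibre of \<open>\<pi>\<close> it gives multiplicativity of
  \<open>push\<close>.\<close>

lemma FpG_sum_mult:
  assumes f: "f \<in> carrier \<F>" and h: "h \<in> carrier \<F>" and C: "finite C" "C \<subseteq> carrier G" "prod_supp f h \<subseteq> C"
  shows "[(\<Sum>c\<in>C. (f \<otimes>\<^bsub>\<F>\<^esub> h) c * \<phi> c) = (\<Sum>a\<in>supp f. \<Sum>b\<in>supp h. f a * h b * \<phi> (a \<otimes> b))] (mod int n)"
proof -
  have "[(\<Sum>c\<in>C. (f \<otimes>\<^bsub>\<F>\<^esub> h) c * \<phi> c) = (\<Sum>c\<in>C. (\<Sum>a\<in>supp f. f a * h (inv a \<otimes> c)) * \<phi> c)] (mod int n)"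
  proof (rule cong_sum)
    fix c assume "c \<in> C"
    hence "(f \<otimes>\<^bsub>\<F>\<^esub> h) c = (\<Sum>a\<in>supp f. f a * h (inv a \<otimes> c)) mod int n"
      using C f by (intro FpG_mult_eq) (auto simp: FpG_finite)
    thus "[(f \<otimes>\<^bsub>\<F>\<^esub> h) c * \<phi> c = (\<Sum>a\<in>supp f. f a * h (inv a \<otimes> c)) * \<phi> c] (mod int n)"
      by (simp add: cong_mult)
  qed
  also have "(\<Sum>c\<in>C. (\<Sum>a\<in>supp f. f a * h (inv a \<otimes> c)) * \<phi> c) = (\<Sum>a\<in>supp f. \<Sum>c\<in>C. f a * h (inv a \<otimes> c) * \<phi> c)"
    unfolding sum_distrib_right by (rule sum.swap)
  also have "\<dots> = (\<Sum>a\<in>supp f. \<Sum>b\<in>supp h. f a * h b * \<phi> (a \<otimes> b))"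
  proof (rule sum.cong[OF refl])
    fix a assume a: "a \<in> supp f"
    have "(\<Sum>c\<in>C. f a * h (inv a \<otimes> c) * \<phi> c) = (\<Sum>c\<in>(\<lambda>b. a \<otimes> b) ` supp h. f a * h (inv a \<otimes> c) * \<phi> c)"
    proof (rule sum.mono_neutral_right[OF C(1)])
      show "(\<lambda>b. a \<otimes> b) ` supp h \<subseteq> C" using C a by (auto simp: prod_supp_def)
      show "\<forall>i\<in>C - (\<lambda>b. a \<otimes> b) ` supp h. f a * h (inv a \<otimes> i) * \<phi> i = 0"
      proof
        fix c assume c: "c \<in> C - (\<lambda>b. a \<otimes> b) ` supp h"
        have "a \<otimes> (inv a \<otimes> c) = c" using a c C m_assoc[of a "inv a" c] by auto
        moreover have "inv a \<otimes> c \<in> carrier G" using a c C by auto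
        ultimately have "h (inv a \<otimes> c) = 0" using c by (metis (mono_tags, lifting) DiffD2 imageI mem_Collect_eq)
        thus "f a * h (inv a \<otimes> c) * \<phi> c = 0" by simp
      qed
    qed
    also have "\<dots> = (\<Sum>b\<in>supp h. f a * h (inv a \<otimes> (a \<otimes> b)) * \<phi> (a \<otimes> b))"
      by (subst sum.reindex) (use a in \<open>auto simp: inj_on_def\<close>)
    also have "\<dots> = (\<Sum>b\<in>supp h. f a * h b * \<phi> (a \<otimes> b))"
    proof (rule sum.cong[OF refl])
      fix b assume "b \<in> supp h"
      thus "f a * h (inv a \<otimes> (a \<otimes> b)) * \<phi> (a \<otimes> b) = f a * h b * \<phi> (a \<otimes> b)"
        using a m_assoc[of "inv a" a b] by auto
    qed
    finally show "(\<Sum>c\<in>C. f a * h (inv a \<otimes> c) * \<phi> c) = (\<Sum>b\<in>supp h. f a * h b * \<phi> (a \<otimes> b))" .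
  qed
  finally show ?thesis .
qed

lemma FpG_mult_assoc:
  assumes f: "f \<in> carrier \<F>" and h: "h \<in> carrier \<F>" and k: "k \<in> carrier \<F>"
  shows "(f \<otimes>\<^bsub>\<F>\<^esub> h) \<otimes>\<^bsub>\<F>\<^esub> k = f \<otimes>\<^bsub>\<F>\<^esub> (h \<otimes>\<^bsub>\<F>\<^esub> k)"
proof
  fix x
  show "((f \<otimes>\<^bsub>\<F>\<^esub> h) \<otimes>\<^bsub>\<F>\<^esub> k) x = (f \<otimes>\<^bsub>\<F>\<^esub> (h \<otimes>\<^bsub>\<F>\<^esub> k)) x"
  proof (cases "x \<in> carrier G")
    case x: True
    note ps = prod_supp[OF f h]
    have "((f \<otimes>\<^bsub>\<F>\<^esub> h) \<otimes>\<^bsub>\<F>\<^esub> k) x = (\<Sum>c\<in>prod_supp f h. (f \<otimes>\<^bsub>\<F>\<^esub> h) c * k (inv c \<otimes> x)) mod int n"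
      by (rule FpG_mult_eq[OF ps x])
    also have "\<dots> = (\<Sum>a\<in>supp f. \<Sum>b\<in>supp h. f a * h b * k (inv (a \<otimes> b) \<otimes> x)) mod int n"
      using FpG_sum_mult[OF f h ps(1,2) subset_refl] by (simp add: cong_def)
    also have "\<dots> = (\<Sum>a\<in>supp f. f a * (h \<otimes>\<^bsub>\<F>\<^esub> k) (inv a \<otimes> x)) mod int n"
      unfolding cong_def[symmetric]
    proof (rule cong_sum)
      fix a assume a: "a \<in> supp f"
      have "(h \<otimes>\<^bsub>\<F>\<^esub> k) (inv a \<otimes> x) = (\<Sum>b\<in>supp h. h b * k (inv b \<otimes> (inv a \<otimes> x))) mod int n"
        using h a x by (intro FpG_mult_eq) (auto simp: FpG_finite)
      hence "[f a * (\<Sum>b\<in>supp h. h b * k (inv b \<otimes> (inv a \<otimes> x))) = f a * (h \<otimes>\<^bsub>\<F>\<^esub> k) (inv a \<otimes> x)] (mod int n)"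
        by (simp add: cong_mult)
      also have "f a * (\<Sum>b\<in>supp h. h b * k (inv b \<otimes> (inv a \<otimes> x))) =
          (\<Sum>b\<in>supp h. f a * h b * k (inv (a \<otimes> b) \<otimes> x))"
        unfolding sum_distrib_left using a x by (intro sum.cong) (auto simp: inv_mult_group m_assoc)
      finally show "[(\<Sum>b\<in>supp h. f a * h b * k (inv (a \<otimes> b) \<otimes> x)) = f a * (h \<otimes>\<^bsub>\<F>\<^esub> k) (inv a \<otimes> x)] (mod int n)" .
    qed
    also have "\<dots> = (f \<otimes>\<^bsub>\<F>\<^esub> (h \<otimes>\<^bsub>\<F>\<^esub> k)) x"
      using f x by (intro FpG_mult_eq[symmetric]) (auto simp: FpG_finite)
    finally show ?thesis .
  qed (simp add: FpG_mult_outside)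
qed

lemma Fp_elt_closed: "g \<in> carrier G \<Longrightarrow> Fp_elt g \<in> carrier \<F>"
  using n_gt_1 by (intro FpG_I) (auto simp: Fp_elt_def)

lemma Fp_elt_mult_left:
  assumes "f \<in> carrier \<F>" "g \<in> carrier G" "x \<in> carrier G" shows "(Fp_elt g \<otimes>\<^bsub>\<F>\<^esub> f) x = f (inv g \<otimes> x)"
  by (subst FpG_mult_eq[of "{g}"]) (use assms in \<open>auto simp: Fp_elt_def\<close>)

lemma FpG_one_left: "f \<in> carrier \<F> \<Longrightarrow> Fp_elt \<one> \<otimes>\<^bsub>\<F>\<^esub> f = f"
proof
  fix x assume f: "f \<in> carrier \<F>"
  show "(Fp_elt \<one> \<otimes>\<^bsub>\<F>\<^esub> f) x = f x"
    by (cases "x \<in> carrier G") (use f in \<open>auto simp: Fp_elt_mult_left FpG_mult_outside FpG_outside\<close>)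
qed

lemma FpG_one_right: "f \<in> carrier \<F> \<Longrightarrow> f \<otimes>\<^bsub>\<F>\<^esub> Fp_elt \<one> = f"
proof
  fix x assume f: "f \<in> carrier \<F>"
  show "(f \<otimes>\<^bsub>\<F>\<^esub> Fp_elt \<one>) x = f x"
  proof (cases "x \<in> carrier G")
    case x: True
    have eq: "inv g \<otimes> x = \<one> \<longleftrightarrow> g = x" if "g \<in> carrier G" for g
      using that x by (metis inv_closed inv_equality inv_inv r_inv)
    have "(f \<otimes>\<^bsub>\<F>\<^esub> Fp_elt \<one>) x = (\<Sum>g\<in>insert x (supp f). f g * Fp_elt \<one> (inv g \<otimes> x)) mod int n"
      by (rule FpG_mult_eq) (use f x in \<open>auto simp: FpG_finite\<close>)
    also have "(\<Sum>g\<in>insert x (supp f). f g * Fp_elt \<one> (inv g \<otimes> x)) = (\<Sum>g\<in>insert x (supp f). if g = x then f g else 0)"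
      by (rule sum.cong) (use eq x in \<open>auto simp: Fp_elt_def\<close>)
    also have "\<dots> = f x" using FpG_finite[OF f] by (subst sum.delta) auto
    finally show ?thesis using f by simp
  qed (use f in \<open>auto simp: FpG_mult_outside FpG_outside\<close>)
qed

lemma Fp_elt_mult:
  assumes "g \<in> carrier G" "h \<in> carrier G" shows "Fp_elt g \<otimes>\<^bsub>\<F>\<^esub> Fp_elt h = Fp_elt (g \<otimes> h)"
proof
  fix x
  show "(Fp_elt g \<otimes>\<^bsub>\<F>\<^esub> Fp_elt h) x = Fp_elt (g \<otimes> h) x"
  proof (cases "x \<in> carrier G")
    case x: True
    have "inv g \<otimes> x = h \<longleftrightarrow> x = g \<otimes> h"
      using assms x by (metis inv_closed inv_solve_left)
    thus ?thesis using assms x by (simp add: Fp_elt_mult_left Fp_elt_closed) (simp add: Fp_elt_def)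
  qed (use assms in \<open>auto simp: FpG_mult_outside Fp_elt_def\<close>)
qed

lemma FpG_add_closed:
  assumes "f \<in> carrier \<F>" "h \<in> carrier \<F>" shows "f \<oplus>\<^bsub>\<F>\<^esub> h \<in> carrier \<F>"
proof (rule FpG_I)
  have "supp (f \<oplus>\<^bsub>\<F>\<^esub> h) \<subseteq> supp f \<union> supp h" by (auto simp: FpG_simps)
  thus "finite (supp (f \<oplus>\<^bsub>\<F>\<^esub> h))" using assms by (auto simp: FpG_finite elim: finite_subset)
qed (use n_gt_1 assms in \<open>auto simp: FpG_simps FpG_outside\<close>)

lemma FpG_uminus_closed:
  assumes "f \<in> carrier \<F>" shows "(\<lambda>x. (- f x) mod int n) \<in> carrier \<F>"
proof (rule FpG_I)
  have "supp (\<lambda>x. (- f x) mod int n) \<subseteq> supp f" by auto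
  thus "finite (supp (\<lambda>x. (- f x) mod int n))" using assms by (auto simp: FpG_finite elim: finite_subset)
qed (use n_gt_1 assms in \<open>auto simp: FpG_outside\<close>)

lemma ring_FpG: "ring \<F>"
proof (rule ringI)
  show "abelian_group \<F>"
  proof (rule abelian_groupI)
    fix f assume f: "f \<in> carrier \<F>"
    show "\<exists>y\<in>carrier \<F>. y \<oplus>\<^bsub>\<F>\<^esub> f = \<zero>\<^bsub>\<F>\<^esub>"
      by (rule bexI[OF _ FpG_uminus_closed[OF f]]) (auto simp: FpG_simps mod_add_left_eq)
  next
    show "\<zero>\<^bsub>\<F>\<^esub> \<in> carrier \<F>" using n_gt_1 by (intro FpG_I) (auto simp: FpG_simps)
  qed (simp_all add: FpG_add_closed, simp_all add: FpG_simps mod_simps algebra_simps)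
next
  show "Group.monoid \<F>"
    by (rule Group.monoidI) (auto simp: FpG_mult_closed FpG_mult_assoc FpG_one_left FpG_one_right FpG_simps(2) Fp_elt_closed)
next
  fix f h k assume f: "f \<in> carrier \<F>" and h: "h \<in> carrier \<F>" and k: "k \<in> carrier \<F>"
  show "(f \<oplus>\<^bsub>\<F>\<^esub> h) \<otimes>\<^bsub>\<F>\<^esub> k = f \<otimes>\<^bsub>\<F>\<^esub> k \<oplus>\<^bsub>\<F>\<^esub> h \<otimes>\<^bsub>\<F>\<^esub> k"
  proof
    fix x
    define S where "S = supp f \<union> supp h"
    have S: "finite S" "S \<subseteq> carrier G" "supp f \<subseteq> S" "supp h \<subseteq> S" "supp (f \<oplus>\<^bsub>\<F>\<^esub> h) \<subseteq> S"
      using f h by (auto simp: S_def FpG_finite FpG_simps)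
    show "((f \<oplus>\<^bsub>\<F>\<^esub> h) \<otimes>\<^bsub>\<F>\<^esub> k) x = (f \<otimes>\<^bsub>\<F>\<^esub> k \<oplus>\<^bsub>\<F>\<^esub> h \<otimes>\<^bsub>\<F>\<^esub> k) x"
    proof (cases "x \<in> carrier G")
      case x: True
      have "((f \<oplus>\<^bsub>\<F>\<^esub> h) \<otimes>\<^bsub>\<F>\<^esub> k) x = (\<Sum>g\<in>S. (f \<oplus>\<^bsub>\<F>\<^esub> h) g * k (inv g \<otimes> x)) mod int n"
        by (rule FpG_mult_eq) (use S x in auto)
      also have "\<dots> = (\<Sum>g\<in>S. (f g + h g) * k (inv g \<otimes> x)) mod int n"
        unfolding cong_def[symmetric] by (intro cong_sum cong_mult) (auto simp: FpG_simps)
      also have "\<dots> = (f \<otimes>\<^bsub>\<F>\<^esub> k \<oplus>\<^bsub>\<F>\<^esub> h \<otimes>\<^bsub>\<F>\<^esub> k) x"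
        using S x by (simp add: FpG_simps FpG_mult_eq[of S] distrib_right sum.distrib mod_simps)
      finally show ?thesis .
    qed (auto simp: FpG_mult_outside FpG_simps)
  qed
  show "k \<otimes>\<^bsub>\<F>\<^esub> (f \<oplus>\<^bsub>\<F>\<^esub> h) = k \<otimes>\<^bsub>\<F>\<^esub> f \<oplus>\<^bsub>\<F>\<^esub> k \<otimes>\<^bsub>\<F>\<^esub> h"
  proof
    fix x
    have S: "finite (supp k)" using k by (simp add: FpG_finite)
    show "(k \<otimes>\<^bsub>\<F>\<^esub> (f \<oplus>\<^bsub>\<F>\<^esub> h)) x = (k \<otimes>\<^bsub>\<F>\<^esub> f \<oplus>\<^bsub>\<F>\<^esub> k \<otimes>\<^bsub>\<F>\<^esub> h) x"
    proof (cases "x \<in> carrier G")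
      case x: True
      have "(k \<otimes>\<^bsub>\<F>\<^esub> (f \<oplus>\<^bsub>\<F>\<^esub> h)) x = (\<Sum>g\<in>supp k. k g * (f \<oplus>\<^bsub>\<F>\<^esub> h) (inv g \<otimes> x)) mod int n"
        by (rule FpG_mult_eq) (use S x in auto)
      also have "\<dots> = (\<Sum>g\<in>supp k. k g * (f (inv g \<otimes> x) + h (inv g \<otimes> x))) mod int n"
        unfolding cong_def[symmetric] by (intro cong_sum cong_mult) (auto simp: FpG_simps)
      also have "\<dots> = (k \<otimes>\<^bsub>\<F>\<^esub> f \<oplus>\<^bsub>\<F>\<^esub> k \<otimes>\<^bsub>\<F>\<^esub> h) x"
        using S x by (simp add: FpG_simps FpG_mult_eq[of "supp k"] distrib_left sum.distrib mod_simps)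
      finally show ?thesis .
    qed (auto simp: FpG_mult_outside FpG_simps)
  qed
qed

end

section \<open>Push-forward to a finite quotient group\<close>

locale finite_quotient = group_ring_mod G n + group_hom G H \<pi>
  for G :: "('g, 'b) monoid_scheme" (structure) and n and H :: "('h, 'c) monoid_scheme" and \<pi> +
  assumes finite_H: "finite (carrier H)"
begin

text \<open>The image in the group ring of \<open>H\<close>, left as plain integers instead of
  residues: determinants can then be taken over the integers, while compatibility with sums and
  products holds modulo \<open>n\<close>.\<close>

definition push :: "('g \<Rightarrow> int) \<Rightarrow> 'h \<Rightarrow> int" where
  "push f y = (\<Sum>g\<in>supp f. if \<pi> g = y then f g else 0)"

lemma push_eq:
  assumes "finite S" "S \<subseteq> carrier G" "supp f \<subseteq> S"
  shows "push f y = (\<Sum>g\<in>S. f g * (if \<pi> g = y then 1 else 0))"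
  unfolding push_def by (rule sum.mono_neutral_cong_left) (use assms in auto)

lemma push_zero: "push \<zero>\<^bsub>\<F>\<^esub> y = 0"
  by (simp add: push_def FpG_simps)

lemma push_elt: "g \<in> carrier G \<Longrightarrow> push (Fp_elt g) y = (if y = \<pi> g then 1 else 0)"
  by (subst push_eq[of "{g}"]) (auto simp: Fp_elt_def)

lemma push_add:
  assumes f: "f \<in> carrier \<F>" and h: "h \<in> carrier \<F>"
  shows "[push (f \<oplus>\<^bsub>\<F>\<^esub> h) y = push f y + push h y] (mod int n)"
proof -
  define S where "S = supp f \<union> supp h"
  have S: "finite S" "S \<subseteq> carrier G" "supp f \<subseteq> S" "supp h \<subseteq> S" "supp (f \<oplus>\<^bsub>\<F>\<^esub> h) \<subseteq> S"
    using f h by (auto simp: S_def FpG_finite FpG_simps)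
  have "[push (f \<oplus>\<^bsub>\<F>\<^esub> h) y = (\<Sum>g\<in>S. (f g + h g) * (if \<pi> g = y then 1 else 0))] (mod int n)"
    unfolding push_eq[OF S(1,2,5)] by (intro cong_sum cong_mult) (auto simp: FpG_simps)
  also have "(\<Sum>g\<in>S. (f g + h g) * (if \<pi> g = y then 1 else 0)) = push f y + push h y"
    unfolding push_eq[OF S(1,2,3)] push_eq[OF S(1,2,4)] by (simp add: distrib_right sum.distrib)
  finally show ?thesis .
qed

text \<open>The sum over pairs is regrouped along the fibres of \<open>\<pi>\<close> in the first
  factor; on such a fibre the contribution of the second factor is constant.\<close>

lemma push_mult:
  assumes f: "f \<in> carrier \<F>" and h: "h \<in> carrier \<F>" and y: "y \<in> carrier H"
  shows "[push (f \<otimes>\<^bsub>\<F>\<^esub> h) y = (\<Sum>z\<in>carrier H. push f z * push h (inv\<^bsub>H\<^esub> z \<otimes>\<^bsub>H\<^esub> y))] (mod int n)"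
proof -
  note ps = prod_supp[OF f h]
  have "[push (f \<otimes>\<^bsub>\<F>\<^esub> h) y = (\<Sum>a\<in>supp f. \<Sum>b\<in>supp h. f a * h b * (if \<pi> (a \<otimes> b) = y then 1 else 0))] (mod int n)"
    unfolding push_eq[OF ps] by (rule FpG_sum_mult[OF f h ps(1,2) subset_refl])
  also have "(\<Sum>a\<in>supp f. \<Sum>b\<in>supp h. f a * h b * (if \<pi> (a \<otimes> b) = y then 1 else 0)) =
    (\<Sum>a\<in>supp f. f a * push h (inv\<^bsub>H\<^esub> \<pi> a \<otimes>\<^bsub>H\<^esub> y))"
  proof (rule sum.cong[OF refl])
    fix a assume a: "a \<in> supp f"
    have "\<pi> (a \<otimes> b) = y \<longleftrightarrow> \<pi> b = inv\<^bsub>H\<^esub> \<pi> a \<otimes>\<^bsub>H\<^esub> y" if "b \<in> supp h" for b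
    proof -
      have "\<pi> a \<in> carrier H" "\<pi> b \<in> carrier H" using a that by auto
      thus ?thesis using a that y H.inv_solve_left[of "\<pi> b" "\<pi> a" y] by auto
    qed
    thus "(\<Sum>b\<in>supp h. f a * h b * (if \<pi> (a \<otimes> b) = y then 1 else 0)) = f a * push h (inv\<^bsub>H\<^esub> \<pi> a \<otimes>\<^bsub>H\<^esub> y)"
      unfolding push_def sum_distrib_left by (intro sum.cong) auto
  qed
  also have "\<dots> = (\<Sum>z\<in>carrier H. \<Sum>a | a \<in> supp f \<and> \<pi> a = z. f a * push h (inv\<^bsub>H\<^esub> \<pi> a \<otimes>\<^bsub>H\<^esub> y))"
    by (rule sum.group[symmetric, OF _ finite_H]) (use f in \<open>auto simp: FpG_finite\<close>)
  also have "\<dots> = (\<Sum>z\<in>carrier H. push f z * push h (inv\<^bsub>H\<^esub> z \<otimes>\<^bsub>H\<^esub> y))"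
  proof (rule sum.cong[OF refl])
    fix z
    have "(\<Sum>a | a \<in> supp f \<and> \<pi> a = z. f a) = push f z"
      unfolding push_def using FpG_finite[OF f] by (simp only: flip: sum.inter_filter)
    thus "(\<Sum>a | a \<in> supp f \<and> \<pi> a = z. f a * push h (inv\<^bsub>H\<^esub> \<pi> a \<otimes>\<^bsub>H\<^esub> y)) = push f z * push h (inv\<^bsub>H\<^esub> z \<otimes>\<^bsub>H\<^esub> y)"
      by (simp add: sum_distrib_right[symmetric] cong: conj_cong)
  qed
  finally show ?thesis .
qed

end

section \<open>Residues and infinite sums\<close>

context padic begin

text \<open>Congruence modulo \<open>p ^ M\<close> between a p-adic number and an integer, in metric
  form. It forces \<open>x\<close> to be integral, see \<open>close_nrm_le_1\<close>.\<close>

definition close :: "nat \<Rightarrow> qp \<Rightarrow> int \<Rightarrow> bool" where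
  "close M x a \<longleftrightarrow> x \<in> carrier K \<and> nrm (x \<ominus>\<^bsub>K\<^esub> emb (of_int a)) \<le> 1 / real p ^ M"

lemma p_pow_inverse [simp]: "1 / real p ^ M \<le> 1" "0 < 1 / real p ^ M" "0 \<le> 1 / real p ^ M"
  using p_gt_1 by (auto simp: field_simps)

lemma close_carrier: "close M x a \<Longrightarrow> x \<in> carrier K" by (simp add: close_def)

lemma close_0_iff: "x \<in> carrier K \<Longrightarrow> close M x 0 \<longleftrightarrow> nrm x \<le> 1 / real p ^ M"
  by (simp add: close_def a_minus_def)

lemma close_emb: "close M (emb (of_int a)) a"
  by (simp add: close_def flip: emb_diff)

lemma close_add:
  assumes "close M x a" "close M y b" shows "close M (x \<oplus>\<^bsub>K\<^esub> y) (a + b)"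
proof -
  have xy: "x \<in> carrier K" "y \<in> carrier K" using assms by (auto simp: close_def)
  have "(x \<oplus>\<^bsub>K\<^esub> y) \<ominus>\<^bsub>K\<^esub> emb (of_int (a + b)) = (x \<ominus>\<^bsub>K\<^esub> emb (of_int a)) \<oplus>\<^bsub>K\<^esub> (y \<ominus>\<^bsub>K\<^esub> emb (of_int b))"
    using xy by (simp add: emb_add a_minus_def K.minus_add K.a_ac)
  thus ?thesis using assms nrm_add[of "x \<ominus>\<^bsub>K\<^esub> emb (of_int a)" "y \<ominus>\<^bsub>K\<^esub> emb (of_int b)"] by (auto simp: close_def)
qed

lemma close_nrm_le_1: assumes "close M x a" shows "nrm x \<le> 1"
proof -
  have x: "x \<in> carrier K" using assms by (simp add: close_def)
  have "x = (x \<ominus>\<^bsub>K\<^esub> emb (of_int a)) \<oplus>\<^bsub>K\<^esub> emb (of_int a)" using x by (simp add: a_minus_def K.a_assoc K.l_neg)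
  hence "nrm x \<le> max (nrm (x \<ominus>\<^bsub>K\<^esub> emb (of_int a))) (nrm (emb (of_int a)))"
    using nrm_add[of "x \<ominus>\<^bsub>K\<^esub> emb (of_int a)" "emb (of_int a)"] x by simp
  also have "\<dots> \<le> 1" using assms pabs_int_le_1[of a] p_pow_inverse(1)[of M]
    unfolding close_def nrm_emb by linarith
  finally show ?thesis .
qed

lemma close_mult:
  assumes "close M x a" "close M y b" shows "close M (x \<otimes>\<^bsub>K\<^esub> y) (a * b)"
proof -
  have xy: "x \<in> carrier K" "y \<in> carrier K" using assms by (auto simp: close_def)
  let ?a = "emb (of_int a)" and ?b = "emb (of_int b)"
  have "(x \<otimes>\<^bsub>K\<^esub> y) \<ominus>\<^bsub>K\<^esub> emb (of_int (a * b)) = (x \<ominus>\<^bsub>K\<^esub> ?a) \<otimes>\<^bsub>K\<^esub> y \<oplus>\<^bsub>K\<^esub> ?a \<otimes>\<^bsub>K\<^esub> (y \<ominus>\<^bsub>K\<^esub> ?b)"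
    using xy by (simp add: emb_mult a_minus_def K.l_distr K.r_distr K.l_minus K.r_minus K.a_assoc K.r_neg1)
  hence "nrm ((x \<otimes>\<^bsub>K\<^esub> y) \<ominus>\<^bsub>K\<^esub> emb (of_int (a * b))) \<le> max (nrm (x \<ominus>\<^bsub>K\<^esub> ?a) * nrm y) (nrm ?a * nrm (y \<ominus>\<^bsub>K\<^esub> ?b))"
    using xy nrm_add[of "(x \<ominus>\<^bsub>K\<^esub> ?a) \<otimes>\<^bsub>K\<^esub> y" "?a \<otimes>\<^bsub>K\<^esub> (y \<ominus>\<^bsub>K\<^esub> ?b)"] by (simp add: nrm_mult)
  also have "\<dots> \<le> 1 / real p ^ M"
  proof (rule max.boundedI)
    have "nrm (x \<ominus>\<^bsub>K\<^esub> ?a) * nrm y \<le> nrm (x \<ominus>\<^bsub>K\<^esub> ?a) * 1"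
      by (rule mult_left_mono) (use close_nrm_le_1[OF assms(2)] xy nrm_nonneg in auto)
    thus "nrm (x \<ominus>\<^bsub>K\<^esub> ?a) * nrm y \<le> 1 / real p ^ M" using assms by (simp add: close_def)
    have "nrm ?a * nrm (y \<ominus>\<^bsub>K\<^esub> ?b) \<le> 1 * nrm (y \<ominus>\<^bsub>K\<^esub> ?b)"
      by (rule mult_right_mono) (use pabs_int_le_1 xy nrm_nonneg in auto)
    thus "nrm ?a * nrm (y \<ominus>\<^bsub>K\<^esub> ?b) \<le> 1 / real p ^ M" using assms by (simp add: close_def)
  qed
  finally show ?thesis using xy by (simp add: close_def)
qed

lemma close_mod:
  assumes "close M x a" "[a = b] (mod int p ^ M)" shows "close M x b"
proof -
  have x: "x \<in> carrier K" using assms by (simp add: close_def)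
  have "pabs (of_int (a - b)) \<le> 1 / real p ^ M"
    using assms(2) by (subst pabs_int_le_iff) (simp add: cong_iff_dvd_diff)
  hence "nrm (emb (of_int a) \<ominus>\<^bsub>K\<^esub> emb (of_int b)) \<le> 1 / real p ^ M" by (simp flip: emb_diff)
  thus ?thesis using assms(1) nrm_diff_trans[of x "emb (of_int a)" "emb (of_int b)"] x by (auto simp: close_def)
qed

lemma close_unique:
  assumes "close M x a" "close M x b" shows "[a = b] (mod int p ^ M)"
proof -
  have x: "x \<in> carrier K" using assms by (simp add: close_def)
  have "nrm (emb (of_int a) \<ominus>\<^bsub>K\<^esub> emb (of_int b)) \<le> 1 / real p ^ M"
    using nrm_diff_trans[of "emb (of_int a)" x "emb (of_int b)"] x assms nrm_diff_commute[of x "emb (of_int a)"]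
    by (auto simp: close_def)
  hence "pabs (of_int (a - b)) \<le> 1 / real p ^ M" by (simp flip: emb_diff)
  thus ?thesis unfolding pabs_int_le_iff by (simp add: cong_iff_dvd_diff)
qed

lemma close_finsum:
  assumes "\<And>i. i \<in> A \<Longrightarrow> close M (f i) (a i)" shows "close M (finsum K f A) (sum a A)"
  using assms
proof (induction A rule: infinite_finite_induct)
  case (insert x F)
  have "f i \<in> carrier K" if "i \<in> insert x F" for i using insert that close_carrier by blast
  thus ?case using insert by (simp add: Pi_def close_add)
qed (simp_all add: close_0_iff)

lemma one_over_p_pow_small: assumes "e > (0::real)" obtains M where "M \<ge> N" "1 / real p ^ M < e"
proof -
  have "(\<lambda>n. (1 / real p) ^ n) \<longlonglongrightarrow> 0" using p_gt_1 by (intro LIMSEQ_realpow_zero) auto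
  hence "eventually (\<lambda>n. (1 / real p) ^ n < e) sequentially" using assms by (rule order_tendstoD)
  then obtain n0 where "\<forall>n\<ge>n0. (1 / real p) ^ n < e" by (auto simp: eventually_sequentially)
  thus ?thesis using that[of "max N n0"] by (simp add: power_one_over)
qed

text \<open>Density of the integers in the p-adic integers: a nearby rational has norm at most 1, so
  \<open>p\<close> does not divide its denominator \<open>b\<close>, and an inverse \<open>c\<close>
  of \<open>b\<close> modulo \<open>p ^ M\<close> gives the integer \<open>a * c\<close>.\<close>

lemma close_exists: assumes x: "x \<in> carrier K" and n: "nrm x \<le> 1" shows "\<exists>a. close M x a"
proof -
  obtain q where q: "nrm (x \<ominus>\<^bsub>K\<^esub> emb q) < 1 / real p ^ M"
    using emb_dense[OF x, of "1 / real p ^ M"] p_gt_0 by auto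
  have "emb q = x \<ominus>\<^bsub>K\<^esub> (x \<ominus>\<^bsub>K\<^esub> emb q)" using x
    by (simp add: a_minus_def K.minus_add flip: K.a_assoc) (simp add: K.r_neg)
  hence "nrm (emb q) \<le> max (nrm x) (nrm (x \<ominus>\<^bsub>K\<^esub> emb q))" using nrm_diff[OF x, of "x \<ominus>\<^bsub>K\<^esub> emb q"] x by simp
  also have "\<dots> \<le> 1" using n q p_pow_inverse(1)[of M] by linarith
  finally have q1: "pabs q \<le> 1" by simp
  obtain a b where ab: "quotient_of q = (a, b)" by fastforce
  have qab: "q = of_int a / of_int b" using quotient_of_div[OF ab] .
  have b: "b > 0" using quotient_of_denom_pos[OF ab] .
  have cop: "coprime a b" using quotient_of_coprime[OF ab] .
  have "\<not> int p dvd b"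
  proof
    assume pb: "int p dvd b"
    hence "\<not> int p dvd a" using cop prime_int_p by (meson coprime_common_divisor not_prime_unit)
    hence "multiplicity (int p) a = 0" "a \<noteq> 0" by (auto simp: not_dvd_imp_multiplicity_0)
    moreover have "multiplicity (int p) b \<ge> 1" using pb b prime_int_p
      by (metis One_nat_def Suc_leI less_irrefl multiplicity_eq_zero_iff not_gr_zero not_prime_unit)
    ultimately have "pabs q > 1" using p_gt_1 b one_less_power[of "real p" "multiplicity (int p) b"]
      by (simp add: qab pabs_frac)
    thus False using q1 by simp
  qed
  hence "coprime b (int p ^ M)" using prime_int_p by (metis coprime_commute coprime_power_left_iff prime_imp_coprime)
  then obtain c where c: "[b * c = 1] (mod int p ^ M)" using cong_solve_coprime_int by blast
  have pb1: "pabs (of_int b) = 1" using \<open>\<not> int p dvd b\<close> b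
    by (simp add: pabs_int not_dvd_imp_multiplicity_0)
  have "int p ^ M dvd a - (a * c) * b"
    using c by (metis (no_types, opaque_lifting) cong_iff_dvd_diff cong_scalar_left cong_sym mult.assoc mult.commute mult.right_neutral)
  hence "pabs (of_int (a - (a * c) * b)) \<le> 1 / real p ^ M" using pabs_int_le_iff by blast
  moreover have "q - of_int (a * c) = of_int (a - (a * c) * b) / of_int b" using b by (simp add: qab field_simps)
  ultimately have "pabs (q - of_int (a * c)) \<le> 1 / real p ^ M" using pb1 by (simp add: pabs_divide)
  hence "nrm (emb q \<ominus>\<^bsub>K\<^esub> emb (of_int (a * c))) \<le> 1 / real p ^ M" by (metis emb_diff nrm_emb)
  hence "close M x (a * c)" using q x nrm_diff_trans[of x "emb q" "emb (of_int (a * c))"] by (auto simp: close_def)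
  thus ?thesis by blast
qed

text \<open>The outer \<open>mod\<close> turns an arbitrary choice of a \<open>close\<close> integer
  into the unique one from 0 to \<open>p ^ M - 1\<close>, the range that the carrier of
  \<open>FpG\<close> demands.\<close>

definition residue :: "nat \<Rightarrow> qp \<Rightarrow> int" where
  "residue M x = (SOME a. close M x a) mod int p ^ M"

lemma residue_range: "0 \<le> residue M x" "residue M x < int p ^ M"
  using p_gt_0 by (auto simp: residue_def)

lemma residue_close: "x \<in> carrier K \<Longrightarrow> nrm x \<le> 1 \<Longrightarrow> close M x (residue M x)"
  unfolding residue_def using close_exists[of x M] by (metis someI_ex close_mod cong_mod_right cong_refl)

lemma residue_eq: "close M x a \<Longrightarrow> residue M x = a mod int p ^ M"
  unfolding residue_def using close_unique by (metis someI cong_def)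

text \<open>Agreement modulo all powers of \<open>p\<close> is equality. The exponents start at 1
  because the group rings are set up for a modulus above 1.\<close>

lemma K_eq_closeI:
  assumes "\<And>M. M \<ge> 1 \<Longrightarrow> \<exists>a. close M x a \<and> close M y a" shows "x = y"
proof (rule K_eqI)
  show xy: "x \<in> carrier K" "y \<in> carrier K" using assms[of 1] by (auto simp: close_def)
  fix e :: real assume "e > 0"
  then obtain M where M: "M \<ge> 1" "1 / real p ^ M < e" using one_over_p_pow_small by blast
  then obtain a where "close M x a" "close M y a" using assms by blast
  hence "nrm (x \<ominus>\<^bsub>K\<^esub> y) \<le> 1 / real p ^ M"
    using xy nrm_diff_trans[of x "emb (of_int a)" y] nrm_diff_commute[of y "emb (of_int a)"] by (auto simp: close_def)
  thus "nrm (x \<ominus>\<^bsub>K\<^esub> y) \<le> e" using M by simp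
qed

section \<open>Unordered sums of null families\<close>

lemma nrm_finsum_le:
  assumes "B \<ge> 0" "\<And>i. i \<in> A \<Longrightarrow> f i \<in> carrier K" "\<And>i. i \<in> A \<Longrightarrow> nrm (f i) \<le> B"
  shows "nrm (finsum K f A) \<le> B"
  using assms(2,3)
proof (induction A rule: infinite_finite_induct)
  case (insert x F)
  have "finsum K f F \<in> carrier K" using insert by (intro K.finsum_closed) auto
  hence "nrm (f x \<oplus>\<^bsub>K\<^esub> finsum K f F) \<le> B" using insert nrm_add[of "f x" "finsum K f F"] by fastforce
  thus ?case using insert by (simp add: Pi_def)
qed (use assms(1) in simp_all)

lemma finsum_diff_subset:
  assumes "finite B" "A \<subseteq> B" "\<And>i. i \<in> B \<Longrightarrow> f i \<in> carrier K"
  shows "finsum K f B \<ominus>\<^bsub>K\<^esub> finsum K f A = finsum K f (B - A)"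
proof -
  have "finsum K f (A \<union> (B - A)) = finsum K f A \<oplus>\<^bsub>K\<^esub> finsum K f (B - A)"
    by (rule K.finsum_Un_disjoint) (use assms finite_subset in auto)
  moreover have "A \<union> (B - A) = B" using assms by auto
  moreover have "finsum K f A \<in> carrier K" "finsum K f (B - A) \<in> carrier K"
    using assms by (auto intro!: K.finsum_closed)
  ultimately show ?thesis
    by (simp add: a_minus_def K.a_comm[of "finsum K f A"] K.a_assoc K.r_neg)
qed

text \<open>Ultrametric convergence: \<open>A n\<close> holds the finitely many terms of norm at
  least \<open>1 / Suc n\<close>, and enlarging it by any finite set changes the sum by at most
  \<open>1 / Suc n\<close>.\<close>

lemma qp_has_sum_exists:
  assumes F: "\<And>s. s \<in> S \<Longrightarrow> F s \<in> carrier K" and fin: "\<And>e. e > 0 \<Longrightarrow> finite {s \<in> S. nrm (F s) \<ge> e}"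
  shows "\<exists>L. qp_has_sum p F S L"
proof -
  define A where "A n = {s \<in> S. nrm (F s) \<ge> 1 / Suc n}" for n
  have A: "finite (A n)" "A n \<subseteq> S" for n unfolding A_def by (auto intro!: fin)
  define Y where "Y n = finsum K F (A n)" for n
  have Y: "Y n \<in> carrier K" for n unfolding Y_def using F A by (auto intro!: K.finsum_closed)
  have bd: "nrm (finsum K F B \<ominus>\<^bsub>K\<^esub> Y n) \<le> 1 / Suc n" if "finite B" "A n \<subseteq> B" "B \<subseteq> S" for B n
  proof -
    have "finsum K F B \<ominus>\<^bsub>K\<^esub> Y n = finsum K F (B - A n)"
      unfolding Y_def by (rule finsum_diff_subset) (use that F in auto)
    also have "nrm \<dots> \<le> 1 / Suc n" by (rule nrm_finsum_le) (use that F in \<open>auto simp: A_def not_le dest: less_imp_le\<close>)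
    finally show ?thesis .
  qed
  have mono: "A m \<subseteq> A n" if "m \<le> n" for m n
  proof -
    have "1 / real (Suc n) \<le> 1 / Suc m" using that by (intro frac_le) auto
    thus ?thesis by (auto simp: A_def)
  qed
  have YY: "nrm (Y m \<ominus>\<^bsub>K\<^esub> Y n) \<le> 1 / Suc (min m n)" for m n
  proof (cases "m \<le> n")
    case True
    have "nrm (Y n \<ominus>\<^bsub>K\<^esub> Y m) \<le> 1 / Suc m" using bd[OF A(1) mono[OF True] A(2)] unfolding Y_def[of n] .
    thus ?thesis using nrm_diff_commute[OF Y Y, of m n] True by (simp add: min_absorb1)
  next
    case False
    hence "n \<le> m" by simp
    have "nrm (Y m \<ominus>\<^bsub>K\<^esub> Y n) \<le> 1 / Suc n" using bd[OF A(1) mono[OF \<open>n \<le> m\<close>] A(2)] unfolding Y_def[of m] .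
    thus ?thesis using \<open>n \<le> m\<close> by (simp add: min_absorb2)
  qed
  have small: "\<exists>n. 1 / Suc n < e" if "e > 0" for e :: real by (rule nat_approx_posE[OF that]) (rule exI)
  have C: "\<exists>N. \<forall>m\<ge>N. \<forall>n\<ge>N. nrm (Y m \<ominus>\<^bsub>K\<^esub> Y n) < e" if e: "e > 0" for e
  proof -
    obtain N where N: "1 / Suc N < e" using small e by blast
    have "nrm (Y m \<ominus>\<^bsub>K\<^esub> Y n) < e" if "m \<ge> N" "n \<ge> N" for m n
    proof -
      have "1 / real (Suc (min m n)) \<le> 1 / Suc N" using that by (intro frac_le) auto
      thus ?thesis using YY[of m n] N by linarith
    qed
    thus ?thesis by blast
  qed
  obtain L where L: "L \<in> carrier K" "(\<lambda>n. nrm (Y n \<ominus>\<^bsub>K\<^esub> L)) \<longlonglongrightarrow> 0"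
    by (rule K_complete[OF Y C])
  have "\<exists>A. finite A \<and> A \<subseteq> S \<and> (\<forall>B. finite B \<and> A \<subseteq> B \<and> B \<subseteq> S \<longrightarrow> nrm (finsum K F B \<ominus>\<^bsub>K\<^esub> L) < e)"
    if e: "e > 0" for e
  proof -
    obtain N where N: "1 / Suc N < e" using small e by blast
    have "eventually (\<lambda>n. nrm (Y n \<ominus>\<^bsub>K\<^esub> L) < e) sequentially" using L(2) e by (rule order_tendstoD)
    then obtain N' where N': "\<forall>n\<ge>N'. nrm (Y n \<ominus>\<^bsub>K\<^esub> L) < e" by (auto simp: eventually_sequentially)
    define m where "m = max N N'"
    have "1 / real (Suc m) \<le> 1 / Suc N" unfolding m_def by (intro frac_le) auto
    hence m: "1 / Suc m < e" "nrm (Y m \<ominus>\<^bsub>K\<^esub> L) < e" using N N' by (auto simp: m_def)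
    have "nrm (finsum K F B \<ominus>\<^bsub>K\<^esub> L) < e" if "finite B" "A m \<subseteq> B" "B \<subseteq> S" for B
    proof -
      have c: "finsum K F B \<in> carrier K" using F that by (auto intro!: K.finsum_closed)
      show ?thesis using nrm_diff_trans[of "finsum K F B" "Y m" L, OF c Y L(1)] bd[OF that] m by linarith
    qed
    thus ?thesis by (intro exI[of _ "A m"] conjI A allI impI) blast
  qed
  thus ?thesis using L(1) unfolding qp_has_sum_def carrier_K by (intro exI[of _ L] conjI allI impI)
qed

lemma qp_has_sum_unique:
  assumes F: "\<And>s. s \<in> S \<Longrightarrow> F s \<in> carrier K" and "qp_has_sum p F S L" "qp_has_sum p F S L'"
  shows "L = L'"
proof (rule K_eqI)
  show LL: "L \<in> carrier K" "L' \<in> carrier K" using assms by (auto simp: qp_has_sum_def carrier_K)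
  fix e :: real assume e: "e > 0"
  obtain A where A: "finite A" "A \<subseteq> S" "\<forall>B. finite B \<and> A \<subseteq> B \<and> B \<subseteq> S \<longrightarrow> nrm (finsum K F B \<ominus>\<^bsub>K\<^esub> L) < e"
    using assms(2) e unfolding qp_has_sum_def by blast
  obtain A' where A': "finite A'" "A' \<subseteq> S" "\<forall>B. finite B \<and> A' \<subseteq> B \<and> B \<subseteq> S \<longrightarrow> nrm (finsum K F B \<ominus>\<^bsub>K\<^esub> L') < e"
    using assms(3) e unfolding qp_has_sum_def by blast
  have "nrm (finsum K F (A \<union> A') \<ominus>\<^bsub>K\<^esub> L) < e" "nrm (finsum K F (A \<union> A') \<ominus>\<^bsub>K\<^esub> L') < e"
    using A(1,2) A'(1,2) by (auto intro!: A(3)[rule_format] A'(3)[rule_format])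
  moreover have c: "finsum K F (A \<union> A') \<in> carrier K" using A(2) A'(2) F by (intro K.finsum_closed) auto
  ultimately show "nrm (L \<ominus>\<^bsub>K\<^esub> L') \<le> e"
    using nrm_diff_trans[OF LL(1) c LL(2)] nrm_diff_commute[OF LL(1) c] by linarith
qed

lemma qp_sum_has_sum:
  assumes F: "\<And>s. s \<in> S \<Longrightarrow> F s \<in> carrier K" and fin: "\<And>e. e > 0 \<Longrightarrow> finite {s \<in> S. nrm (F s) \<ge> e}"
  shows "qp_has_sum p F S (qp_sum p F S)"
proof -
  obtain L where L: "qp_has_sum p F S L" using qp_has_sum_exists[OF assms] ..
  show ?thesis unfolding qp_sum_def by (rule theI[of "qp_has_sum p F S", OF L]) (rule qp_has_sum_unique[OF F _ L])
qed

lemma qp_has_sum_nrm_le: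
  assumes F: "\<And>s. s \<in> S \<Longrightarrow> F s \<in> carrier K" and L: "qp_has_sum p F S L" and "finite T" "T \<subseteq> S"
    and B: "B > 0" "\<And>s. s \<in> S - T \<Longrightarrow> nrm (F s) \<le> B"
  shows "nrm (L \<ominus>\<^bsub>K\<^esub> finsum K F T) \<le> B"
proof -
  obtain A where A: "finite A" "A \<subseteq> S" "\<forall>C. finite C \<and> A \<subseteq> C \<and> C \<subseteq> S \<longrightarrow> nrm (finsum K F C \<ominus>\<^bsub>K\<^esub> L) < B"
    using L B(1) unfolding qp_has_sum_def by blast
  let ?C = "A \<union> T"
  have LK: "L \<in> carrier K" using L by (auto simp: qp_has_sum_def carrier_K)
  have cl: "finsum K F ?C \<in> carrier K" "finsum K F T \<in> carrier K" using A(2) F assms(4) by (auto intro!: K.finsum_closed)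
  have "nrm (finsum K F ?C \<ominus>\<^bsub>K\<^esub> L) < B" using A(1,2) assms(3,4) by (intro A(3)[rule_format]) auto
  moreover have "nrm (finsum K F ?C \<ominus>\<^bsub>K\<^esub> finsum K F T) \<le> B"
    by (subst finsum_diff_subset) (use assms(3,4) A(1,2) B in \<open>auto intro!: nrm_finsum_le F\<close>)
  ultimately show ?thesis using nrm_diff_trans[OF LK cl] nrm_diff_commute[OF LK cl(1)] by linarith
qed

text \<open>Modulo \<open>p ^ M\<close> an infinite sum is a finite one; this is how convolutions in
  \<open>c0\<close> turn into convolutions in a group ring.\<close>

lemma qp_has_sum_close:
  assumes F: "\<And>s. s \<in> S \<Longrightarrow> F s \<in> carrier K" and L: "qp_has_sum p F S L" and "finite T" "T \<subseteq> S"
    and "\<And>s. s \<in> S - T \<Longrightarrow> close M (F s) 0" "\<And>s. s \<in> T \<Longrightarrow> close M (F s) (a s)"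
  shows "close M L (sum a T)"
proof -
  have LK: "L \<in> carrier K" using L by (auto simp: qp_has_sum_def carrier_K)
  have cl: "finsum K F T \<in> carrier K" using F assms by (auto intro!: K.finsum_closed)
  have "nrm (L \<ominus>\<^bsub>K\<^esub> finsum K F T) \<le> 1 / real p ^ M"
    by (rule qp_has_sum_nrm_le[OF F L]) (use assms F in \<open>auto simp: close_0_iff\<close>)
  moreover have "close M (finsum K F T) (sum a T)" by (rule close_finsum) (use assms in auto)
  ultimately show ?thesis using nrm_diff_trans[OF LK cl, of "emb (of_int (sum a T))"] LK unfolding close_def by auto
qed

end

section \<open>The ring of null sequences on a group\<close>

locale padic_group = padic p + group G for p and G :: "('g, 'b) monoid_scheme" (structure)
begin

abbreviation "CG \<equiv> c0 p G"
abbreviation "ZG \<equiv> c0Z p G"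

lemma c0_setI: "(\<And>g. g \<in> carrier G \<Longrightarrow> f g \<in> carrier K) \<Longrightarrow> (\<And>g. g \<notin> carrier G \<Longrightarrow> f g = \<zero>\<^bsub>K\<^esub>) \<Longrightarrow>
   (\<And>e. e > 0 \<Longrightarrow> finite {g \<in> carrier G. nrm (f g) \<ge> e}) \<Longrightarrow> f \<in> c0_set p G"
  by (auto simp: c0_set_def carrier_K)

lemma c0_set_closed: "f \<in> c0_set p G \<Longrightarrow> f g \<in> carrier K"
  by (cases "g \<in> carrier G") (auto simp: c0_set_def carrier_K[symmetric])

lemma c0_set_outside: "f \<in> c0_set p G \<Longrightarrow> g \<notin> carrier G \<Longrightarrow> f g = \<zero>\<^bsub>K\<^esub>"
  and c0_set_finite: "f \<in> c0_set p G \<Longrightarrow> e > 0 \<Longrightarrow> finite {g \<in> carrier G. nrm (f g) \<ge> e}"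
  by (auto simp: c0_set_def)

lemma c0_carrier: "carrier CG = c0_set p G" by (simp add: c0_def)

lemma c0_simps:
  "\<zero>\<^bsub>CG\<^esub> = (\<lambda>_. \<zero>\<^bsub>K\<^esub>)" "\<one>\<^bsub>CG\<^esub> = delta K \<one>"
  "f \<oplus>\<^bsub>CG\<^esub> h = (\<lambda>x. if x \<in> carrier G then f x \<oplus>\<^bsub>K\<^esub> h x else \<zero>\<^bsub>K\<^esub>)"
  by (simp_all add: c0_def)

lemma c0Z_simps:
  "\<zero>\<^bsub>ZG\<^esub> = \<zero>\<^bsub>CG\<^esub>" "\<one>\<^bsub>ZG\<^esub> = \<one>\<^bsub>CG\<^esub>" "ring.add ZG = ring.add CG" "monoid.mult ZG = monoid.mult CG"
  by (simp_all add: c0Z_def c0_def)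

lemma c0_bdd_above: assumes "f \<in> c0_set p G" shows "bdd_above ((\<lambda>g. nrm (f g)) ` carrier G)"
proof -
  have "(\<lambda>g. nrm (f g)) ` carrier G \<subseteq> (\<lambda>g. nrm (f g)) ` {g \<in> carrier G. nrm (f g) \<ge> 1} \<union> {..1}" by auto
  moreover have "bdd_above ((\<lambda>g. nrm (f g)) ` {g \<in> carrier G. nrm (f g) \<ge> 1} \<union> {..1})"
    using c0_set_finite[OF assms] by simp
  ultimately show ?thesis by (rule bdd_above_mono[rotated])
qed

lemma c0_norm_le_iff: "f \<in> c0_set p G \<Longrightarrow> c0_norm p G f \<le> e \<longleftrightarrow> (\<forall>g\<in>carrier G. nrm (f g) \<le> e)"
  unfolding c0_norm_def using one_closed by (subst cSUP_le_iff) (auto simp: c0_bdd_above)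

lemma c0Z_iff: "f \<in> carrier ZG \<longleftrightarrow> f \<in> c0_set p G \<and> (\<forall>g\<in>carrier G. nrm (f g) \<le> 1)"
  using c0_norm_le_iff[of f 1] by (auto simp: c0Z_def)

lemma c0Z_c0: "f \<in> carrier ZG \<Longrightarrow> f \<in> c0_set p G"
  by (simp add: c0Z_iff)

lemma c0Z_closed: "f \<in> carrier ZG \<Longrightarrow> f g \<in> carrier K"
  by (simp add: c0Z_iff c0_set_closed)

lemma c0Z_nrm: "f \<in> carrier ZG \<Longrightarrow> nrm (f g) \<le> 1"
  by (cases "g \<in> carrier G") (auto simp: c0Z_iff c0_set_outside)

lemma c0_zero_closed: "\<zero>\<^bsub>CG\<^esub> \<in> c0_set p G"
  by (rule c0_setI) (auto simp: c0_simps)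

lemma c0_add_closed: assumes "f \<in> c0_set p G" "h \<in> c0_set p G" shows "f \<oplus>\<^bsub>CG\<^esub> h \<in> c0_set p G"
proof (rule c0_setI)
  fix e :: real assume e: "e > 0"
  have "{g \<in> carrier G. nrm ((f \<oplus>\<^bsub>CG\<^esub> h) g) \<ge> e} \<subseteq> {g \<in> carrier G. nrm (f g) \<ge> e} \<union> {g \<in> carrier G. nrm (h g) \<ge> e}"
  proof
    fix g assume g: "g \<in> {g \<in> carrier G. nrm ((f \<oplus>\<^bsub>CG\<^esub> h) g) \<ge> e}"
    hence "e \<le> max (nrm (f g)) (nrm (h g))"
      using nrm_add[of "f g" "h g"] assms by (auto simp: c0_simps c0_set_closed)
    thus "g \<in> {g \<in> carrier G. nrm (f g) \<ge> e} \<union> {g \<in> carrier G. nrm (h g) \<ge> e}" using g by (auto simp: max_def split: if_splits)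
  qed
  thus "finite {g \<in> carrier G. nrm ((f \<oplus>\<^bsub>CG\<^esub> h) g) \<ge> e}"
    by (rule finite_subset) (use assms e in \<open>simp add: c0_set_finite\<close>)
qed (use assms in \<open>auto simp: c0_simps c0_set_closed\<close>)

lemma c0_uminus_closed: assumes "f \<in> c0_set p G" shows "(\<lambda>g. \<ominus>\<^bsub>K\<^esub> f g) \<in> c0_set p G"
  by (rule c0_setI) (use assms in \<open>auto simp: c0_set_closed c0_set_outside nrm_uminus c0_set_finite\<close>)

lemma abelian_group_c0: "abelian_group CG"
proof (rule abelian_groupI)
  fix f assume f: "f \<in> carrier CG"
  show "\<exists>h\<in>carrier CG. h \<oplus>\<^bsub>CG\<^esub> f = \<zero>\<^bsub>CG\<^esub>"
    by (rule bexI[of _ "\<lambda>g. \<ominus>\<^bsub>K\<^esub> f g"])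
      (use f in \<open>auto simp: c0_carrier c0_uminus_closed c0_set_closed c0_simps K.l_neg fun_eq_iff\<close>)
qed (auto simp: c0_carrier c0_zero_closed c0_add_closed,
     auto simp: c0_simps c0_set_closed c0_set_outside fun_eq_iff K.a_ac)

lemma c0Z_zero_closed: "\<zero>\<^bsub>CG\<^esub> \<in> carrier ZG"
  using c0_zero_closed by (auto simp: c0Z_iff c0_simps)

lemma c0Z_add_closed: "f \<in> carrier ZG \<Longrightarrow> h \<in> carrier ZG \<Longrightarrow> f \<oplus>\<^bsub>CG\<^esub> h \<in> carrier ZG"
  unfolding c0Z_iff
proof (elim conjE, intro conjI ballI)
  fix g assume "f \<in> c0_set p G" "h \<in> c0_set p G" "\<forall>g\<in>carrier G. nrm (f g) \<le> 1" "\<forall>g\<in>carrier G. nrm (h g) \<le> 1" "g \<in> carrier G"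
  thus "nrm ((f \<oplus>\<^bsub>CG\<^esub> h) g) \<le> 1" using nrm_add[of "f g" "h g"] by (fastforce simp: c0_simps c0_set_closed)
qed (simp add: c0_add_closed)

lemma c0Z_uminus_closed: "f \<in> carrier ZG \<Longrightarrow> (\<lambda>g. \<ominus>\<^bsub>K\<^esub> f g) \<in> carrier ZG"
  unfolding c0Z_iff by (auto simp: c0_uminus_closed nrm_uminus c0_set_closed)

lemma abelian_group_c0Z: "abelian_group ZG"
proof (rule abelian_groupI)
  fix f assume f: "f \<in> carrier ZG"
  show "\<exists>h\<in>carrier ZG. h \<oplus>\<^bsub>ZG\<^esub> f = \<zero>\<^bsub>ZG\<^esub>"
    by (rule bexI[OF _ c0Z_uminus_closed[OF f]]) (use f in \<open>auto simp: c0Z_closed c0Z_simps c0_simps K.l_neg fun_eq_iff\<close>)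
qed (auto simp: c0Z_simps c0Z_zero_closed c0Z_add_closed,
     auto simp: c0_simps c0Z_closed c0_set_outside[OF c0Z_c0] fun_eq_iff K.a_ac)

lemma delta_closed: "g \<in> carrier G \<Longrightarrow> delta K g \<in> carrier ZG"
  unfolding c0Z_iff
proof
  assume g: "g \<in> carrier G"
  show "delta K g \<in> c0_set p G"
  proof (rule c0_setI)
    fix e :: real assume "e > 0"
    hence "{x \<in> carrier G. nrm (delta K g x) \<ge> e} \<subseteq> {g}"
      by (auto simp: delta_def split: if_splits)
    thus "finite {x \<in> carrier G. nrm (delta K g x) \<ge> e}" by (rule finite_subset) simp
  qed (use g in \<open>auto simp: delta_def\<close>)
qed (auto simp: delta_def)

text \<open>The product is a definite description through \<open>qp_sum\<close>, so summability
  comes before any computation with it. Decay of \<open>f\<close> is enough because \<open>h\<close>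
  is bounded by 1.\<close>

lemma c0_mult_has_sum:
  assumes f: "f \<in> carrier ZG" and h: "h \<in> carrier ZG" and x: "x \<in> carrier G"
  shows "qp_has_sum p (\<lambda>g. f g \<otimes>\<^bsub>K\<^esub> h (inv g \<otimes> x)) (carrier G) ((f \<otimes>\<^bsub>CG\<^esub> h) x)"
proof -
  have "qp_has_sum p (\<lambda>g. f g \<otimes>\<^bsub>K\<^esub> h (inv g \<otimes> x)) (carrier G) (qp_sum p (\<lambda>g. f g \<otimes>\<^bsub>K\<^esub> h (inv g \<otimes> x)) (carrier G))"
  proof (rule qp_sum_has_sum)
    fix e :: real assume e: "e > 0"
    have "nrm (f g \<otimes>\<^bsub>K\<^esub> h (inv g \<otimes> x)) \<le> nrm (f g)" for g
      using mult_left_mono[OF c0Z_nrm[OF h] nrm_nonneg[OF c0Z_closed[OF f]], of g "inv g \<otimes> x"]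
      by (simp add: nrm_mult c0Z_closed f h)
    hence "{g \<in> carrier G. nrm (f g \<otimes>\<^bsub>K\<^esub> h (inv g \<otimes> x)) \<ge> e} \<subseteq> {g \<in> carrier G. nrm (f g) \<ge> e}"
      by (auto intro: order_trans)
    thus "finite {g \<in> carrier G. nrm (f g \<otimes>\<^bsub>K\<^esub> h (inv g \<otimes> x)) \<ge> e}"
      using c0_set_finite[OF c0Z_c0[OF f] e] finite_subset by blast
  qed (use f h in \<open>auto simp: c0Z_closed\<close>)
  thus ?thesis using x by (simp add: c0_def)
qed

lemma c0_mult_outside: "x \<notin> carrier G \<Longrightarrow> (f \<otimes>\<^bsub>CG\<^esub> h) x = \<zero>\<^bsub>K\<^esub>"
  by (simp add: c0_def)

lemma c0_mult_in_K:
  assumes "f \<in> carrier ZG" "h \<in> carrier ZG" shows "(f \<otimes>\<^bsub>CG\<^esub> h) x \<in> carrier K"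
  using c0_mult_has_sum[OF assms, of x] c0_mult_outside[of x]
  by (cases "x \<in> carrier G") (auto simp: qp_has_sum_def carrier_K[symmetric])

lemma c0_mult_nrm:
  assumes f: "f \<in> carrier ZG" and h: "h \<in> carrier ZG" and B: "\<And>g. nrm (f g) \<le> a" "\<And>g. nrm (h g) \<le> b" "a > 0" "b > 0"
  shows "nrm ((f \<otimes>\<^bsub>CG\<^esub> h) x) \<le> a * b"
proof (cases "x \<in> carrier G")
  case True
  have "nrm ((f \<otimes>\<^bsub>CG\<^esub> h) x \<ominus>\<^bsub>K\<^esub> finsum K (\<lambda>g. f g \<otimes>\<^bsub>K\<^esub> h (inv g \<otimes> x)) {}) \<le> a * b"
    by (rule qp_has_sum_nrm_le[OF _ c0_mult_has_sum[OF f h True]])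
      (use f h B in \<open>auto simp: c0Z_closed nrm_mult nrm_nonneg intro!: mult_mono less_imp_le[OF B(3)]\<close>)
  thus ?thesis using c0_mult_in_K[OF f h, of x] by (simp add: a_minus_def)
qed (use B in \<open>auto simp: c0_mult_outside\<close>)

section \<open>Reduction of coefficients modulo \<open>p ^ M\<close>\<close>

definition red :: "nat \<Rightarrow> ('g \<Rightarrow> qp) \<Rightarrow> 'g \<Rightarrow> int" where
  "red M f = (\<lambda>g. if g \<in> carrier G then residue M (f g) else 0)"

lemma red_close: "f \<in> carrier ZG \<Longrightarrow> close M (f g) (red M f g)"
  by (cases "g \<in> carrier G")
    (auto simp: red_def residue_close c0Z_closed c0Z_nrm c0_set_outside[OF c0Z_c0] close_0_iff)

lemma red_eq: "close M (f g) a \<Longrightarrow> g \<in> carrier G \<Longrightarrow> red M f g = a mod int (p ^ M)"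
  by (simp add: red_def residue_eq)

lemma red_finite: assumes f: "f \<in> carrier ZG" shows "finite {g \<in> carrier G. red M f g \<noteq> 0}"
proof -
  have "red M f g = 0" if "g \<in> carrier G" "nrm (f g) < 1 / real p ^ M" for g
    using red_eq[of M f g 0] that f by (simp add: close_0_iff c0Z_closed)
  hence "{g \<in> carrier G. red M f g \<noteq> 0} \<subseteq> {g \<in> carrier G. nrm (f g) \<ge> 1 / real p ^ M}"
    by (auto simp: not_less[symmetric])
  thus ?thesis using c0_set_finite[OF c0Z_c0[OF f] p_pow_inverse(2)] finite_subset by blast
qed

text \<open>Terms at which \<open>f\<close> has residue zero are negligible since \<open>h\<close>
  is integral, so the finite support of the reduction of \<open>f\<close> is the right index set; it
  is also the one in the product of \<open>FpG\<close>.\<close>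

lemma c0_mult_close:
  assumes f: "f \<in> carrier ZG" and h: "h \<in> carrier ZG" and x: "x \<in> carrier G"
  shows "close M ((f \<otimes>\<^bsub>CG\<^esub> h) x) (\<Sum>g\<in>{g \<in> carrier G. red M f g \<noteq> 0}. red M f g * red M h (inv g \<otimes> x))"
proof (rule qp_has_sum_close[OF _ c0_mult_has_sum[OF f h x]])
  fix s assume "s \<in> carrier G - {g \<in> carrier G. red M f g \<noteq> 0}"
  hence "close M (f s \<otimes>\<^bsub>K\<^esub> h (inv s \<otimes> x)) (0 * red M h (inv s \<otimes> x))"
    using red_close[OF f, of M s] by (intro close_mult red_close h) auto
  thus "close M (f s \<otimes>\<^bsub>K\<^esub> h (inv s \<otimes> x)) 0" by simp
qed (use f h in \<open>auto simp: c0Z_closed red_finite intro!: close_mult red_close\<close>)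

lemma c0Z_ext:
  assumes "f \<in> carrier ZG" "h \<in> carrier ZG" "\<And>M. M \<ge> 1 \<Longrightarrow> red M f = red M h" shows "f = h"
proof
  fix g show "f g = h g" by (rule K_eq_closeI) (metis assms red_close)
qed

context
  fixes M :: nat
  assumes M: "M \<ge> 1"
begin

lemma group_ring_mod_p_pow: "group_ring_mod G (p ^ M)"
  by unfold_locales (use M one_less_power[of p M] p_gt_1 in simp)

interpretation F: group_ring_mod G "p ^ M" by (rule group_ring_mod_p_pow)

lemma red_closed: "f \<in> carrier ZG \<Longrightarrow> red M f \<in> carrier (FpG (p ^ M) G)"
  by (rule F.FpG_I) (auto simp: red_finite, auto simp: red_def residue_range)

lemma red_add:
  assumes "f \<in> carrier ZG" "h \<in> carrier ZG" shows "red M (f \<oplus>\<^bsub>CG\<^esub> h) = red M f \<oplus>\<^bsub>FpG (p ^ M) G\<^esub> red M h"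
proof
  fix x show "red M (f \<oplus>\<^bsub>CG\<^esub> h) x = (red M f \<oplus>\<^bsub>FpG (p ^ M) G\<^esub> red M h) x"
  proof (cases "x \<in> carrier G")
    case True
    thus ?thesis using red_eq[of M "f \<oplus>\<^bsub>CG\<^esub> h" x "red M f x + red M h x"] assms
      by (simp add: F.FpG_simps c0_simps close_add red_close)
  qed (simp add: red_def F.FpG_simps)
qed

lemma red_mult_eq:
  assumes "f \<in> carrier ZG" "h \<in> carrier ZG" shows "red M (f \<otimes>\<^bsub>CG\<^esub> h) = red M f \<otimes>\<^bsub>FpG (p ^ M) G\<^esub> red M h"
proof
  fix x show "red M (f \<otimes>\<^bsub>CG\<^esub> h) x = (red M f \<otimes>\<^bsub>FpG (p ^ M) G\<^esub> red M h) x"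
  proof (cases "x \<in> carrier G")
    case True
    show ?thesis
      using red_eq[of M "f \<otimes>\<^bsub>CG\<^esub> h", OF c0_mult_close[OF assms True] True]
        F.FpG_mult_eq[of "F.supp (red M f)" "red M f" x "red M h"] True red_finite[OF assms(1)] by simp
  qed (simp add: red_def F.FpG_mult_outside)
qed

lemma red_delta: "g \<in> carrier G \<Longrightarrow> red M (delta K g) = Fp_elt g"
proof
  fix x assume g: "g \<in> carrier G"
  have "close M (delta K g x) (Fp_elt g x)"
    using close_emb[of M 1] close_emb[of M 0] by (auto simp: delta_def Fp_elt_def)
  thus "red M (delta K g) x = Fp_elt g x"
    using red_eq[of M "delta K g" x] M p_gt_1 g F.Fp_elt_closed[OF g]
    by (cases "x \<in> carrier G") (auto simp: red_def Fp_elt_def)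
qed

end

text \<open>A coefficient of norm at least \<open>e\<close> is nonzero modulo a suitable
  \<open>p ^ M\<close>, and modulo \<open>p ^ M\<close> the product lies in a group ring, where
  supports are finite.\<close>

lemma c0Z_mult_closed:
  assumes f: "f \<in> carrier ZG" and h: "h \<in> carrier ZG" shows "f \<otimes>\<^bsub>CG\<^esub> h \<in> carrier ZG"
  unfolding c0Z_iff
proof
  show "f \<otimes>\<^bsub>CG\<^esub> h \<in> c0_set p G"
  proof (rule c0_setI)
    fix e :: real assume "e > 0"
    then obtain M where M: "M \<ge> 1" "1 / real p ^ M < e" using one_over_p_pow_small by blast
    interpret F: group_ring_mod G "p ^ M" by (rule group_ring_mod_p_pow[OF M(1)])
    have "red M (f \<otimes>\<^bsub>CG\<^esub> h) g \<noteq> 0" if "g \<in> carrier G" "nrm ((f \<otimes>\<^bsub>CG\<^esub> h) g) \<ge> e" for g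
    proof
      assume 0: "red M (f \<otimes>\<^bsub>CG\<^esub> h) g = 0"
      have "close M ((f \<otimes>\<^bsub>CG\<^esub> h) g) (red M (f \<otimes>\<^bsub>CG\<^esub> h) g)"
        using residue_close c0_mult_close[OF f h that(1), THEN close_nrm_le_1] c0_mult_in_K[OF f h] that
        by (simp add: red_def)
      thus False using 0 that M c0_mult_in_K[OF f h] by (simp add: close_0_iff)
    qed
    hence "{g \<in> carrier G. nrm ((f \<otimes>\<^bsub>CG\<^esub> h) g) \<ge> e} \<subseteq> {g \<in> carrier G. (red M f \<otimes>\<^bsub>FpG (p ^ M) G\<^esub> red M h) g \<noteq> 0}"
      using red_mult_eq[OF M(1) f h] by auto
    moreover have "finite {g \<in> carrier G. (red M f \<otimes>\<^bsub>FpG (p ^ M) G\<^esub> red M h) g \<noteq> 0}"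
      by (rule F.FpG_finite[OF F.FpG_mult_closed[OF red_closed red_closed]]) (use f h M in auto)
    ultimately show "finite {g \<in> carrier G. nrm ((f \<otimes>\<^bsub>CG\<^esub> h) g) \<ge> e}" by (rule finite_subset)
  qed (use f h in \<open>auto simp: c0_mult_in_K c0_mult_outside\<close>)
  show "\<forall>g\<in>carrier G. nrm ((f \<otimes>\<^bsub>CG\<^esub> h) g) \<le> 1"
    using c0_mult_close[OF f h, THEN close_nrm_le_1] by blast
qed

text \<open>The product of \<open>c0Z\<close> is associative because \<open>c0Z\<close> embeds into the product of the group
  rings modulo \<open>p\<^sup>M\<close>.\<close>
lemma ring_c0Z: "ring ZG"
proof (rule ringI)
  have assoc: "f \<otimes>\<^bsub>CG\<^esub> h \<otimes>\<^bsub>CG\<^esub> k = f \<otimes>\<^bsub>CG\<^esub> (h \<otimes>\<^bsub>CG\<^esub> k)"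
    if f: "f \<in> carrier ZG" and h: "h \<in> carrier ZG" and k: "k \<in> carrier ZG" for f h k
  proof (rule c0Z_ext)
    fix M :: nat assume M: "M \<ge> 1"
    interpret F: group_ring_mod G "p ^ M" by (rule group_ring_mod_p_pow[OF M])
    show "red M (f \<otimes>\<^bsub>CG\<^esub> h \<otimes>\<^bsub>CG\<^esub> k) = red M (f \<otimes>\<^bsub>CG\<^esub> (h \<otimes>\<^bsub>CG\<^esub> k))"
      using F.FpG_mult_assoc[OF red_closed[OF M f] red_closed[OF M h] red_closed[OF M k]]
        red_mult_eq[OF M f h] red_mult_eq[OF M h k] red_mult_eq[OF M f c0Z_mult_closed[OF h k]]
        red_mult_eq[OF M c0Z_mult_closed[OF f h] k] by simp
  qed (use f h k c0Z_mult_closed in auto)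
  have one: "delta K \<one> \<otimes>\<^bsub>CG\<^esub> f = f" "f \<otimes>\<^bsub>CG\<^esub> delta K \<one> = f" if f: "f \<in> carrier ZG" for f
  proof -
    have d: "delta K \<one> \<in> carrier ZG" by (rule delta_closed[OF one_closed])
    have "red M (delta K \<one> \<otimes>\<^bsub>CG\<^esub> f) = red M f \<and> red M (f \<otimes>\<^bsub>CG\<^esub> delta K \<one>) = red M f" if M: "M \<ge> 1" for M
    proof -
      interpret F: group_ring_mod G "p ^ M" by (rule group_ring_mod_p_pow[OF M])
      show ?thesis
        using red_mult_eq[OF M d f] red_mult_eq[OF M f d] red_delta[OF M one_closed] red_closed[OF M f]
          F.FpG_one_left[OF red_closed[OF M f]] F.FpG_one_right[OF red_closed[OF M f]] by simp
    qed
    thus "delta K \<one> \<otimes>\<^bsub>CG\<^esub> f = f" "f \<otimes>\<^bsub>CG\<^esub> delta K \<one> = f"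
      using c0Z_ext[OF c0Z_mult_closed[OF d f] f] c0Z_ext[OF c0Z_mult_closed[OF f d] f] by simp_all
  qed
  show "Group.monoid ZG"
    by (rule Group.monoidI; unfold c0Z_simps c0_simps(2))
      (blast intro: c0Z_mult_closed delta_closed one_closed assoc one)+
next
  fix f h k assume *: "f \<in> carrier ZG" "h \<in> carrier ZG" "k \<in> carrier ZG"
  have "red M ((f \<oplus>\<^bsub>CG\<^esub> h) \<otimes>\<^bsub>CG\<^esub> k) = red M (f \<otimes>\<^bsub>CG\<^esub> k \<oplus>\<^bsub>CG\<^esub> h \<otimes>\<^bsub>CG\<^esub> k) \<and>
    red M (k \<otimes>\<^bsub>CG\<^esub> (f \<oplus>\<^bsub>CG\<^esub> h)) = red M (k \<otimes>\<^bsub>CG\<^esub> f \<oplus>\<^bsub>CG\<^esub> k \<otimes>\<^bsub>CG\<^esub> h)" if M: "M \<ge> 1" for M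
  proof -
    interpret F: ring "FpG (p ^ M) G" by (rule group_ring_mod.ring_FpG[OF group_ring_mod_p_pow[OF M]])
    note [simp] = red_mult_eq[OF M] red_add[OF M] red_closed[OF M] c0Z_mult_closed c0Z_add_closed
    show ?thesis using * by (simp add: F.l_distr F.r_distr)
  qed
  thus "(f \<oplus>\<^bsub>ZG\<^esub> h) \<otimes>\<^bsub>ZG\<^esub> k = f \<otimes>\<^bsub>ZG\<^esub> k \<oplus>\<^bsub>ZG\<^esub> h \<otimes>\<^bsub>ZG\<^esub> k"
    "k \<otimes>\<^bsub>ZG\<^esub> (f \<oplus>\<^bsub>ZG\<^esub> h) = k \<otimes>\<^bsub>ZG\<^esub> f \<oplus>\<^bsub>ZG\<^esub> k \<otimes>\<^bsub>ZG\<^esub> h"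
    using * unfolding c0Z_simps by (auto intro!: c0Z_ext c0Z_mult_closed c0Z_add_closed)
qed (rule abelian_group_c0Z)

lemma red_ring_hom:
  assumes M: "M \<ge> 1" shows "ring_hom_ring ZG (FpG (p ^ M) G) (red M)"
proof (rule ring_hom_ringI)
  show "ring (FpG (p ^ M) G)" by (rule group_ring_mod.ring_FpG[OF group_ring_mod_p_pow[OF M]])
  show "red M \<one>\<^bsub>ZG\<^esub> = \<one>\<^bsub>FpG (p ^ M) G\<^esub>"
    unfolding c0Z_simps c0_simps(2) group_ring_mod.FpG_simps(2)[OF group_ring_mod_p_pow[OF M]]
    by (rule red_delta[OF M one_closed])
qed (unfold c0Z_simps, auto intro: ring_c0Z red_mult_eq[OF M] red_add[OF M] red_closed[OF M])

text \<open>An element of the group ring, its coefficients read as p-adic integers, is its own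
  lift.\<close>

lemma red_surj: assumes M: "M \<ge> 1" shows "red M ` carrier ZG = carrier (FpG (p ^ M) G)"
proof
  interpret F: group_ring_mod G "p ^ M" by (rule group_ring_mod_p_pow[OF M(1)])
  show "carrier (FpG (p ^ M) G) \<subseteq> red M ` carrier ZG"
  proof
    fix f assume f: "f \<in> carrier (FpG (p ^ M) G)"
    define h where "h g = emb (of_int (f g))" for g
    have "h \<in> carrier ZG" unfolding c0Z_iff
    proof
      show "h \<in> c0_set p G"
      proof (rule c0_setI)
        fix e :: real assume "e > 0"
        hence "{g \<in> carrier G. nrm (h g) \<ge> e} \<subseteq> {g \<in> carrier G. f g \<noteq> 0}" by (auto simp: h_def)
        thus "finite {g \<in> carrier G. nrm (h g) \<ge> e}" using F.FpG_finite[OF f] finite_subset by blast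
      qed (auto simp: h_def F.FpG_outside[OF f])
    qed (auto simp: h_def pabs_int_le_1)
    moreover have "red M h = f"
    proof
      fix g show "red M h g = f g"
      proof (cases "g \<in> carrier G")
        case True
        have "close M (h g) (f g)" by (simp add: h_def close_emb)
        from red_eq[of M h, OF this True] show ?thesis using F.FpG_mod[OF f] by simp
      qed (use F.FpG_outside[OF f] in \<open>simp add: red_def\<close>)
    qed
    ultimately show "f \<in> red M ` carrier ZG" by blast
  qed
qed (use M in \<open>auto simp: red_closed\<close>)

lemma delta_mult:
  assumes "g \<in> carrier G" "h \<in> carrier G" shows "delta K g \<otimes>\<^bsub>CG\<^esub> delta K h = delta K (g \<otimes> h)"
  by (rule c0Z_ext) (use assms in \<open>simp_all add: c0Z_mult_closed delta_closed red_mult_eq red_delta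
        group_ring_mod.Fp_elt_mult[OF group_ring_mod_p_pow]\<close>)

lemma c0_a_inv: "f \<in> c0_set p G \<Longrightarrow> \<ominus>\<^bsub>CG\<^esub> f = (\<lambda>g. \<ominus>\<^bsub>K\<^esub> f g)"
proof -
  interpret C: abelian_group CG by (rule abelian_group_c0)
  assume f: "f \<in> c0_set p G"
  show ?thesis
    by (rule C.minus_equality) (use f in \<open>auto simp: c0_carrier c0_uminus_closed c0_set_closed c0_simps K.l_neg fun_eq_iff\<close>)
qed

lemma c0Z_a_inv: "f \<in> carrier ZG \<Longrightarrow> \<ominus>\<^bsub>ZG\<^esub> f = (\<lambda>g. \<ominus>\<^bsub>K\<^esub> f g)"
proof -
  interpret Z: abelian_group ZG by (rule abelian_group_c0Z)
  assume f: "f \<in> carrier ZG"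
  show ?thesis
    by (rule Z.minus_equality) (use f in \<open>auto simp: c0Z_uminus_closed c0Z_closed c0Z_simps c0_simps K.l_neg fun_eq_iff\<close>)
qed

lemma c0_minus: "f \<in> c0_set p G \<Longrightarrow> h \<in> c0_set p G \<Longrightarrow> f \<ominus>\<^bsub>CG\<^esub> h = (\<lambda>g. f g \<ominus>\<^bsub>K\<^esub> h g)"
  by (auto simp: a_minus_def c0_a_inv c0_simps c0_set_outside fun_eq_iff)

lemma c0Z_minus: "f \<in> carrier ZG \<Longrightarrow> h \<in> carrier ZG \<Longrightarrow> f \<ominus>\<^bsub>ZG\<^esub> h = (\<lambda>g. f g \<ominus>\<^bsub>K\<^esub> h g)"
  by (auto simp: a_minus_def c0Z_a_inv c0Z_simps c0_simps c0_set_outside[OF c0Z_c0] fun_eq_iff)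

end

section \<open>Determinants of the regular representation\<close>

lemma det_cong:
  fixes A B :: "int mat"
  assumes "A \<in> carrier_mat m m" "B \<in> carrier_mat m m"
    "\<And>i j. i < m \<Longrightarrow> j < m \<Longrightarrow> [A $$ (i, j) = B $$ (i, j)] (mod n)"
  shows "[det A = det B] (mod n)"
  unfolding det_def'[OF assms(1)] det_def'[OF assms(2)]
proof (intro cong_sum cong_mult cong_refl cong_prod)
  fix \<sigma> i assume "\<sigma> \<in> {\<sigma>. \<sigma> permutes {0..<m}}" "i \<in> {0..<m}"
  thus "[A $$ (i, \<sigma> i) = B $$ (i, \<sigma> i)] (mod n)"
    by (intro assms(3)) (auto simp: permutes_in_image)
qed

lemma prod_one_plus_cong:
  fixes c :: int
  assumes "finite S"
  shows "[(\<Prod>i\<in>S. 1 + c * y i) = 1 + c * sum y S] (mod c * c)"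
  using assms
proof induction
  case (insert x F)
  have "[(1 + c * y x) * (\<Prod>i\<in>F. 1 + c * y i) = (1 + c * y x) * (1 + c * sum y F)] (mod c * c)"
    by (rule cong_mult[OF cong_refl insert.IH])
  also have "(1 + c * y x) * (1 + c * sum y F) = (1 + c * (y x + sum y F)) + c * c * (y x * sum y F)"
    by (simp add: algebra_simps)
  also have "[\<dots> = 1 + c * (y x + sum y F)] (mod c * c)" by (simp add: cong_iff_dvd_diff)
  finally show ?case using insert by simp
qed simp

text \<open>A permutation other than the identity moves two points, so its term is divisible by \<open>c\<^sup>2\<close>.\<close>
lemma det_one_plus_cong:
  fixes A :: "int mat"
  assumes A: "A \<in> carrier_mat m m"
    and e: "\<And>i j. i < m \<Longrightarrow> j < m \<Longrightarrow> A $$ (i, j) = (if i = j then 1 else 0) + c * y i j"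
  shows "[det A = 1 + c * (\<Sum>i<m. y i i)] (mod c * c)"
proof -
  let ?P = "{\<sigma>. \<sigma> permutes {0..<m}}"
  let ?t = "\<lambda>\<sigma>. signof \<sigma> * (\<Prod>i = 0..<m. A $$ (i, \<sigma> i))"
  have fin: "finite ?P" by (rule finite_permutations) simp
  have "[(\<Sum>\<sigma>\<in>?P - {id}. ?t \<sigma>) = (\<Sum>\<sigma>\<in>?P - {id}. 0)] (mod c * c)"
  proof (rule cong_sum)
    fix \<sigma> assume s: "\<sigma> \<in> ?P - {id}"
    then obtain i where i: "\<sigma> i \<noteq> i" by (metis DiffE eq_id_iff insertI1)
    have perm: "\<sigma> permutes {0..<m}" using s by simp
    have im: "i < m" using i perm permutes_not_in by fastforce
    define j where "j = \<sigma> i"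
    have j: "j \<noteq> i" "j < m" "\<sigma> j \<noteq> j"
      using i im perm permutes_in_image[OF perm, of i] permutes_inj[OF perm] by (auto simp: j_def inj_eq)
    have sj: "\<sigma> j < m" "\<sigma> i < m" using j im permutes_in_image[OF perm] by auto
    have "(\<Prod>i = 0..<m. A $$ (i, \<sigma> i)) = A $$ (i, \<sigma> i) * (A $$ (j, \<sigma> j) * (\<Prod>i\<in>{0..<m} - {i} - {j}. A $$ (i, \<sigma> i)))"
      using im j by (subst prod.remove[of _ i], simp, simp, subst prod.remove[of _ j]) auto
    moreover have "c dvd A $$ (i, \<sigma> i)" "c dvd A $$ (j, \<sigma> j)" using e[OF im sj(2)] e[OF j(2) sj(1)] i j by auto
    ultimately have "c * c dvd (\<Prod>i = 0..<m. A $$ (i, \<sigma> i))"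
      by (simp only: mult_dvd_mono dvd_mult2)
    thus "[?t \<sigma> = 0] (mod c * c)" by (simp add: cong_0_iff)
  qed
  hence 1: "[(\<Sum>\<sigma>\<in>?P - {id}. ?t \<sigma>) = 0] (mod c * c)" by simp
  have "?t id = (\<Prod>i = 0..<m. 1 + c * y i i)" by (simp add: e)
  hence 2: "[?t id = 1 + c * (\<Sum>i = 0..<m. y i i)] (mod c * c)" using prod_one_plus_cong[of "{0..<m}" c] by simp
  have "det A = ?t id + (\<Sum>\<sigma>\<in>?P - {id}. ?t \<sigma>)"
    unfolding det_def'[OF A] by (rule sum.remove[OF fin]) (simp add: permutes_id)
  thus ?thesis using cong_add[OF 2 1] by (simp add: lessThan_atLeast0)
qed

text \<open>Flattens a pair (block, position in the block) into one index, matching the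
  \<open>div\<close> and \<open>mod\<close> layout of \<open>reg_mat\<close>.\<close>

lemma sum_div_mod:
  fixes f :: "nat \<Rightarrow> nat \<Rightarrow> 'a::comm_monoid_add"
  assumes "d > 0"
  shows "(\<Sum>u<r * d. f (u div d) (u mod d)) = (\<Sum>k<r. \<Sum>c<d. f k c)"
proof -
  have lt: "k * d + c < r * d" if "k < r" "c < d" for k c
  proof -
    have "k * d + c < Suc k * d" using that by simp
    also have "\<dots> \<le> r * d" using that by (intro mult_right_mono) auto
    finally show ?thesis .
  qed
  show ?thesis unfolding sum.cartesian_product
    by (rule sum.reindex_bij_witness[of _ "\<lambda>(k, c). k * d + c" "\<lambda>u. (u div d, u mod d)"])
      (use assms in \<open>auto simp: less_mult_imp_div_less lt\<close>)
qed

context finite_quotient begin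

definition qcard :: nat where "qcard = card (carrier H)"

definition qenum :: "nat \<Rightarrow> 'h" where
  "qenum = (SOME q. bij_betw q {..<qcard} (carrier H))"

lemma qenum_bij: "bij_betw qenum {..<qcard} (carrier H)"
proof -
  have "\<exists>q. bij_betw q {..<qcard} (carrier H)"
    using ex_bij_betw_nat_finite[OF finite_H] by (simp add: qcard_def lessThan_atLeast0)
  thus ?thesis unfolding qenum_def by (rule someI_ex)
qed

lemma qenum_closed [simp]: "a < qcard \<Longrightarrow> qenum a \<in> carrier H"
  using bij_betwE[OF qenum_bij] by auto

lemma qenum_eq_iff: "a < qcard \<Longrightarrow> b < qcard \<Longrightarrow> qenum a = qenum b \<longleftrightarrow> a = b"
  using qenum_bij by (auto simp: bij_betw_def inj_on_def)

lemma qcard_pos [simp]: "qcard > 0"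
  using finite_H H.one_closed by (auto simp: qcard_def card_gt_0_iff)

text \<open>\<open>f (qdiff a b)\<close> is the matrix entry of right convolution by
  \<open>f\<close> on row vectors. Since \<open>qdiff a c\<close> times \<open>qdiff c b\<close>
  telescopes to \<open>qdiff a b\<close>, matrix products come in the same order as ring
  products.\<close>

definition qdiff :: "nat \<Rightarrow> nat \<Rightarrow> 'h" where
  "qdiff a b = inv\<^bsub>H\<^esub> qenum a \<otimes>\<^bsub>H\<^esub> qenum b"

lemma qdiff_closed [simp]: "a < qcard \<Longrightarrow> b < qcard \<Longrightarrow> qdiff a b \<in> carrier H"
  by (simp add: qdiff_def)

lemma qdiff_eq_one: "a < qcard \<Longrightarrow> b < qcard \<Longrightarrow> qdiff a b = \<one>\<^bsub>H\<^esub> \<longleftrightarrow> a = b"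
  unfolding qdiff_def using H.inv_solve_left'[of "\<one>\<^bsub>H\<^esub>" "qenum a" "qenum b"] qenum_eq_iff by auto

lemma qdiff_inv: "a < qcard \<Longrightarrow> b < qcard \<Longrightarrow> inv\<^bsub>H\<^esub> qdiff a b = qdiff b a"
  by (simp add: qdiff_def H.inv_mult_group)

lemma qdiff_mult:
  assumes "a < qcard" "b < qcard" "c < qcard" shows "qdiff a b \<otimes>\<^bsub>H\<^esub> qdiff b c = qdiff a c"
proof -
  have "qenum b \<otimes>\<^bsub>H\<^esub> (inv\<^bsub>H\<^esub> qenum b \<otimes>\<^bsub>H\<^esub> qenum c) = qenum c"
    using assms H.m_assoc[of "qenum b" "inv\<^bsub>H\<^esub> qenum b" "qenum c"] by simp
  thus ?thesis using assms by (simp add: qdiff_def H.m_assoc)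
qed

lemma sum_qdiff:
  assumes a: "a < qcard" shows "(\<Sum>z\<in>carrier H. \<phi> z) = (\<Sum>c<qcard. \<phi> (qdiff a c))"
proof -
  have "bij_betw (\<lambda>z. inv\<^bsub>H\<^esub> qenum a \<otimes>\<^bsub>H\<^esub> z) (carrier H) (carrier H)"
    by (rule bij_betw_byWitness[where f' = "\<lambda>z. qenum a \<otimes>\<^bsub>H\<^esub> z"])
      (use a in \<open>auto simp: H.m_assoc[symmetric]\<close>)
  from bij_betw_trans[OF qenum_bij this] have "bij_betw (qdiff a) {..<qcard} (carrier H)"
    by (simp add: comp_def qdiff_def[abs_def])
  from sum.reindex_bij_betw[OF this] show ?thesis by metis
qed

text \<open>Each entry of \<open>A\<close> becomes the square block of size \<open>qcard\<close> by
  which it acts on the group ring of \<open>H\<close>; \<open>div\<close> selects the block,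
  \<open>mod\<close> the place in it.\<close>

definition reg_mat :: "nat \<Rightarrow> (nat \<Rightarrow> nat \<Rightarrow> 'g \<Rightarrow> int) \<Rightarrow> int mat" where
  "reg_mat r A = mat (r * qcard) (r * qcard)
     (\<lambda>(s, t). push (A (s div qcard) (t div qcard)) (qdiff (s mod qcard) (t mod qcard)))"

definition reg_det :: "nat \<Rightarrow> (nat \<Rightarrow> nat \<Rightarrow> 'g \<Rightarrow> int) \<Rightarrow> int" where
  "reg_det r A = det (reg_mat r A)"

lemma reg_mat_carrier [simp]: "reg_mat r A \<in> carrier_mat (r * qcard) (r * qcard)"
  by (simp add: reg_mat_def)

lemma reg_mat_index: "s < r * qcard \<Longrightarrow> t < r * qcard \<Longrightarrow>
   reg_mat r A $$ (s, t) = push (A (s div qcard) (t div qcard)) (qdiff (s mod qcard) (t mod qcard))"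
  by (simp add: reg_mat_def)

lemma div_mod_eq_iff: "(s::nat) = t \<longleftrightarrow> s div d = t div d \<and> s mod d = t mod d"
  by (metis div_mult_mod_eq)

lemma push_one: "a < qcard \<Longrightarrow> b < qcard \<Longrightarrow> push (mat_one \<F> i j) (qdiff a b) = (if i = j \<and> a = b then 1 else 0)"
  using qdiff_eq_one by (auto simp: mat_one_def FpG_simps(2) push_elt push_zero)

lemma reg_mat_one: "reg_mat r (mat_one \<F>) = 1\<^sub>m (r * qcard)"
proof (rule eq_matI)
  fix s t assume "s < dim_row (1\<^sub>m (r * qcard) :: int mat)" "t < dim_col (1\<^sub>m (r * qcard) :: int mat)"
  thus "reg_mat r (mat_one \<F>) $$ (s, t) = 1\<^sub>m (r * qcard) $$ (s, t)"
    using div_mod_eq_iff[of s t qcard] by (simp add: reg_mat_index push_one)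
qed (simp_all add: reg_mat_def)

lemma reg_det_one: "reg_det r (mat_one \<F>) = 1"
  by (simp add: reg_det_def reg_mat_one)

lemma push_finsum:
  assumes "\<And>i. i \<in> I \<Longrightarrow> f i \<in> carrier \<F>"
  shows "[push (finsum \<F> f I) y = (\<Sum>i\<in>I. push (f i) y)] (mod int n)"
proof -
  interpret F: ring \<F> by (rule ring_FpG)
  show ?thesis using assms
  proof (induction I rule: infinite_finite_induct)
    case (insert x I)
    have cl: "f x \<in> carrier \<F>" "finsum \<F> f I \<in> carrier \<F>" using insert by (auto intro!: F.finsum_closed)
    have "[push (f x \<oplus>\<^bsub>\<F>\<^esub> finsum \<F> f I) y = push (f x) y + push (finsum \<F> f I) y] (mod int n)"
      by (rule push_add[OF cl])
    also have "[push (f x) y + push (finsum \<F> f I) y = push (f x) y + (\<Sum>i\<in>I. push (f i) y)] (mod int n)"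
      using insert by (intro cong_add) auto
    finally show ?case using insert by (simp add: Pi_def)
  qed (simp_all add: push_zero)
qed

text \<open>The convolution sum over \<open>H\<close> is reindexed by \<open>z = qdiff a c\<close>;
  together with the sum over blocks it becomes the single summation index of a matrix
  product.\<close>

lemma reg_mat_mult:
  assumes A: "supported_below \<F> r A" and B: "supported_below \<F> r B" and st: "s < r * qcard" "t < r * qcard"
  shows "[reg_mat r (inf_mult \<F> A B) $$ (s, t) = (reg_mat r A * reg_mat r B) $$ (s, t)] (mod int n)"
proof -
  interpret F: ring \<F> by (rule ring_FpG)
  define i a j b where "i = s div qcard" "a = s mod qcard" "j = t div qcard" "b = t mod qcard"
  note defs = this
  have lt: "i < r" "j < r" "a < qcard" "b < qcard"
    using st by (auto simp: defs less_mult_imp_div_less)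
  have cl: "A i k \<in> carrier \<F>" "B k j \<in> carrier \<F>" for k using A B by (auto simp: supported_below_def)
  have "reg_mat r (inf_mult \<F> A B) $$ (s, t) = push (\<Oplus>\<^bsub>\<F>\<^esub>k\<in>{..<r}. A i k \<otimes>\<^bsub>\<F>\<^esub> B k j) (qdiff a b)"
    using st lt by (simp add: reg_mat_index F.inf_mult_supported[OF A B] defs)
  also have "[\<dots> = (\<Sum>k<r. push (A i k \<otimes>\<^bsub>\<F>\<^esub> B k j) (qdiff a b))] (mod int n)"
    by (rule push_finsum) (use cl in auto)
  also have "[(\<Sum>k<r. push (A i k \<otimes>\<^bsub>\<F>\<^esub> B k j) (qdiff a b)) =
      (\<Sum>k<r. \<Sum>c<qcard. push (A i k) (qdiff a c) * push (B k j) (qdiff c b))] (mod int n)"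
  proof (rule cong_sum)
    fix k
    have "[push (A i k \<otimes>\<^bsub>\<F>\<^esub> B k j) (qdiff a b) =
       (\<Sum>z\<in>carrier H. push (A i k) z * push (B k j) (inv\<^bsub>H\<^esub> z \<otimes>\<^bsub>H\<^esub> qdiff a b))] (mod int n)"
      by (rule push_mult) (use cl lt in auto)
    also have "(\<Sum>z\<in>carrier H. push (A i k) z * push (B k j) (inv\<^bsub>H\<^esub> z \<otimes>\<^bsub>H\<^esub> qdiff a b)) =
      (\<Sum>c<qcard. push (A i k) (qdiff a c) * push (B k j) (qdiff c b))"
      unfolding sum_qdiff[OF lt(3)] using lt by (intro sum.cong) (auto simp: qdiff_inv qdiff_mult)
    finally show "[push (A i k \<otimes>\<^bsub>\<F>\<^esub> B k j) (qdiff a b) =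
      (\<Sum>c<qcard. push (A i k) (qdiff a c) * push (B k j) (qdiff c b))] (mod int n)" .
  qed
  also have "(\<Sum>k<r. \<Sum>c<qcard. push (A i k) (qdiff a c) * push (B k j) (qdiff c b)) =
    (\<Sum>u<r * qcard. push (A i (u div qcard)) (qdiff a (u mod qcard)) * push (B (u div qcard) j) (qdiff (u mod qcard) b))"
    by (rule sum_div_mod[symmetric]) simp
  also have "\<dots> = (reg_mat r A * reg_mat r B) $$ (s, t)"
    using st by (simp add: times_mat_def scalar_prod_def reg_mat_def lessThan_atLeast0 defs)
  finally show ?thesis .
qed

lemma reg_det_mult:
  assumes "supported_below \<F> r A" "supported_below \<F> r B"
  shows "[reg_det r (inf_mult \<F> A B) = reg_det r A * reg_det r B] (mod int n)"
proof -
  have "[reg_det r (inf_mult \<F> A B) = det (reg_mat r A * reg_mat r B)] (mod int n)"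
    unfolding reg_det_def
    by (rule det_cong[OF reg_mat_carrier mult_carrier_mat[OF reg_mat_carrier reg_mat_carrier]])
      (rule reg_mat_mult[OF assms])
  thus ?thesis by (simp add: reg_det_def det_mult[OF reg_mat_carrier reg_mat_carrier])
qed

text \<open>Ordering the index by blocks makes the matrix triangular with ones on the diagonal,
  upper or lower according to whether \<open>i < j\<close>. If the place \<open>(i, j)\<close> lies
  outside the first \<open>r\<close> blocks, the matrix is the identity.\<close>

lemma reg_det_elem:
  assumes "i \<noteq> j"
  shows "reg_det r (elem_mat \<F> i j a) = 1"
proof -
  let ?A = "reg_mat r (elem_mat \<F> i j a)"
  have idx: "?A $$ (s, t) = (if s = t then 1 else 0)"
    if "s < r * qcard" "t < r * qcard" "\<not> (s div qcard = i \<and> t div qcard = j)" for s t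
    using that push_one[of "s mod qcard" "t mod qcard" "s div qcard" "t div qcard"]
    by (auto simp: reg_mat_index elem_mat_def div_mod_eq_iff[of s t qcard])
  have diag: "?A $$ (s, s) = 1" if "s < r * qcard" for s using that assms by (subst idx) auto
  hence dm: "prod_list (diag_mat ?A) = 1"
    by (simp add: prod_list_diag_prod reg_mat_def)
  consider "i < j" | "j < i" using assms by linarith
  thus ?thesis
  proof cases
    case 1
    have "upper_triangular ?A"
    proof (rule upper_triangularI)
      fix s t assume "t < s" "s < dim_row ?A"
      thus "?A $$ (s, t) = 0" using 1 div_le_mono[of t s qcard]
        by (subst idx) (auto simp: reg_mat_def)
    qed
    thus ?thesis using det_upper_triangular[OF _ reg_mat_carrier] dm by (simp add: reg_det_def)
  next
    case 2
    have "?A $$ (s, t) = 0" if "s < t" "t < r * qcard" for s t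
      using 2 that div_le_mono[of s t qcard] by (subst idx) auto
    thus ?thesis using det_lower_triangular[OF _ reg_mat_carrier] dm by (simp add: reg_det_def)
  qed
qed

lemma reg_mat_transpose:
  assumes g: "g \<in> carrier G"
  shows "reg_mat r (one_by_one \<F> (Fp_elt (inv g))) = transpose_mat (reg_mat r (one_by_one \<F> (Fp_elt g)))"
proof (rule eq_matI)
  fix s t assume "s < dim_row (transpose_mat (reg_mat r (one_by_one \<F> (Fp_elt g))))"
    "t < dim_col (transpose_mat (reg_mat r (one_by_one \<F> (Fp_elt g))))"
  hence st: "s < r * qcard" "t < r * qcard" by (auto simp: reg_mat_def)
  define a b where "a = s mod qcard" "b = t mod qcard"
  have ab: "a < qcard" "b < qcard" by (auto simp: a_b_def)
  have "qdiff a b = inv\<^bsub>H\<^esub> \<pi> g \<longleftrightarrow> qdiff b a = \<pi> g"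
    using ab g qdiff_inv[OF ab] H.inv_inv[of "\<pi> g"] H.inv_inv[of "qdiff a b"] by auto
  hence "push (Fp_elt (inv g)) (qdiff a b) = push (Fp_elt g) (qdiff b a)"
    using g by (simp add: push_elt)
  moreover have "push (mat_one \<F> i j) (qdiff a b) = push (mat_one \<F> j i) (qdiff b a)" for i j
    using ab by (simp add: push_one conj_commute eq_commute)
  ultimately show "reg_mat r (one_by_one \<F> (Fp_elt (inv g))) $$ (s, t)
      = transpose_mat (reg_mat r (one_by_one \<F> (Fp_elt g))) $$ (s, t)"
    using st by (auto simp: transpose_mat_def reg_mat_index reg_mat_def one_by_one_def a_b_def)
qed (auto simp: reg_mat_def)

text \<open>The matrix of \<open>g\<close> is a permutation matrix, so that of \<open>inv g\<close>
  is its transpose and has the same determinant, while the two multiply to 1. Asserting only the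
  square spares the sign of the permutation.\<close>

lemma reg_det_group_elt:
  assumes g: "g \<in> carrier G" and r: "r > 0"
  shows "[reg_det r (one_by_one \<F> (Fp_elt g)) ^ 2 = 1] (mod int n)"
proof -
  interpret F: ring \<F> by (rule ring_FpG)
  have "reg_det r (one_by_one \<F> (Fp_elt (inv g))) = reg_det r (one_by_one \<F> (Fp_elt g))"
    unfolding reg_det_def reg_mat_transpose[OF g] by (rule det_transpose[OF reg_mat_carrier])
  moreover have "inf_mult \<F> (one_by_one \<F> (Fp_elt g)) (one_by_one \<F> (Fp_elt (inv g))) = mat_one \<F>"
    using g by (simp add: F.one_by_one_mult Fp_elt_closed Fp_elt_mult)
      (auto simp: one_by_one_def mat_one_def FpG_simps fun_eq_iff)
  ultimately show ?thesis
    using reg_det_mult[of r "one_by_one \<F> (Fp_elt g)" "one_by_one \<F> (Fp_elt (inv g))"] g r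
    by (simp add: F.one_by_one_supported Fp_elt_closed reg_det_one power2_eq_square cong_sym)
qed

lemma push_dvd: "(\<And>g. c dvd f g) \<Longrightarrow> c dvd push f y"
  unfolding push_def by (intro dvd_sum) auto

text \<open>All \<open>qcard\<close> diagonal places of a diagonal block carry the same deviation
  from 1, the value at the identity of \<open>H\<close>. The resulting factor \<open>qcard\<close>
  is what the normalisation by the index later removes.\<close>

lemma reg_det_one_plus:
  assumes Z: "\<And>i j. i < r \<Longrightarrow> j < r \<Longrightarrow> Z i j \<in> carrier \<F>" "\<And>i j g. i < r \<Longrightarrow> j < r \<Longrightarrow> c dvd Z i j g"
    and U: "\<And>i j. i < r \<Longrightarrow> j < r \<Longrightarrow> U i j = mat_one \<F> i j \<oplus>\<^bsub>\<F>\<^esub> Z i j" and c: "c * c dvd int n"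
  shows "[reg_det r U = 1 + int qcard * (\<Sum>i<r. push (Z i i) \<one>\<^bsub>H\<^esub>)] (mod c * c)"
proof -
  \<comment> \<open>The factor \<open>c\<close> is divided out so that
    \<open>det_one_plus_cong\<close> applies; within the matrix the division is exact by
    \<open>push_dvd\<close>.\<close>
  define y where "y s t = push (Z (s div qcard) (t div qcard)) (qdiff (s mod qcard) (t mod qcard)) div c" for s t
  define B where "B = mat (r * qcard) (r * qcard) (\<lambda>(s, t). (if s = t then 1 else 0) + c * y s t)"
  have lt: "s div qcard < r" if "s < r * qcard" for s using that by (simp add: less_mult_imp_div_less)
  have cy: "c * y s t = push (Z (s div qcard) (t div qcard)) (qdiff (s mod qcard) (t mod qcard))"
    if "s < r * qcard" "t < r * qcard" for s t
    unfolding y_def using lt that by (intro dvd_mult_div_cancel push_dvd Z) auto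
  have "[reg_det r U = det B] (mod int n)" unfolding reg_det_def
  proof (rule det_cong)
    fix s t assume st: "s < r * qcard" "t < r * qcard"
    have "[push (U (s div qcard) (t div qcard)) (qdiff (s mod qcard) (t mod qcard)) =
      push (mat_one \<F> (s div qcard) (t div qcard)) (qdiff (s mod qcard) (t mod qcard)) + c * y s t] (mod int n)"
      unfolding cy[OF st] U[OF lt lt, OF st]
      by (rule push_add) (use lt st Z ring.mat_one_closed[OF ring_FpG] in auto)
    thus "[reg_mat r U $$ (s, t) = B $$ (s, t)] (mod int n)"
      using st by (simp add: reg_mat_index B_def push_one div_mod_eq_iff[of s t qcard])
  qed (auto simp: B_def)
  hence "[reg_det r U = det B] (mod c * c)" using c by (rule cong_dvd_modulus)
  also have "[det B = 1 + c * (\<Sum>s<r * qcard. y s s)] (mod c * c)"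
    by (rule det_one_plus_cong) (auto simp: B_def)
  also have "c * (\<Sum>s<r * qcard. y s s) = (\<Sum>s<r * qcard. push (Z (s div qcard) (s div qcard)) \<one>\<^bsub>H\<^esub>)"
    unfolding sum_distrib_left by (intro sum.cong) (auto simp: cy qdiff_eq_one[THEN iffD2])
  also have "\<dots> = int qcard * (\<Sum>i<r. push (Z i i) \<one>\<^bsub>H\<^esub>)"
    using sum_div_mod[of qcard "\<lambda>k c. push (Z k k) \<one>\<^bsub>H\<^esub>" r] by (simp add: sum_distrib_left)
  finally show ?thesis .
qed

end

section \<open>The limit of the determinants\<close>

context padic begin

text \<open>\<open>(p - 1) * p ^ k\<close> is the order of the unit group modulo
  \<open>p ^ Suc k\<close>, so for a unit the power is close to 1 and its deviation from 1 is a
  first-order logarithm; dividing by the exponent restores the scale. \<open>d\<close> is the index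
  by which the logarithm is normalised.\<close>

definition alog :: "nat \<Rightarrow> nat \<Rightarrow> int \<Rightarrow> rat" where
  "alog k d D = of_int (D ^ ((p - 1) * p ^ k) - 1) / of_nat (d * (p - 1) * p ^ k)"

lemma alog_one [simp]: "alog k d 1 = 0"
  by (simp add: alog_def)

text \<open>Error budget: of the \<open>2 * k + 2\<close> powers of \<open>p\<close> in the
  numerator, \<open>k\<close> are spent on the denominator; \<open>p - 1\<close> is a unit, and
  \<open>d\<close> costs at most the real factor \<open>d\<close>.\<close>

lemma pabs_alog_div:
  assumes "d > 0" "int p ^ (2 * k + 2) dvd z"
  shows "pabs (of_int z / of_nat (d * (p - 1) * p ^ k)) \<le> real d / real p ^ k"
proof -
  have "\<not> int p dvd int (p - 1)" using p_gt_1 by (auto dest: zdvd_imp_le)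
  hence "pabs (of_int (int (p - 1))) = 1"
    using p_gt_1 by (subst pabs_int) (auto simp: not_dvd_imp_multiplicity_0)
  hence p1: "pabs (of_nat (p - 1)) = 1" by simp
  have pk: "pabs (of_nat (p ^ k)) = 1 / real p ^ k" by (simp add: pabs_power pabs_p power_one_over)
  have z: "pabs (of_int z) \<le> 1 / real p ^ (2 * k + 2)" using assms(2) pabs_int_le_iff by blast
  have d0: "pabs (of_nat d) > 0" using assms(1) by (intro pabs_pos) auto
  have d: "1 / pabs (of_nat d) \<le> real d" using pabs_nat_ge[OF assms(1)] assms(1) d0 by (simp add: field_simps)
  have "pabs (of_int z / of_nat (d * (p - 1) * p ^ k)) = pabs (of_int z) * real p ^ k * (1 / pabs (of_nat d))"
    using p1 pk by (simp only: pabs_divide of_nat_mult pabs_mult) simp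
  also have "\<dots> \<le> 1 / real p ^ (2 * k + 2) * real p ^ k * real d"
    by (intro mult_mono z d) (auto intro: less_imp_le[OF d0])
  also have "\<dots> = real d / real p ^ (k + 2)"
  proof -
    have "real p ^ (2 * k + 2) = real p ^ k * real p ^ (k + 2)" by (simp only: power_add[symmetric]) (simp add: mult_2)
    thus ?thesis using p_gt_1 by simp
  qed
  also have "\<dots> \<le> real d / real p ^ k"
    using p_gt_1 by (intro divide_left_mono power_increasing) auto
  finally show ?thesis .
qed

text \<open>\<open>D\<close> may be negative, so it passes through its nonnegative residue before
  Euler's theorem for natural numbers applies.\<close>

lemma euler_p:
  assumes "coprime D (int p)" shows "[D ^ ((p - 1) * p ^ k) = 1] (mod int p ^ Suc k)"
proof -
  define a where "a = nat (D mod int p ^ Suc k)"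
  have a: "[int a = D] (mod int p ^ Suc k)" using p_gt_0 by (simp add: a_def)
  have "coprime (int a) (int p ^ Suc k)" using cong_imp_coprime[OF cong_sym[OF a]] assms by simp
  hence "coprime a (p ^ Suc k)" by (metis coprime_int_iff of_nat_power)
  hence "[a ^ totient (p ^ Suc k) = 1] (mod p ^ Suc k)" by (rule euler_theorem)
  moreover have "totient (p ^ Suc k) = (p - 1) * p ^ k"
    using totient_prime_power_Suc[OF prime_p, of k] by (simp add: mult.commute)
  ultimately have "[int a ^ ((p - 1) * p ^ k) = 1] (mod int p ^ Suc k)"
    by (metis cong_int_iff of_nat_1 of_nat_power)
  thus ?thesis using cong_pow[OF a] cong_trans cong_sym by blast
qed

text \<open>With \<open>x = D1 ^ E\<close> and \<open>y = D2 ^ E\<close>, the defect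
  \<open>(x y - 1) - (x - 1) - (y - 1)\<close> equals \<open>(x - 1) (y - 1)\<close>. Each factor is
  divisible by \<open>p ^ Suc k\<close>, which is the origin of the modulus
  \<open>p ^ (2 * k + 2)\<close>.\<close>

lemma alog_mult:
  assumes "d > 0" and D: "coprime D1 (int p)" "coprime D2 (int p)" "[D = D1 * D2] (mod int p ^ (2 * k + 2))"
  shows "pabs (alog k d D - alog k d D1 - alog k d D2) \<le> real d / real p ^ k"
proof -
  define E where "E = (p - 1) * p ^ k"
  have "int p ^ Suc k dvd D1 ^ E - 1" "int p ^ Suc k dvd D2 ^ E - 1"
    using euler_p[OF D(1)] euler_p[OF D(2)] unfolding E_def cong_iff_dvd_diff by auto
  hence "int p ^ Suc k * int p ^ Suc k dvd (D1 ^ E - 1) * (D2 ^ E - 1)" by (rule mult_dvd_mono)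
  moreover have "int p ^ Suc k * int p ^ Suc k = int p ^ (2 * k + 2)" by (simp only: power_add[symmetric]) (simp add: mult_2)
  ultimately have 1: "int p ^ (2 * k + 2) dvd (D1 ^ E - 1) * (D2 ^ E - 1)" by (simp only:)
  have 2: "int p ^ (2 * k + 2) dvd D ^ E - (D1 * D2) ^ E" using cong_pow[OF D(3)] by (simp add: cong_iff_dvd_diff)
  have eq: "(D ^ E - (D1 * D2) ^ E) + (D1 ^ E - 1) * (D2 ^ E - 1) = (D ^ E - 1) - (D1 ^ E - 1) - (D2 ^ E - 1)"
    by (simp add: algebra_simps)
  have "alog k d D - alog k d D1 - alog k d D2 =
     of_int ((D ^ E - 1) - (D1 ^ E - 1) - (D2 ^ E - 1)) / of_nat (d * (p - 1) * p ^ k)"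
    by (simp add: alog_def E_def diff_divide_distrib)
  also have "pabs \<dots> \<le> real d / real p ^ k"
    by (rule pabs_alog_div[OF assms(1)]) (use dvd_add[OF 2 1] eq in simp)
  finally show ?thesis .
qed

lemma alog_cong:
  assumes "d > 0" "coprime D' (int p)" "[D = D'] (mod int p ^ (2 * k + 2))"
  shows "pabs (alog k d D - alog k d D') \<le> real d / real p ^ k"
  using alog_mult[of d D' 1 D k] assms by simp

lemma pabs_add_bound: "pabs x \<le> B \<Longrightarrow> pabs y \<le> B \<Longrightarrow> pabs (x + y) \<le> B"
  using pabs_ultra[of x y] by linarith

lemma alog_power:
  assumes d: "d > 0" and D1: "coprime D1 (int p)" and D: "[D = D1 ^ m] (mod int p ^ (2 * k + 2))"
  shows "pabs (alog k d D - of_nat m * alog k d D1) \<le> real d / real p ^ k"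
proof -
  have "pabs (alog k d (D1 ^ m) - of_nat m * alog k d D1) \<le> real d / real p ^ k"
  proof (induction m)
    case (Suc m)
    have "pabs (alog k d (D1 ^ Suc m) - alog k d D1 - alog k d (D1 ^ m)) \<le> real d / real p ^ k"
      by (rule alog_mult) (use d D1 in auto)
    from pabs_add_bound[OF this Suc.IH] show ?case by (simp add: algebra_simps)
  qed simp
  moreover have "pabs (alog k d D - alog k d (D1 ^ m)) \<le> real d / real p ^ k"
    by (rule alog_cong) (use assms in auto)
  ultimately show ?thesis
    using pabs_add_bound[of "alog k d D - alog k d (D1 ^ m)" _ "alog k d (D1 ^ m) - of_nat m * alog k d D1"] by simp
qed

lemma pabs_mult_nat_le: "m > 0 \<Longrightarrow> pabs (of_nat m * x) \<le> B \<Longrightarrow> pabs x \<le> real m * B"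
proof -
  assume m: "m > 0" and "pabs (of_nat m * x) \<le> B"
  hence "1 / real m * pabs x \<le> B"
    using mult_right_mono[OF pabs_nat_ge[OF m] pabs_nonneg[of x]] by (simp add: pabs_mult)
  thus ?thesis using m by (simp add: field_simps)
qed

lemma eventually_small: assumes "e > 0" shows "\<exists>k0. \<forall>k\<ge>k0. B / real p ^ k < e"
proof -
  have "(\<lambda>n. B * (1 / real p) ^ n) \<longlonglongrightarrow> B * 0" using p_gt_1
    by (intro tendsto_mult tendsto_const LIMSEQ_realpow_zero) auto
  hence "eventually (\<lambda>n. B * (1 / real p) ^ n < e) sequentially" using assms by (simp add: order_tendstoD)
  thus ?thesis by (simp add: eventually_sequentially power_one_over)
qed

end

text \<open>A coset of the intersection is the intersection of the two cosets of the same element,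
  so there are no more of them than pairs of cosets.\<close>

lemma (in group) finite_index_Int:
  assumes "M \<lhd> G" "N \<lhd> G" "finite (rcosets M)" "finite (rcosets N)"
  shows "finite (rcosets (M \<inter> N))"
proof -
  have sub: "subgroup M G" "subgroup N G" using assms by (auto intro: normal_imp_subgroup)
  have eq: "(M \<inter> N) #> x = (M #> x) \<inter> (N #> x)" if x: "x \<in> carrier G" for x
  proof
    show "(M #> x) \<inter> (N #> x) \<subseteq> (M \<inter> N) #> x"
    proof
      fix y assume "y \<in> (M #> x) \<inter> (N #> x)"
      then obtain m n where mn: "m \<in> M" "n \<in> N" "y = m \<otimes> x" "y = n \<otimes> x" by (auto simp: r_coset_def)
      moreover from this have "m = n" using x sub by (metis r_cancel subgroup.mem_carrier)
      ultimately show "y \<in> (M \<inter> N) #> x" by (auto simp: r_coset_def)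
    qed
  qed (auto simp: r_coset_def)
  have "rcosets (M \<inter> N) \<subseteq> (\<lambda>(a, b). a \<inter> b) ` ((rcosets M) \<times> (rcosets N))"
    using eq by (auto simp: RCOSETS_def image_iff)
  thus ?thesis using assms finite_subset by blast
qed

section \<open>Limits along normal subgroups of finite index\<close>

context padic_group begin

definition fin_index :: "'g set \<Rightarrow> bool" where
  "fin_index N \<longleftrightarrow> N \<lhd> G \<and> finite (rcosets N)"

text \<open>The bound on \<open>k\<close> may depend on \<open>N\<close>: the index of \<open>N\<close> can be divisible by high powers of \<open>p\<close>, and
  dividing by it must not destroy the precision gained from \<open>k\<close>.\<close>
definition ev_index :: "('g set \<Rightarrow> nat \<Rightarrow> bool) \<Rightarrow> bool" where
  "ev_index P \<longleftrightarrow> (\<exists>S. finite S \<and> S \<subseteq> carrier G - {\<one>} \<and>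
     (\<forall>N. fin_index N \<and> N \<inter> S = {} \<longrightarrow> (\<exists>k0. \<forall>k\<ge>k0. P N k)))"

lemma ev_index_conj: assumes "ev_index P" "ev_index Q" shows "ev_index (\<lambda>N k. P N k \<and> Q N k)"
proof -
  obtain S where S: "finite S" "S \<subseteq> carrier G - {\<one>}" "\<And>N. fin_index N \<Longrightarrow> N \<inter> S = {} \<Longrightarrow> \<exists>k0. \<forall>k\<ge>k0. P N k"
    using assms(1) unfolding ev_index_def by blast
  obtain T where T: "finite T" "T \<subseteq> carrier G - {\<one>}" "\<And>N. fin_index N \<Longrightarrow> N \<inter> T = {} \<Longrightarrow> \<exists>k0. \<forall>k\<ge>k0. Q N k"
    using assms(2) unfolding ev_index_def by blast
  have "\<exists>k0. \<forall>k\<ge>k0. P N k \<and> Q N k" if N: "fin_index N" "N \<inter> (S \<union> T) = {}" for N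
  proof -
    obtain k1 k2 where "\<forall>k\<ge>k1. P N k" "\<forall>k\<ge>k2. Q N k" using S(3)[OF N(1)] T(3)[OF N(1)] N(2) by blast
    thus ?thesis by (intro exI[of _ "max k1 k2"]) auto
  qed
  thus ?thesis unfolding ev_index_def using S(1,2) T(1,2) by (intro exI[of _ "S \<union> T"]) auto
qed

lemma ev_index_mono: assumes "ev_index P" "\<And>N k. fin_index N \<Longrightarrow> P N k \<Longrightarrow> Q N k" shows "ev_index Q"
proof -
  obtain S where S: "finite S" "S \<subseteq> carrier G - {\<one>}" "\<And>N. fin_index N \<Longrightarrow> N \<inter> S = {} \<Longrightarrow> \<exists>k0. \<forall>k\<ge>k0. P N k"
    using assms(1) unfolding ev_index_def by blast
  have "\<exists>k0. \<forall>k\<ge>k0. Q N k" if "fin_index N" "N \<inter> S = {}" for N using S(3)[OF that] assms(2)[OF that(1)] by blast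
  thus ?thesis unfolding ev_index_def using S by blast
qed

lemma ev_index_large: "(\<And>N. fin_index N \<Longrightarrow> \<exists>k0. \<forall>k\<ge>k0. P N k) \<Longrightarrow> ev_index P"
  unfolding ev_index_def by (rule exI[of _ "{}"]) auto

lemma ev_index_avoid: "finite S \<Longrightarrow> S \<subseteq> carrier G - {\<one>} \<Longrightarrow> ev_index (\<lambda>N k. N \<inter> S = {})"
  unfolding ev_index_def by (rule exI[of _ S]) auto

definition idx :: "'g set \<Rightarrow> nat" where "idx N = card (rcosets N)"

lemma idx_pos: "fin_index N \<Longrightarrow> idx N > 0"
  using rcosetsI[OF _ one_closed, of N] normal_imp_subgroup[of N G] subgroup.subset[of N G]
  by (auto simp: fin_index_def idx_def card_gt_0_iff)

lemma ev_index_small: "e > 0 \<Longrightarrow> ev_index (\<lambda>N k. real c * (real (idx N) / real p ^ k) < e)"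
proof (rule ev_index_large)
  fix N assume "e > 0"
  from eventually_small[OF this, of "real c * real (idx N)"]
  show "\<exists>k0. \<forall>k\<ge>k0. real c * (real (idx N) / real p ^ k) < e" by simp
qed

lemma ev_index_k_ge: "ev_index (\<lambda>N k. k \<ge> m)"
  by (rule ev_index_large) auto

lemma fin_index_finite_quotient:
  assumes "fin_index N" "M \<ge> 1" shows "finite_quotient G (p ^ M) (G Mod N) ((#>) N)"
proof -
  interpret N: normal N G using assms by (simp add: fin_index_def)
  interpret group_ring_mod G "p ^ M" by (rule group_ring_mod_p_pow[OF assms(2)])
  have "finite (carrier (G Mod N))" using assms by (simp add: fin_index_def FactGroup_def)
  thus ?thesis
    by (intro finite_quotient.intro finite_quotient_axioms.intro group_hom.intro group_hom_axioms.intro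
      group_ring_mod_axioms is_group N.factorgroup_is_group N.r_coset_hom_Mod)
qed

lemma red_matrix_hom: "M \<ge> 1 \<Longrightarrow> matrix_ring_hom ZG (FpG (p ^ M) G) (red M)"
  by (rule ring_hom_ring.matrix_ring_hom[OF red_ring_hom])

text \<open>The truncation size \<open>r\<close> stays a free parameter, and \<open>ldet_lim\<close>
  quantifies over all large \<open>r\<close>: the determinants of two truncations never have to be
  compared, and matrices of different sizes are handled by a maximum.\<close>

definition qdet :: "nat \<Rightarrow> 'g set \<Rightarrow> nat \<Rightarrow> (nat \<Rightarrow> nat \<Rightarrow> 'g \<Rightarrow> qp) \<Rightarrow> int" where
  "qdet r N k A = finite_quotient.reg_det G (G Mod N) ((#>) N) r (map_entries (red (2 * k + 2)) A)"

abbreviation "qlog r N k A \<equiv> alog k (idx N) (qdet r N k A)"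

lemma qdet_mult:
  assumes "fin_index N" "supported_below ZG r A" "supported_below ZG r B"
  shows "[qdet r N k (inf_mult ZG A B) = qdet r N k A * qdet r N k B] (mod int p ^ (2 * k + 2))"
proof -
  interpret Q: finite_quotient G "p ^ (2 * k + 2)" "G Mod N" "(#>) N"
    by (rule fin_index_finite_quotient[OF assms(1)]) simp
  interpret Z: ring ZG by (rule ring_c0Z)
  interpret h: matrix_ring_hom ZG "FpG (p ^ (2 * k + 2)) G" "red (2 * k + 2)" by (rule red_matrix_hom) simp
  note m = h.map_entries_mult[OF Z.supported_below_rfm[OF assms(2)] Z.supported_below_rfm[OF assms(3)]]
  show ?thesis unfolding qdet_def m
    using Q.reg_det_mult[OF h.map_entries_supported[OF assms(2)] h.map_entries_supported[OF assms(3)]]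
    by (simp only: of_nat_power)
qed

lemma qdet_one: assumes "fin_index N" shows "qdet r N k (mat_one ZG) = 1"
proof -
  interpret Q: finite_quotient G "p ^ (2 * k + 2)" "G Mod N" "(#>) N"
    by (rule fin_index_finite_quotient[OF assms(1)]) simp
  interpret h: matrix_ring_hom ZG "FpG (p ^ (2 * k + 2)) G" "red (2 * k + 2)" by (rule red_matrix_hom) simp
  show ?thesis unfolding qdet_def by (simp only: h.map_entries_one Q.reg_det_one)
qed

lemma qdet_elem: assumes "fin_index N" "i \<noteq> j" shows "qdet r N k (elem_mat ZG i j a) = 1"
proof -
  interpret Q: finite_quotient G "p ^ (2 * k + 2)" "G Mod N" "(#>) N"
    by (rule fin_index_finite_quotient[OF assms(1)]) simp
  interpret h: matrix_ring_hom ZG "FpG (p ^ (2 * k + 2)) G" "red (2 * k + 2)" by (rule red_matrix_hom) simp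
  show ?thesis unfolding qdet_def by (simp only: h.map_entries_elem Q.reg_det_elem[OF assms(2)])
qed

lemma map_one_by_one:
  assumes "M \<ge> 1" "g \<in> carrier G"
  shows "map_entries (red M) (one_by_one ZG (delta K g)) = one_by_one (FpG (p ^ M) G) (Fp_elt g)"
proof -
  interpret h: matrix_ring_hom ZG "FpG (p ^ M) G" "red M" by (rule red_matrix_hom[OF assms(1)])
  show ?thesis using h.map_entries_one assms
    by (auto simp: map_entries_def one_by_one_def fun_eq_iff red_delta)
qed

lemma qdet_group_elt:
  assumes "fin_index N" "g \<in> carrier G" "r > 0"
  shows "[qdet r N k (one_by_one ZG (delta K g)) ^ 2 = 1] (mod int p ^ (2 * k + 2))"
proof -
  interpret Q: finite_quotient G "p ^ (2 * k + 2)" "G Mod N" "(#>) N"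
    by (rule fin_index_finite_quotient[OF assms(1)]) simp
  have "map_entries (red (2 * k + 2)) (one_by_one ZG (delta K g)) = one_by_one (FpG (p ^ (2 * k + 2)) G) (Fp_elt g)"
    by (rule map_one_by_one[OF _ assms(2)]) simp
  thus ?thesis unfolding qdet_def using Q.reg_det_group_elt[OF assms(2,3)] by (simp only: of_nat_power)
qed

lemma cong_coprime_p: "[a = b] (mod int p ^ (2 * k + 2)) \<Longrightarrow> coprime b (int p) \<Longrightarrow> coprime a (int p)"
  using cong_imp_coprime[of b a "int p ^ (2 * k + 2)"] by (simp add: cong_sym coprime_commute)

text \<open>\<open>ldet_lim A l\<close>: the limit of \<open>[G : N]\<^sup>-\<^sup>1 log\<^sub>p det \<rho>\<^sub>N(A)\<close> along \<open>N\<close> is \<open>l\<close>, where \<open>\<rho>\<^sub>N\<close> is the regular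
  representation of \<open>G / N\<close>.  The logarithm of a unit \<open>D\<close> is approximated by
  \<open>(D\<^bsup>(p - 1) p\<^sup>k\<^esup> - 1) / ((p - 1) p\<^sup>k)\<close>, for which \<open>D\<close> is only needed modulo \<open>p\<^bsup>2k + 2\<^esup>\<close>.\<close>
definition ldet_lim :: "(nat \<Rightarrow> nat \<Rightarrow> 'g \<Rightarrow> qp) \<Rightarrow> qp \<Rightarrow> bool" where
  "ldet_lim A l \<longleftrightarrow> l \<in> carrier K \<and> (\<exists>r0. \<forall>r\<ge>r0. \<forall>e>0.
     ev_index (\<lambda>N k. coprime (qdet r N k A) (int p) \<and> nrm (emb (qlog r N k A) \<ominus>\<^bsub>K\<^esub> l) < e))"

lemma ldet_limI:
  assumes "l \<in> carrier K"
    "\<And>r e. r \<ge> r0 \<Longrightarrow> e > 0 \<Longrightarrow> ev_index (\<lambda>N k. coprime (qdet r N k A) (int p) \<and> nrm (emb (qlog r N k A) \<ominus>\<^bsub>K\<^esub> l) < e)"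
  shows "ldet_lim A l"
  using assms unfolding ldet_lim_def by blast

lemma ldet_limE:
  assumes "ldet_lim A l"
  obtains r0 where "l \<in> carrier K" "\<And>r e. r \<ge> r0 \<Longrightarrow> e > 0 \<Longrightarrow>
    ev_index (\<lambda>N k. coprime (qdet r N k A) (int p) \<and> nrm (emb (qlog r N k A) \<ominus>\<^bsub>K\<^esub> l) < e)"
  using assms unfolding ldet_lim_def by blast

text \<open>If the \<open>m\<close>-th power of the determinant is 1, then \<open>m\<close> times
  its approximate logarithm is a mere error term, and removing \<open>m\<close> costs at most a
  factor \<open>m\<close>. Used with \<open>m = 1\<close> for elementary matrices and
  \<open>m = 2\<close> for group elements.\<close>

lemma ldet_lim_zeroI:
  assumes "\<And>r N k. r \<ge> r0 \<Longrightarrow> fin_index N \<Longrightarrow> [qdet r N k A ^ m = 1] (mod int p ^ (2 * k + 2))" "m > 0"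
  shows "ldet_lim A \<zero>\<^bsub>K\<^esub>"
proof (rule ldet_limI[of _ r0])
  fix r :: nat and e :: real assume r: "r \<ge> r0" and e: "e > 0"
  show "ev_index (\<lambda>N k. coprime (qdet r N k A) (int p) \<and> nrm (emb (qlog r N k A) \<ominus>\<^bsub>K\<^esub> \<zero>\<^bsub>K\<^esub>) < e)"
  proof (rule ev_index_mono[OF ev_index_small[OF e, of m]], rule conjI)
    fix N k assume N: "fin_index N" and s: "real m * (real (idx N) / real p ^ k) < e"
    note 1 = assms(1)[OF r N, of k]
    have "coprime (qdet r N k A ^ m) (int p)" using cong_coprime_p[OF 1] by simp
    thus c: "coprime (qdet r N k A) (int p)" using assms(2) by simp
    have "pabs (alog k (idx N) 1 - of_nat m * qlog r N k A) \<le> real (idx N) / real p ^ k"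
      by (rule alog_power[OF idx_pos[OF N] c cong_sym[OF 1]])
    hence "pabs (of_nat m * qlog r N k A) \<le> real (idx N) / real p ^ k" by simp
    from pabs_mult_nat_le[OF assms(2) this] have "pabs (qlog r N k A) < e" using s by linarith
    thus "nrm (emb (qlog r N k A) \<ominus>\<^bsub>K\<^esub> \<zero>\<^bsub>K\<^esub>) < e" by (simp add: a_minus_def)
  qed
qed simp

text \<open>Three errors are combined: the two given ones and the defect of additivity of
  \<open>alog\<close>, which is at most \<open>idx N / p ^ k\<close> and so needs \<open>k\<close>
  large for the given \<open>N\<close>. The ultrametric inequality keeps the bound
  \<open>e\<close>.\<close>

lemma ldet_lim_mult:
  assumes A: "ldet_lim A a" "finitary ZG A" and B: "ldet_lim B b" "finitary ZG B"
  shows "ldet_lim (inf_mult ZG A B) (a \<oplus>\<^bsub>K\<^esub> b)"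
proof -
  obtain r1 where r1: "a \<in> carrier K" "\<And>r e. r \<ge> r1 \<Longrightarrow> e > 0 \<Longrightarrow>
    ev_index (\<lambda>N k. coprime (qdet r N k A) (int p) \<and> nrm (emb (qlog r N k A) \<ominus>\<^bsub>K\<^esub> a) < e)" by (rule ldet_limE[OF A(1)]) blast
  obtain r2 where r2: "b \<in> carrier K" "\<And>r e. r \<ge> r2 \<Longrightarrow> e > 0 \<Longrightarrow>
    ev_index (\<lambda>N k. coprime (qdet r N k B) (int p) \<and> nrm (emb (qlog r N k B) \<ominus>\<^bsub>K\<^esub> b) < e)" by (rule ldet_limE[OF B(1)]) blast
  obtain r3 r4 where r34: "supported_below ZG r3 A" "supported_below ZG r4 B" using A B unfolding finitary_iff by blast
  define r0 where "r0 = max (max r1 r2) (max r3 r4)"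
  show ?thesis
  proof (rule ldet_limI[of _ r0])
    fix r :: nat and e :: real assume r: "r \<ge> r0" and e: "e > 0"
    have s: "supported_below ZG r A" "supported_below ZG r B"
      using r34 r by (auto simp: r0_def intro: supported_below_mono)
    have "ev_index (\<lambda>N k. (coprime (qdet r N k A) (int p) \<and> nrm (emb (qlog r N k A) \<ominus>\<^bsub>K\<^esub> a) < e) \<and>
      (coprime (qdet r N k B) (int p) \<and> nrm (emb (qlog r N k B) \<ominus>\<^bsub>K\<^esub> b) < e) \<and>
      real 1 * (real (idx N) / real p ^ k) < e)"
      using r e by (intro ev_index_conj r1 r2 ev_index_small) (auto simp: r0_def)
    thus "ev_index (\<lambda>N k. coprime (qdet r N k (inf_mult ZG A B)) (int p) \<and>
       nrm (emb (qlog r N k (inf_mult ZG A B)) \<ominus>\<^bsub>K\<^esub> (a \<oplus>\<^bsub>K\<^esub> b)) < e)"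
    proof (rule ev_index_mono, elim conjE, intro conjI)
      fix N k assume N: "fin_index N" and cA: "coprime (qdet r N k A) (int p)" and cB: "coprime (qdet r N k B) (int p)"
        and nA: "nrm (emb (qlog r N k A) \<ominus>\<^bsub>K\<^esub> a) < e" and nB: "nrm (emb (qlog r N k B) \<ominus>\<^bsub>K\<^esub> b) < e"
        and small: "real 1 * (real (idx N) / real p ^ k) < e"
      note m = qdet_mult[OF N s, of k]
      show "coprime (qdet r N k (inf_mult ZG A B)) (int p)" using cong_coprime_p[OF m] cA cB by simp
      define x where "x = qlog r N k (inf_mult ZG A B)"
      define y where "y = qlog r N k A"
      define z where "z = qlog r N k B"
      have "pabs (x - y - z) \<le> real (idx N) / real p ^ k"
        unfolding x_def y_def z_def by (rule alog_mult[OF idx_pos[OF N] cA cB m])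
      hence 1: "nrm (emb (x - y - z)) < e" using small by simp
      have 2: "nrm ((emb y \<ominus>\<^bsub>K\<^esub> a) \<oplus>\<^bsub>K\<^esub> (emb z \<ominus>\<^bsub>K\<^esub> b)) < e"
        using nrm_add[of "emb y \<ominus>\<^bsub>K\<^esub> a" "emb z \<ominus>\<^bsub>K\<^esub> b"] nA nB r1(1) r2(1) by (simp add: y_def z_def)
      have "emb x = emb (x - y - z) \<oplus>\<^bsub>K\<^esub> (emb y \<oplus>\<^bsub>K\<^esub> emb z)"
        by (simp flip: emb_add)
      moreover have "(w \<oplus>\<^bsub>K\<^esub> (u \<oplus>\<^bsub>K\<^esub> v)) \<ominus>\<^bsub>K\<^esub> (a \<oplus>\<^bsub>K\<^esub> b) = w \<oplus>\<^bsub>K\<^esub> ((u \<ominus>\<^bsub>K\<^esub> a) \<oplus>\<^bsub>K\<^esub> (v \<ominus>\<^bsub>K\<^esub> b))"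
        if "w \<in> carrier K" "u \<in> carrier K" "v \<in> carrier K" for w u v
        using that r1(1) r2(1) by (simp add: a_minus_def K.minus_add K.a_ac)
      ultimately have "emb x \<ominus>\<^bsub>K\<^esub> (a \<oplus>\<^bsub>K\<^esub> b) = emb (x - y - z) \<oplus>\<^bsub>K\<^esub> ((emb y \<ominus>\<^bsub>K\<^esub> a) \<oplus>\<^bsub>K\<^esub> (emb z \<ominus>\<^bsub>K\<^esub> b))"
        by simp
      thus "nrm (emb (qlog r N k (inf_mult ZG A B)) \<ominus>\<^bsub>K\<^esub> (a \<oplus>\<^bsub>K\<^esub> b)) < e"
        using nrm_add[of "emb (x - y - z)" "(emb y \<ominus>\<^bsub>K\<^esub> a) \<oplus>\<^bsub>K\<^esub> (emb z \<ominus>\<^bsub>K\<^esub> b)"] 1 2 r1(1) r2(1) by (simp add: x_def)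
    qed
  qed (use r1 r2 in simp)
qed

lemma ldet_lim_one: "ldet_lim (mat_one ZG) \<zero>\<^bsub>K\<^esub>"
  by (rule ldet_lim_zeroI[of 0 _ 1]) (simp_all add: qdet_one)

lemma ldet_lim_Einf: "A \<in> Einf ZG \<Longrightarrow> ldet_lim A \<zero>\<^bsub>K\<^esub>"
proof -
  interpret Z: matrix_ring ZG by (rule ring.matrix_ring[OF ring_c0Z])
  assume "A \<in> Einf ZG"
  thus ?thesis
  proof (induction rule: Z.Einf_induct)
    case one show ?case by (rule ldet_lim_one)
  next
    case (elem i j a) thus ?case by (intro ldet_lim_zeroI[of 0 _ 1]) (simp_all add: qdet_elem)
  next
    case (mult A B)
    have "finitary ZG A" "finitary ZG B"
      using mult subgroup.subset[OF Z.Einf_subgroup] Z.GLinf_finitary by auto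
    thus ?case using ldet_lim_mult[of A "\<zero>\<^bsub>K\<^esub>" B "\<zero>\<^bsub>K\<^esub>"] mult by simp
  qed
qed

lemma ldet_lim_group_elt: "g \<in> carrier G \<Longrightarrow> ldet_lim (one_by_one ZG (delta K g)) \<zero>\<^bsub>K\<^esub>"
  by (rule ldet_lim_zeroI[of 1 _ 2], rule qdet_group_elt) auto

text \<open>The determinant of the inverse matrix is an inverse of the determinant modulo a power of
  \<open>p\<close>; the threshold \<open>r0\<close> has to cover the blocks of both
  matrices.\<close>

lemma qdet_coprime_GL:
  assumes "A \<in> carrier (GLinf ZG)" obtains r0 where "\<And>r N k. r \<ge> r0 \<Longrightarrow> fin_index N \<Longrightarrow> coprime (qdet r N k A) (int p)"
proof -
  interpret Z: matrix_ring ZG by (rule ring.matrix_ring[OF ring_c0Z])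
  obtain B where B: "finitary ZG A" "finitary ZG B" "inf_mult ZG A B = mat_one ZG"
    using Z.GLinf_E[OF assms] .
  then obtain r1 r2 where r12: "supported_below ZG r1 A" "supported_below ZG r2 B" unfolding finitary_iff by blast
  have "coprime (qdet r N k A) (int p)" if r: "r \<ge> max r1 r2" and N: "fin_index N" for r N k
  proof -
    have s: "supported_below ZG r A" "supported_below ZG r B" using r12 r by (auto intro: supported_below_mono)
    have "[qdet r N k A * qdet r N k B = 1] (mod int p ^ (2 * k + 2))"
      using qdet_mult[OF N s, of k] B(3) qdet_one[OF N] by (simp add: cong_sym)
    from cong_coprime_p[OF this] show ?thesis by simp
  qed
  thus ?thesis by (rule that)
qed

lemma qdet_power:
  assumes "fin_index N" "supported_below ZG r A"
  shows "[qdet r N k (A [^]\<^bsub>rfm ZG\<^esub> (m::nat)) = qdet r N k A ^ m] (mod int p ^ (2 * k + 2))"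
proof (induction m)
  case 0 thus ?case using qdet_one[OF assms(1)] by (simp add: rfm_simps)
next
  case (Suc m)
  interpret Z: ring ZG by (rule ring_c0Z)
  have "[qdet r N k (A [^]\<^bsub>rfm ZG\<^esub> Suc m) = qdet r N k (A [^]\<^bsub>rfm ZG\<^esub> m) * qdet r N k A] (mod int p ^ (2 * k + 2))"
    using qdet_mult[OF assms(1) Z.supported_below_pow[OF assms(2)] assms(2)] by (simp add: rfm_simps)
  also have "[qdet r N k (A [^]\<^bsub>rfm ZG\<^esub> m) * qdet r N k A = qdet r N k A ^ m * qdet r N k A] (mod int p ^ (2 * k + 2))"
    by (rule cong_mult[OF Suc.IH cong_refl])
  finally show ?case by (simp add: mult.commute)
qed

text \<open>The logarithm of the power is \<open>m\<close> times that of \<open>A\<close> up to a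
  vanishing error, so convergence descends to \<open>A\<close>.\<close>

lemma ldet_lim_root:
  assumes A: "A \<in> carrier (GLinf ZG)" and m: "m > 0" and l: "l \<in> carrier K"
    and lim: "ldet_lim (A [^]\<^bsub>rfm ZG\<^esub> m) (emb (of_nat m) \<otimes>\<^bsub>K\<^esub> l)"
  shows "ldet_lim A l"
proof -
  interpret Z: matrix_ring ZG by (rule ring.matrix_ring[OF ring_c0Z])
  obtain r1 where r1: "\<And>r e. r \<ge> r1 \<Longrightarrow> e > 0 \<Longrightarrow> ev_index (\<lambda>N k. coprime (qdet r N k (A [^]\<^bsub>rfm ZG\<^esub> m)) (int p) \<and>
    nrm (emb (qlog r N k (A [^]\<^bsub>rfm ZG\<^esub> m)) \<ominus>\<^bsub>K\<^esub> (emb (of_nat m) \<otimes>\<^bsub>K\<^esub> l)) < e)" by (rule ldet_limE[OF lim]) blast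
  obtain r2 where r2: "\<And>r N k. r \<ge> r2 \<Longrightarrow> fin_index N \<Longrightarrow> coprime (qdet r N k A) (int p)" by (rule qdet_coprime_GL[OF A]) blast
  obtain r3 where r3: "supported_below ZG r3 A" using Z.GLinf_finitary[OF A] unfolding finitary_iff by blast
  have mpos: "pabs (of_nat m) > 0" using m by (intro pabs_pos) auto
  show ?thesis
  proof (rule ldet_limI[OF l, of "max r1 (max r2 r3)"])
    fix r :: nat and e :: real assume r: "r \<ge> max r1 (max r2 r3)" and e: "e > 0"
    \<comment> \<open>Dividing by \<open>m\<close> divides norms by \<open>pabs (of_nat m)\<close>,
      so the power has to be approximated to this finer precision.\<close>
    define e' where "e' = pabs (of_nat m) * e"
    have e': "e' > 0" using e mpos by (simp add: e'_def)
    have s: "supported_below ZG r A" using r r3 by (auto intro: supported_below_mono)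
    have "ev_index (\<lambda>N k. (coprime (qdet r N k (A [^]\<^bsub>rfm ZG\<^esub> m)) (int p) \<and>
    nrm (emb (qlog r N k (A [^]\<^bsub>rfm ZG\<^esub> m)) \<ominus>\<^bsub>K\<^esub> (emb (of_nat m) \<otimes>\<^bsub>K\<^esub> l)) < e') \<and> real 1 * (real (idx N) / real p ^ k) < e')"
      using r e' by (intro ev_index_conj r1 ev_index_small) auto
    thus "ev_index (\<lambda>N k. coprime (qdet r N k A) (int p) \<and> nrm (emb (qlog r N k A) \<ominus>\<^bsub>K\<^esub> l) < e)"
    proof (rule ev_index_mono, elim conjE, intro conjI)
      fix N k assume N: "fin_index N" and
        n: "nrm (emb (qlog r N k (A [^]\<^bsub>rfm ZG\<^esub> m)) \<ominus>\<^bsub>K\<^esub> (emb (of_nat m) \<otimes>\<^bsub>K\<^esub> l)) < e'"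
        and small: "real 1 * (real (idx N) / real p ^ k) < e'"
      show c: "coprime (qdet r N k A) (int p)" using r2 r N by auto
      define x where "x = qlog r N k A"
      define y where "y = qlog r N k (A [^]\<^bsub>rfm ZG\<^esub> m)"
      have "pabs (y - of_nat m * x) \<le> real (idx N) / real p ^ k"
        unfolding x_def y_def by (rule alog_power[OF idx_pos[OF N] c qdet_power[OF N s]])
      hence "nrm (emb (of_nat m * x) \<ominus>\<^bsub>K\<^esub> emb y) < e'"
        using small by (simp add: pabs_diff_commute flip: emb_diff)
      hence "nrm (emb (of_nat m * x) \<ominus>\<^bsub>K\<^esub> (emb (of_nat m) \<otimes>\<^bsub>K\<^esub> l)) < e'"
        using n nrm_diff_trans[of "emb (of_nat m * x)" "emb y" "emb (of_nat m) \<otimes>\<^bsub>K\<^esub> l"] l by (simp add: y_def)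
      moreover have "emb (of_nat m * x) \<ominus>\<^bsub>K\<^esub> (emb (of_nat m) \<otimes>\<^bsub>K\<^esub> l) = emb (of_nat m) \<otimes>\<^bsub>K\<^esub> (emb x \<ominus>\<^bsub>K\<^esub> l)"
        using l by (simp add: a_minus_def emb_mult K.r_distr K.r_minus)
      ultimately show "nrm (emb (qlog r N k A) \<ominus>\<^bsub>K\<^esub> l) < e"
        using l mpos by (simp add: nrm_mult e'_def x_def)
    qed
  qed
qed

end

section \<open>Logarithms of principal units\<close>

context padic begin

text \<open>The chain \<open>p ^ v \<le> n < 2 ^ n \<le> p ^ n\<close> gives \<open>v < n\<close>.
  The one power gained is what makes the terms of the logarithm series divisible by
  \<open>p\<close>, also for \<open>p = 2\<close>.\<close>

lemma pabs_nat_ge_pow: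
  assumes "n > 0" shows "real p / real p ^ n \<le> pabs (of_nat n)"
proof -
  define v where "v = multiplicity (int p) (int n)"
  have "int p ^ v dvd int n" unfolding v_def by (rule multiplicity_dvd)
  hence "int p ^ v \<le> int n" using assms by (intro zdvd_imp_le) auto
  hence "p ^ v \<le> n" by (metis of_nat_le_iff of_nat_power)
  also have "n < 2 ^ n" by (rule less_exp)
  also have "2 ^ n \<le> p ^ n" using p_gt_1 by (intro power_mono) auto
  finally have "v < n" using p_gt_1 by (metis power_strict_increasing_iff)
  hence "real p ^ Suc v \<le> real p ^ n" using p_gt_1 by (intro power_increasing) auto
  hence "real p / real p ^ n \<le> 1 / real p ^ v" using p_gt_0 by (simp add: field_simps)
  also have "1 / real p ^ v = pabs (of_nat n)" using pabs_int[of "int n"] assms by (simp add: v_def)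
  finally show ?thesis .
qed

text \<open>Passing from \<open>n\<close> to \<open>n + 1\<close> multiplies by
  \<open>(n + 1) / (n p)\<close>, which is at most 1 once \<open>n \<ge> 1\<close>. A bound on
  single terms of the logarithm series thereby bounds the whole tail.\<close>

lemma n_div_p_pow_antimono:
  assumes "1 \<le> N" "N \<le> n" shows "real n / real p ^ n \<le> real N / real p ^ N"
  using assms(2)
proof (induction n rule: dec_induct)
  case (step n)
  have "2 * real n \<le> real p * real n" using p_gt_1 by (intro mult_right_mono) auto
  moreover have "real n \<ge> 1" using step(1) assms(1) by simp
  ultimately have "real (Suc n) \<le> real p * real n" unfolding of_nat_Suc by linarith
  hence "real (Suc n) / real p ^ Suc n \<le> real p * real n / real p ^ Suc n" using p_gt_0 by (intro divide_right_mono) auto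
  also have "\<dots> = real n / real p ^ n" using p_gt_1 by simp
  finally have "real (Suc n) / real p ^ Suc n \<le> real n / real p ^ n" .
  thus ?case using step by linarith
qed simp

lemma n_div_p_pow_small: assumes "e > 0" obtains N where "N \<ge> 1" "real N / real p ^ N < e"
proof -
  have "(\<lambda>n. real n * (1 / real p) ^ n) \<longlonglongrightarrow> 0"
    using p_gt_1 by (intro powser_times_n_limit_0) auto
  hence "eventually (\<lambda>n. real n * (1 / real p) ^ n < e) sequentially" using assms by (rule order_tendstoD)
  then obtain n0 where "\<forall>n\<ge>n0. real n * (1 / real p) ^ n < e" by (auto simp: eventually_sequentially)
  thus ?thesis using that[of "max 1 n0"] by (simp add: power_one_over)
qed

text \<open>Formally \<open>(q - 1) choose j\<close> is the product of the
  \<open>(q - i) / i\<close>, each of them -1 modulo \<open>q\<close>; the factorial clears the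
  denominators, which need not be invertible modulo \<open>q\<close>.\<close>

lemma binomial_minus_one_cong:
  "j < q \<Longrightarrow> [int ((q - 1) choose j) * fact j = (- 1) ^ j * fact j] (mod int q)"
proof (induction j)
  case (Suc j)
  have "Suc j * ((q - 1) choose Suc j) = ((q - 1) choose j) * (q - 1 - j)"
    using binomial_absorb_comp[of "q - 1" j] binomial_absorption[of j "q - 1"] by (metis mult.commute)
  hence "int (Suc j) * int ((q - 1) choose Suc j) = int ((q - 1) choose j) * int (q - 1 - j)"
    by (metis of_nat_mult)
  also have "int (q - 1 - j) = int q - int (Suc j)" using Suc.prems by simp
  finally have h: "int (Suc j) * int ((q - 1) choose Suc j) = int ((q - 1) choose j) * (int q - int (Suc j))" .
  have "int ((q - 1) choose Suc j) * fact (Suc j) = (int (Suc j) * int ((q - 1) choose Suc j)) * fact j"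
    by (simp only: fact_Suc of_nat_mult mult_ac)
  also have "\<dots> = (int ((q - 1) choose j) * fact j) * (int q - int (Suc j))"
    unfolding h by (simp only: mult_ac)
  also have "[\<dots> = ((- 1) ^ j * fact j) * (0 - int (Suc j))] (mod int q)"
  proof (rule cong_mult)
    show "[int q - int (Suc j) = 0 - int (Suc j)] (mod int q)" by (intro cong_diff) (simp_all add: cong_0_iff)
  qed (use Suc in simp)
  also have "((- 1) ^ j * fact j) * (0 - int (Suc j)) = (- 1) ^ Suc j * fact (Suc j)" by (simp add: algebra_simps)
  finally show ?case .
qed simp

text \<open>Undoing the factorial costs the real factor \<open>fact j\<close>, harmless because
  \<open>j\<close> stays bounded while \<open>k\<close> grows.\<close>

lemma pabs_binomial_minus_one:
  assumes "j < p ^ k" shows "pabs (of_nat ((p ^ k - 1) choose j) - (- 1) ^ j) \<le> fact j / real p ^ k"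
proof -
  have "int p ^ k dvd int ((p ^ k - 1) choose j) * fact j - (- 1) ^ j * fact j"
    using binomial_minus_one_cong[OF assms] by (simp add: cong_iff_dvd_diff)
  hence "pabs (of_int (int ((p ^ k - 1) choose j) * fact j - (- 1) ^ j * fact j)) \<le> 1 / real p ^ k"
    using pabs_int_le_iff by blast
  also have "of_int (int ((p ^ k - 1) choose j) * fact j - (- 1) ^ j * fact j) =
    of_nat (fact j) * (of_nat ((p ^ k - 1) choose j) - (- 1) ^ j :: rat)" by (simp add: algebra_simps)
  finally have "pabs (of_nat ((p ^ k - 1) choose j) - (- 1) ^ j) \<le> real (fact j) * (1 / real p ^ k)"
    by (intro pabs_mult_nat_le) auto
  thus ?thesis by simp
qed

lemma K_finsum_diff:
  assumes "finite S" "\<And>i. i \<in> S \<Longrightarrow> f i \<in> carrier K" "\<And>i. i \<in> S \<Longrightarrow> h i \<in> carrier K"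
  shows "finsum K f S \<ominus>\<^bsub>K\<^esub> finsum K h S = finsum K (\<lambda>i. f i \<ominus>\<^bsub>K\<^esub> h i) S"
  using assms
proof (induction S rule: finite_induct)
  case (insert x F)
  have cl: "finsum K f F \<in> carrier K" "finsum K h F \<in> carrier K" "f x \<in> carrier K" "h x \<in> carrier K"
    using insert by (auto intro!: K.finsum_closed)
  have "(a \<oplus>\<^bsub>K\<^esub> b) \<ominus>\<^bsub>K\<^esub> (c \<oplus>\<^bsub>K\<^esub> d) = (a \<ominus>\<^bsub>K\<^esub> c) \<oplus>\<^bsub>K\<^esub> (b \<ominus>\<^bsub>K\<^esub> d)"
    if "a \<in> carrier K" "b \<in> carrier K" "c \<in> carrier K" "d \<in> carrier K" for a b c d
    using that by (simp add: a_minus_def K.minus_add K.a_ac)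
  note this[OF cl(3,1,4,2)]
  thus ?case using insert by (simp add: Pi_def)
qed (simp add: a_minus_def)

text \<open>The binomial theorem for \<open>(1 - w)\<^sup>q\<close> is stated after applying an additive map into \<open>Q\<^sub>p\<close>: in the
  induction step the map \<open>\<phi>\<close> is replaced by \<open>x \<mapsto> \<phi> (x w)\<close>.\<close>
lemma additive_one_minus_power:
  assumes "ring M" and w: "w \<in> carrier M"
    and cl: "\<And>x. x \<in> carrier M \<Longrightarrow> \<phi> x \<in> carrier K"
    and add: "\<And>x y. x \<in> carrier M \<Longrightarrow> y \<in> carrier M \<Longrightarrow> \<phi> (x \<oplus>\<^bsub>M\<^esub> y) = \<phi> x \<oplus>\<^bsub>K\<^esub> \<phi> y"
  shows "\<phi> ((\<one>\<^bsub>M\<^esub> \<ominus>\<^bsub>M\<^esub> w) [^]\<^bsub>M\<^esub> q) =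
    finsum K (\<lambda>\<nu>. emb ((- 1) ^ \<nu> * of_nat (q choose \<nu>)) \<otimes>\<^bsub>K\<^esub> \<phi> (w [^]\<^bsub>M\<^esub> \<nu>)) {..q}"
  using cl add
proof (induction q arbitrary: \<phi>)
  case 0
  interpret M: ring M by fact
  show ?case using 0 by simp
next
  case (Suc q)
  interpret M: ring M by fact
  define u where "u = \<one>\<^bsub>M\<^esub> \<ominus>\<^bsub>M\<^esub> w"
  have u: "u \<in> carrier M" using w by (simp add: u_def)
  have uq: "u [^]\<^bsub>M\<^esub> n \<in> carrier M" for n :: nat using u by simp
  have minus: "\<phi> (x \<ominus>\<^bsub>M\<^esub> y) = \<phi> x \<ominus>\<^bsub>K\<^esub> \<phi> y" if xy: "x \<in> carrier M" "y \<in> carrier M" for x y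
  proof -
    have "x = (x \<ominus>\<^bsub>M\<^esub> y) \<oplus>\<^bsub>M\<^esub> y" using xy by (simp add: a_minus_def M.a_assoc M.l_neg)
    hence "\<phi> x = \<phi> (x \<ominus>\<^bsub>M\<^esub> y) \<oplus>\<^bsub>K\<^esub> \<phi> y" using Suc.prems(2)[of "x \<ominus>\<^bsub>M\<^esub> y" y] xy by simp
    thus ?thesis using Suc.prems(1) xy by (simp add: a_minus_def K.a_assoc K.r_neg)
  qed
  define a :: "nat \<Rightarrow> rat" where "a \<nu> = (- 1) ^ \<nu> * of_nat (q choose \<nu>)" for \<nu>
  define F where "F \<nu> = \<phi> (w [^]\<^bsub>M\<^esub> \<nu>)" for \<nu> :: nat
  have F: "F \<nu> \<in> carrier K" for \<nu> unfolding F_def using Suc.prems(1) w by simp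
  define b where "b \<nu> = (case \<nu> of 0 \<Rightarrow> 0 | Suc n \<Rightarrow> a n)" for \<nu>
  have "u [^]\<^bsub>M\<^esub> Suc q = u [^]\<^bsub>M\<^esub> q \<ominus>\<^bsub>M\<^esub> u [^]\<^bsub>M\<^esub> q \<otimes>\<^bsub>M\<^esub> w"
    using uq[of q] w unfolding u_def by (simp add: a_minus_def M.r_distr M.r_minus)
  hence "\<phi> (u [^]\<^bsub>M\<^esub> Suc q) = \<phi> (u [^]\<^bsub>M\<^esub> q) \<ominus>\<^bsub>K\<^esub> \<phi> (u [^]\<^bsub>M\<^esub> q \<otimes>\<^bsub>M\<^esub> w)"
    using minus uq w by simp
  also have "\<phi> (u [^]\<^bsub>M\<^esub> q) = finsum K (\<lambda>\<nu>. emb (a \<nu>) \<otimes>\<^bsub>K\<^esub> F \<nu>) {..q}"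
    unfolding u_def a_def F_def by (rule Suc.IH) (use Suc.prems in auto)
  also have "\<dots> = finsum K (\<lambda>\<nu>. emb (a \<nu>) \<otimes>\<^bsub>K\<^esub> F \<nu>) {..Suc q}"
    using F by (simp add: a_def binomial_eq_0)
  also have "\<phi> (u [^]\<^bsub>M\<^esub> q \<otimes>\<^bsub>M\<^esub> w) = finsum K (\<lambda>\<nu>. emb (a \<nu>) \<otimes>\<^bsub>K\<^esub> F (Suc \<nu>)) {..q}"
    unfolding u_def a_def F_def
  proof (subst Suc.IH[of "\<lambda>x. \<phi> (x \<otimes>\<^bsub>M\<^esub> w)"])
    show "\<phi> (x \<otimes>\<^bsub>M\<^esub> w) \<in> carrier K" if "x \<in> carrier M" for x using that w Suc.prems(1) by simp
    show "\<phi> ((x \<oplus>\<^bsub>M\<^esub> y) \<otimes>\<^bsub>M\<^esub> w) = \<phi> (x \<otimes>\<^bsub>M\<^esub> w) \<oplus>\<^bsub>K\<^esub> \<phi> (y \<otimes>\<^bsub>M\<^esub> w)"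
      if "x \<in> carrier M" "y \<in> carrier M" for x y using that w Suc.prems(2) by (simp add: M.l_distr)
  qed simp
  also have "\<dots> = finsum K (\<lambda>\<nu>. emb (b \<nu>) \<otimes>\<^bsub>K\<^esub> F \<nu>) {..Suc q}"
    using F by (subst K.finsum_Suc2) (auto simp: b_def)
  also have "finsum K (\<lambda>\<nu>. emb (a \<nu>) \<otimes>\<^bsub>K\<^esub> F \<nu>) {..Suc q} \<ominus>\<^bsub>K\<^esub> finsum K (\<lambda>\<nu>. emb (b \<nu>) \<otimes>\<^bsub>K\<^esub> F \<nu>) {..Suc q}
     = finsum K (\<lambda>\<nu>. emb (a \<nu>) \<otimes>\<^bsub>K\<^esub> F \<nu> \<ominus>\<^bsub>K\<^esub> emb (b \<nu>) \<otimes>\<^bsub>K\<^esub> F \<nu>) {..Suc q}"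
    by (rule K_finsum_diff) (use F in auto)
  also have "\<dots> = finsum K (\<lambda>\<nu>. emb ((- 1) ^ \<nu> * of_nat (Suc q choose \<nu>)) \<otimes>\<^bsub>K\<^esub> F \<nu>) {..Suc q}"
  proof (rule K.finsum_cong')
    fix \<nu>
    have "(- 1) ^ \<nu> * of_nat (Suc q choose \<nu>) = a \<nu> - b \<nu>"
      by (cases \<nu>) (auto simp: a_def b_def algebra_simps)
    thus "emb (a \<nu>) \<otimes>\<^bsub>K\<^esub> F \<nu> \<ominus>\<^bsub>K\<^esub> emb (b \<nu>) \<otimes>\<^bsub>K\<^esub> F \<nu> = emb ((- 1) ^ \<nu> * of_nat (Suc q choose \<nu>)) \<otimes>\<^bsub>K\<^esub> F \<nu>"
      using F by (simp add: emb_diff a_minus_def K.l_distr K.l_minus)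
  qed (use F in auto)
  finally show ?case by (simp only: u_def F_def)
qed

text \<open>With \<open>v \<nu> = (1 - u)\<^sup>\<nu>\<close>, these are the partial sums of \<open>log u\<close> and the difference \<open>u\<^sup>q - 1\<close>.\<close>
definition log_sum :: "(nat \<Rightarrow> qp) \<Rightarrow> nat \<Rightarrow> qp" where
  "log_sum v N = \<ominus>\<^bsub>K\<^esub> finsum K (\<lambda>\<nu>. emb (1 / of_nat \<nu>) \<otimes>\<^bsub>K\<^esub> v \<nu>) {1..N}"

definition pow_sum :: "(nat \<Rightarrow> qp) \<Rightarrow> nat \<Rightarrow> qp" where
  "pow_sum v q = finsum K (\<lambda>\<nu>. emb ((- 1) ^ \<nu> * of_nat (q choose \<nu>)) \<otimes>\<^bsub>K\<^esub> v \<nu>) {1..q}"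

context
  fixes v :: "nat \<Rightarrow> qp"
  assumes v: "\<And>\<nu>. v \<nu> \<in> carrier K" and v_le: "\<And>\<nu>. nrm (v \<nu>) \<le> 1 / real p ^ \<nu>"
begin

lemma log_sum_closed: "log_sum v N \<in> carrier K"
  unfolding log_sum_def using v by (auto intro!: K.finsum_closed)

text \<open>The first bound tends to 0 and gives convergence; the second is uniform and gives the
  divisibility in \<open>pow_sum_le\<close>.\<close>

lemma log_term_le:
  assumes "\<nu> > 0" shows "nrm (emb (1 / of_nat \<nu>) \<otimes>\<^bsub>K\<^esub> v \<nu>) \<le> real \<nu> / real p ^ \<nu>"
    "nrm (emb (1 / of_nat \<nu>) \<otimes>\<^bsub>K\<^esub> v \<nu>) \<le> 1 / real p"
proof -
  have pos: "pabs (of_nat \<nu>) > 0" using assms by (intro pabs_pos) auto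
  have eq: "nrm (emb (1 / of_nat \<nu>) \<otimes>\<^bsub>K\<^esub> v \<nu>) = 1 / pabs (of_nat \<nu>) * nrm (v \<nu>)"
    using v by (simp add: nrm_mult pabs_divide)
  have "1 / pabs (of_nat \<nu>) \<le> real \<nu>" using pabs_nat_ge[OF assms] pos assms by (simp add: field_simps)
  hence "1 / pabs (of_nat \<nu>) * nrm (v \<nu>) \<le> real \<nu> * (1 / real p ^ \<nu>)"
    using v_le[of \<nu>] nrm_nonneg[OF v] by (intro mult_mono) auto
  thus "nrm (emb (1 / of_nat \<nu>) \<otimes>\<^bsub>K\<^esub> v \<nu>) \<le> real \<nu> / real p ^ \<nu>" using eq by simp
  have "1 / pabs (of_nat \<nu>) \<le> real p ^ \<nu> / real p" using pabs_nat_ge_pow[OF assms] pos p_gt_0 by (simp add: field_simps)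
  hence "1 / pabs (of_nat \<nu>) * nrm (v \<nu>) \<le> real p ^ \<nu> / real p * (1 / real p ^ \<nu>)"
    using v_le[of \<nu>] nrm_nonneg[OF v] by (intro mult_mono) auto
  thus "nrm (emb (1 / of_nat \<nu>) \<otimes>\<^bsub>K\<^esub> v \<nu>) \<le> 1 / real p" using eq p_gt_0 by simp
qed

lemma log_sum_diff_le:
  assumes "1 \<le> N" "N \<le> n" shows "nrm (log_sum v n \<ominus>\<^bsub>K\<^esub> log_sum v N) \<le> real N / real p ^ N"
proof -
  let ?f = "\<lambda>\<nu>. emb (1 / of_nat \<nu>) \<otimes>\<^bsub>K\<^esub> v \<nu>"
  have cl: "finsum K ?f {1..n} \<in> carrier K" "finsum K ?f {1..N} \<in> carrier K" using v by (auto intro!: K.finsum_closed)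
  have "log_sum v n \<ominus>\<^bsub>K\<^esub> log_sum v N = \<ominus>\<^bsub>K\<^esub> (finsum K ?f {1..n} \<ominus>\<^bsub>K\<^esub> finsum K ?f {1..N})"
    unfolding log_sum_def using cl by (simp add: a_minus_def K.minus_add)
  hence "nrm (log_sum v n \<ominus>\<^bsub>K\<^esub> log_sum v N) = nrm (finsum K ?f {1..n} \<ominus>\<^bsub>K\<^esub> finsum K ?f {1..N})"
    using cl by (simp add: nrm_uminus)
  also have "finsum K ?f {1..n} \<ominus>\<^bsub>K\<^esub> finsum K ?f {1..N} = finsum K ?f ({1..n} - {1..N})"
    by (rule finsum_diff_subset) (use v assms in auto)
  also have "nrm \<dots> \<le> real N / real p ^ N"
  proof (rule nrm_finsum_le)
    fix \<nu> assume "\<nu> \<in> {1..n} - {1..N}"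
    thus "nrm (?f \<nu>) \<le> real N / real p ^ N"
      using log_term_le(1)[of \<nu>] n_div_p_pow_antimono[OF assms(1), of \<nu>] by fastforce
  qed (use v in auto)
  finally show ?thesis .
qed

text \<open>The rate does not involve \<open>v\<close>, so in the application to matrix entries the
  convergence is uniform over all group elements.\<close>

lemma log_sum_converges:
  obtains L where "L \<in> carrier K" "\<And>N. N \<ge> 1 \<Longrightarrow> nrm (log_sum v N \<ominus>\<^bsub>K\<^esub> L) \<le> real N / real p ^ N"
proof -
  have C: "\<exists>N. \<forall>m\<ge>N. \<forall>n\<ge>N. nrm (log_sum v m \<ominus>\<^bsub>K\<^esub> log_sum v n) < e" if e: "e > 0" for e
  proof -
    obtain N where N: "N \<ge> 1" "real N / real p ^ N < e" using n_div_p_pow_small[OF e] .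
    have "nrm (log_sum v m \<ominus>\<^bsub>K\<^esub> log_sum v n) < e" if "m \<ge> N" "n \<ge> N" for m n
      using log_sum_diff_le[OF N(1) that(1)] log_sum_diff_le[OF N(1) that(2)] N(2)
        nrm_diff_trans[of "log_sum v m" "log_sum v N" "log_sum v n"]
        nrm_diff_commute[of "log_sum v n" "log_sum v N"] log_sum_closed by force
    thus ?thesis by (intro exI[of _ N]) simp
  qed
  obtain L where L: "L \<in> carrier K" "(\<lambda>n. nrm (log_sum v n \<ominus>\<^bsub>K\<^esub> L)) \<longlonglongrightarrow> 0"
    by (rule K_complete[OF log_sum_closed C])
  have "nrm (log_sum v N \<ominus>\<^bsub>K\<^esub> L) \<le> real N / real p ^ N" if N: "N \<ge> 1" for N
  proof (rule field_le_epsilon)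
    fix e :: real assume "e > 0"
    with L(2) have "eventually (\<lambda>n. nrm (log_sum v n \<ominus>\<^bsub>K\<^esub> L) < e) sequentially" by (rule order_tendstoD)
    then obtain n0 where n0: "\<forall>n\<ge>n0. nrm (log_sum v n \<ominus>\<^bsub>K\<^esub> L) < e" by (auto simp: eventually_sequentially)
    define n where "n = max n0 N"
    have "nrm (log_sum v n \<ominus>\<^bsub>K\<^esub> L) < e" using n0 by (simp add: n_def)
    moreover have "nrm (log_sum v N \<ominus>\<^bsub>K\<^esub> log_sum v n) \<le> real N / real p ^ N"
      using log_sum_diff_le[OF N, of n] nrm_diff_commute[OF log_sum_closed log_sum_closed] by (simp add: n_def)
    moreover have "real N / real p ^ N \<ge> 0" by simp
    ultimately show "nrm (log_sum v N \<ominus>\<^bsub>K\<^esub> L) \<le> real N / real p ^ N + e"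
      using nrm_diff_trans[OF log_sum_closed log_sum_closed L(1), of N n] \<open>e > 0\<close> by linarith
  qed
  thus ?thesis using L(1) that by blast
qed

lemma pow_sum_closed: "pow_sum v q \<in> carrier K"
  unfolding pow_sum_def using v by (auto intro!: K.finsum_closed)

text \<open>The absorption identity
  \<open>\<nu> (q choose \<nu>) = q ((q - 1) choose (\<nu> - 1))\<close> trades the division by
  \<open>q\<close> for the division by \<open>\<nu>\<close> that occurs in the logarithm
  series.\<close>

lemma pow_sum_div:
  assumes "q > 0"
  shows "emb (1 / of_nat q) \<otimes>\<^bsub>K\<^esub> pow_sum v q =
    finsum K (\<lambda>\<nu>. emb ((- 1) ^ \<nu> * of_nat ((q - 1) choose (\<nu> - 1))) \<otimes>\<^bsub>K\<^esub> (emb (1 / of_nat \<nu>) \<otimes>\<^bsub>K\<^esub> v \<nu>)) {1..q}"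
proof -
  have "emb (1 / of_nat q) \<otimes>\<^bsub>K\<^esub> pow_sum v q =
    finsum K (\<lambda>\<nu>. emb (1 / of_nat q) \<otimes>\<^bsub>K\<^esub> (emb ((- 1) ^ \<nu> * of_nat (q choose \<nu>)) \<otimes>\<^bsub>K\<^esub> v \<nu>)) {1..q}"
    unfolding pow_sum_def by (rule K.finsum_rdistr) (use v in auto)
  also have "\<dots> = finsum K (\<lambda>\<nu>. emb ((- 1) ^ \<nu> * of_nat ((q - 1) choose (\<nu> - 1))) \<otimes>\<^bsub>K\<^esub> (emb (1 / of_nat \<nu>) \<otimes>\<^bsub>K\<^esub> v \<nu>)) {1..q}"
  proof (rule K.finsum_cong')
    fix \<nu> assume \<nu>: "\<nu> \<in> {1..q}"
    have "\<nu> * (q choose \<nu>) = q * ((q - 1) choose (\<nu> - 1))"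
    proof -
      obtain m where "\<nu> = Suc m" using \<nu> by (cases \<nu>) auto
      thus ?thesis using binomial_absorption[of m q] by (simp only: diff_Suc_1)
    qed
    hence "of_nat \<nu> * of_nat (q choose \<nu>) = (of_nat q * of_nat ((q - 1) choose (\<nu> - 1)) :: rat)" by (metis of_nat_mult)
    hence "1 / of_nat q * ((- 1) ^ \<nu> * of_nat (q choose \<nu>)) = (- 1) ^ \<nu> * of_nat ((q - 1) choose (\<nu> - 1)) * (1 / of_nat \<nu> :: rat)"
      using \<nu> assms by (simp add: field_simps)
    thus "emb (1 / of_nat q) \<otimes>\<^bsub>K\<^esub> (emb ((- 1) ^ \<nu> * of_nat (q choose \<nu>)) \<otimes>\<^bsub>K\<^esub> v \<nu>) =
      emb ((- 1) ^ \<nu> * of_nat ((q - 1) choose (\<nu> - 1))) \<otimes>\<^bsub>K\<^esub> (emb (1 / of_nat \<nu>) \<otimes>\<^bsub>K\<^esub> v \<nu>)"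
      using v by (simp only: K.m_assoc[symmetric] emb_closed emb_mult[symmetric])
  qed (use v in auto)
  finally show ?thesis .
qed

lemma pabs_sign_nat_le: "pabs ((- 1) ^ \<nu> * of_nat m) \<le> 1"
  using pabs_int_le_1[of "int m"] by (simp add: pabs_mult pabs_power)

text \<open>In the application \<open>u ^ (p ^ k)\<close> is 1 modulo \<open>p ^ Suc k\<close>:
  after division by \<open>p ^ k\<close> every term is an integer times a logarithm term of norm at
  most \<open>1 / real p\<close>.\<close>

lemma pow_sum_le: "nrm (pow_sum v (p ^ k)) \<le> 1 / real p ^ Suc k"
proof -
  have "nrm (emb (1 / of_nat (p ^ k)) \<otimes>\<^bsub>K\<^esub> pow_sum v (p ^ k)) \<le> 1 / real p"
    unfolding pow_sum_div[of "p ^ k", OF zero_less_power[OF p_gt_0]]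
  proof (rule nrm_finsum_le)
    fix \<nu> assume "\<nu> \<in> {1..p ^ k}"
    hence t: "nrm (emb (1 / of_nat \<nu>) \<otimes>\<^bsub>K\<^esub> v \<nu>) \<le> 1 / real p" using log_term_le(2)[of \<nu>] by simp
    show "nrm (emb ((- 1) ^ \<nu> * of_nat ((p ^ k - 1) choose (\<nu> - 1))) \<otimes>\<^bsub>K\<^esub> (emb (1 / of_nat \<nu>) \<otimes>\<^bsub>K\<^esub> v \<nu>)) \<le> 1 / real p"
      using mult_mono[OF pabs_sign_nat_le t] v by (simp add: nrm_mult nrm_nonneg)
  qed (use v in auto)
  thus ?thesis using pow_sum_closed[of "p ^ k"] p_gt_0
    by (simp add: nrm_mult pabs_divide pabs_power pabs_p field_simps)
qed

text \<open>Beyond \<open>N\<close> the terms are uniformly small; up to \<open>N\<close> the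
  coefficients \<open>(-1) ^ \<nu> ((p ^ k - 1) choose (\<nu> - 1))\<close> are p-adically close to
  -1, the coefficient in \<open>log_sum\<close>.\<close>

lemma pow_sum_log_sum_le:
  assumes N: "1 \<le> N" "N \<le> p ^ k" and e: "real N / real p ^ N \<le> e" "fact N / real p ^ k \<le> e"
  shows "nrm (emb (1 / of_nat (p ^ k)) \<otimes>\<^bsub>K\<^esub> pow_sum v (p ^ k) \<ominus>\<^bsub>K\<^esub> log_sum v N) \<le> e"
proof -
  let ?q = "p ^ k"
  let ?t = "\<lambda>\<nu>. emb (1 / of_nat \<nu>) \<otimes>\<^bsub>K\<^esub> v \<nu>"
  let ?f = "\<lambda>\<nu>. emb ((- 1) ^ \<nu> * of_nat ((?q - 1) choose (\<nu> - 1))) \<otimes>\<^bsub>K\<^esub> ?t \<nu>"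
  have e0: "e \<ge> 0" using e(1) by (rule order_trans[rotated]) simp
  have t: "?t \<nu> \<in> carrier K" for \<nu> using v by simp
  have f: "?f \<nu> \<in> carrier K" for \<nu> using v by simp
  have cl: "finsum K ?f {1..?q} \<in> carrier K" "finsum K ?f {1..N} \<in> carrier K" "finsum K ?t {1..N} \<in> carrier K"
    using f t by (auto intro!: K.finsum_closed)
  have 1: "nrm (finsum K ?f {1..?q} \<ominus>\<^bsub>K\<^esub> finsum K ?f {1..N}) \<le> e"
  proof (subst finsum_diff_subset)
    show "nrm (finsum K ?f ({1..?q} - {1..N})) \<le> e"
    proof (rule nrm_finsum_le[OF e0 f])
      fix \<nu> assume "\<nu> \<in> {1..?q} - {1..N}"
      hence \<nu>: "\<nu> > 0" "N \<le> \<nu>" by auto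
      have "nrm (?t \<nu>) \<le> e" using log_term_le(1)[OF \<nu>(1)] n_div_p_pow_antimono[OF N(1) \<nu>(2)] e by linarith
      thus "nrm (?f \<nu>) \<le> e" using mult_mono[OF pabs_sign_nat_le, of "nrm (?t \<nu>)" e] t
        by (simp add: nrm_mult nrm_nonneg)
    qed
  qed (use N f in auto)
  have 2: "nrm (finsum K ?f {1..N} \<ominus>\<^bsub>K\<^esub> log_sum v N) \<le> e"
  proof -
    have "finsum K ?f {1..N} \<ominus>\<^bsub>K\<^esub> log_sum v N = finsum K ?f {1..N} \<oplus>\<^bsub>K\<^esub> finsum K ?t {1..N}"
      unfolding log_sum_def using cl by (simp add: a_minus_def)
    also have "\<dots> = finsum K (\<lambda>\<nu>. ?f \<nu> \<oplus>\<^bsub>K\<^esub> ?t \<nu>) {1..N}" by (rule K.finsum_addf[symmetric]) (use f t in auto)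
    also have "nrm \<dots> \<le> e"
    proof (rule nrm_finsum_le[OF e0])
      fix \<nu> assume \<nu>: "\<nu> \<in> {1..N}"
      \<comment> \<open>The deviation of the coefficient from -1, the sign being the leading minus
        of \<open>log_sum\<close>.\<close>
      let ?c = "(- 1) ^ \<nu> * of_nat ((?q - 1) choose (\<nu> - 1)) + 1 :: rat"
      have eq: "?f \<nu> \<oplus>\<^bsub>K\<^esub> ?t \<nu> = emb ?c \<otimes>\<^bsub>K\<^esub> ?t \<nu>"
        unfolding emb_add using t by (simp add: K.l_distr)
      have "(- 1) ^ \<nu> * (of_nat ((?q - 1) choose (\<nu> - 1)) - (- 1) ^ (\<nu> - 1)) = ?c"
        using \<nu> by (cases \<nu>) (auto simp: algebra_simps simp flip: power_mult_distrib)
      hence "pabs ?c = pabs (of_nat ((?q - 1) choose (\<nu> - 1)) - (- 1) ^ (\<nu> - 1))"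
        by (metis (no_types, lifting) mult_1 pabs_1 pabs_minus pabs_mult pabs_power power_one)
      also have "\<dots> \<le> fact (\<nu> - 1) / real p ^ k" by (rule pabs_binomial_minus_one) (use \<nu> N in auto)
      also have "\<dots> \<le> fact N / real p ^ k" using \<nu> p_gt_0 by (intro divide_right_mono fact_mono) auto
      finally have c: "pabs ?c \<le> e" using e by linarith
      have "1 / real p \<le> 1" using p_gt_1 by simp
      moreover have "nrm (?t \<nu>) \<le> 1 / real p" using \<nu> by (intro log_term_le(2)) auto
      ultimately have "nrm (?t \<nu>) \<le> 1" by linarith
      hence "pabs ?c * nrm (?t \<nu>) \<le> e * 1" by (intro mult_mono c) (use e0 t nrm_nonneg in auto)
      thus "nrm (?f \<nu> \<oplus>\<^bsub>K\<^esub> ?t \<nu>) \<le> e" unfolding eq using t by (simp add: nrm_mult)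
    qed (use f t in auto)
    finally show ?thesis .
  qed
  show ?thesis unfolding pow_sum_div[of ?q, OF zero_less_power[OF p_gt_0]]
    using 1 2 nrm_diff_trans[OF cl(1,2) log_sum_closed, of N] by linarith
qed

end

end

section \<open>The matrix logarithm of a principal unit\<close>

context padic_group begin

text \<open>\<open>mat_log\<close> is phrased in \<open>c0\<close>, of which only the additive group
  is established here. Ring computations take place in \<open>c0Z\<close>, and sums are carried over
  by this equality.\<close>

lemma finsum_CG_eq:
  assumes "\<And>i. i \<in> S \<Longrightarrow> F i \<in> carrier ZG" shows "finsum CG F S = finsum ZG F S"
proof -
  interpret C: abelian_group CG by (rule abelian_group_c0)
  interpret Z: abelian_group ZG by (rule abelian_group_c0Z)
  show ?thesis using assms
  proof (induction S rule: infinite_finite_induct)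
    case (insert x S)
    have "F \<in> S \<rightarrow> carrier CG" "F x \<in> carrier CG" "F \<in> S \<rightarrow> carrier ZG" "F x \<in> carrier ZG"
      using insert c0Z_c0 by (auto simp: c0_carrier)
    thus ?case using insert by (simp add: c0Z_simps)
  qed (simp_all add: c0Z_simps)
qed

lemma finsum_CG_eval:
  assumes "\<And>i. i \<in> S \<Longrightarrow> F i \<in> c0_set p G" shows "finsum CG F S g = finsum K (\<lambda>i. F i g) S"
proof -
  interpret C: abelian_group CG by (rule abelian_group_c0)
  show ?thesis using assms
  proof (induction S rule: infinite_finite_induct)
    case (insert x S)
    have F: "F \<in> S \<rightarrow> carrier CG" "F x \<in> carrier CG" using insert by (auto simp: c0_carrier)
    have cl: "F x g \<in> carrier K" "(\<lambda>i. F i g) \<in> S \<rightarrow> carrier K" using insert c0_set_closed by auto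
    have fs: "finsum CG F S \<in> c0_set p G" using C.finsum_closed[OF F(1)] by (simp add: c0_carrier)
    have "(F x \<oplus>\<^bsub>CG\<^esub> finsum CG F S) g = F x g \<oplus>\<^bsub>K\<^esub> finsum CG F S g"
      using insert c0_set_outside[of "F x" g] c0_set_outside[OF fs, of g] by (auto simp: c0_simps)
    moreover have "finsum CG F S g = finsum K (\<lambda>i. F i g) S" using insert by simp
    ultimately show ?case using insert(1,2) F cl by simp
  qed (simp_all add: c0_simps)
qed

lemma c0_smul_closed: assumes f: "f \<in> c0_set p G" shows "c0_smul p G q f \<in> c0_set p G"
proof (cases "q = 0")
  case True
  hence "c0_smul p G q f = \<zero>\<^bsub>CG\<^esub>" using f by (auto simp: c0_smul_def c0_simps c0_set_closed fun_eq_iff)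
  thus ?thesis using c0_zero_closed by simp
next
  case False
  show ?thesis
  proof (rule c0_setI)
    fix e :: real assume "e > 0"
    hence "e / pabs q > 0" using pabs_pos[OF False] by simp
    moreover have "{g \<in> carrier G. e \<le> nrm (c0_smul p G q f g)} = {g \<in> carrier G. e / pabs q \<le> nrm (f g)}"
      using f pabs_pos[OF False] by (auto simp: c0_smul_def nrm_mult c0_set_closed field_simps)
    ultimately show "finite {g \<in> carrier G. e \<le> nrm (c0_smul p G q f g)}" using c0_set_finite[OF f] by simp
  qed (use f in \<open>auto simp: c0_smul_def c0_set_closed\<close>)
qed

lemma c0_smul_eval: "f \<in> c0_set p G \<Longrightarrow> c0_smul p G q f g = emb q \<otimes>\<^bsub>K\<^esub> f g"
  by (simp add: c0_smul_def c0_set_outside)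

lemma smul_p_closed: "f \<in> carrier ZG \<Longrightarrow> c0_smul p G (of_nat p) f \<in> carrier ZG \<and> (\<forall>g. nrm (c0_smul p G (of_nat p) f g) \<le> 1 / real p)"
proof -
  assume f: "f \<in> carrier ZG"
  have b: "nrm (c0_smul p G (of_nat p) f g) \<le> 1 / real p" for g
    using c0Z_nrm[OF f, of g] f by (simp add: c0_smul_eval c0Z_c0 nrm_mult c0Z_closed pabs_p divide_right_mono)
  have "1 / real p \<le> 1" using p_gt_1 by simp
  hence "nrm (c0_smul p G (of_nat p) f g) \<le> 1" for g using b[of g] by linarith
  thus ?thesis using b c0_smul_closed[OF c0Z_c0[OF f]] by (simp add: c0Z_iff)
qed

lemma mat_one_CG: "mat_one CG = mat_one ZG"
  by (simp add: mat_one_def c0Z_simps fun_eq_iff)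

lemma nrm_rfm_mult_le:
  assumes A: "A \<in> carrier (rfm ZG)" and B: "B \<in> carrier (rfm ZG)"
    and a: "\<And>i j g. nrm (A i j g) \<le> a" "a > 0" and b: "\<And>i j g. nrm (B i j g) \<le> b" "b > 0"
  shows "nrm (inf_mult ZG A B i j g) \<le> a * b"
proof -
  interpret Z: ring ZG by (rule ring_c0Z)
  note cl = rfm_closedD[OF A] rfm_closedD[OF B]
  have m: "A i k \<otimes>\<^bsub>ZG\<^esub> B k j \<in> carrier ZG" for k using cl by simp
  have "inf_mult ZG A B i j g = finsum CG (\<lambda>k. A i k \<otimes>\<^bsub>ZG\<^esub> B k j) {k. A i k \<noteq> \<zero>\<^bsub>ZG\<^esub>} g"
    unfolding inf_mult_def by (subst finsum_CG_eq) (use m in auto)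
  also have "\<dots> = finsum K (\<lambda>k. (A i k \<otimes>\<^bsub>ZG\<^esub> B k j) g) {k. A i k \<noteq> \<zero>\<^bsub>ZG\<^esub>}"
    by (rule finsum_CG_eval) (use m c0Z_c0 in auto)
  also have "nrm \<dots> \<le> a * b"
  proof (rule nrm_finsum_le)
    fix k show "nrm ((A i k \<otimes>\<^bsub>ZG\<^esub> B k j) g) \<le> a * b"
      unfolding c0Z_simps by (rule c0_mult_nrm) (use cl a b in auto)
  qed (use a b m c0Z_closed in auto)
  finally show ?thesis .
qed

context
  fixes r :: nat and u :: "nat \<Rightarrow> nat \<Rightarrow> 'g \<Rightarrow> qp"
  assumes u_mem: "u \<in> one_plus_pM p G r"
begin

definition dev :: "nat \<Rightarrow> nat \<Rightarrow> 'g \<Rightarrow> qp" where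
  "dev = (\<lambda>k l. mat_one CG k l \<ominus>\<^bsub>CG\<^esub> u k l)"

lemma dev_props:
  shows u_supported: "supported_below ZG r u"
    and dev_rfm: "dev \<in> carrier (rfm ZG)"
    and dev_nrm: "nrm (dev i j g) \<le> 1 / real p"
    and dev_outside: "r \<le> i \<or> r \<le> j \<Longrightarrow> dev i j = \<zero>\<^bsub>ZG\<^esub>"
    and u_eq: "u = \<one>\<^bsub>rfm ZG\<^esub> \<ominus>\<^bsub>rfm ZG\<^esub> dev"
proof -
  interpret Z: matrix_ring ZG by (rule ring.matrix_ring[OF ring_c0Z])
  interpret C: abelian_group CG by (rule abelian_group_c0)
  obtain m where m0: "\<forall>i<r. \<forall>j<r. m i j \<in> carrier ZG"
    and m2: "u = (\<lambda>i j. if i < r \<and> j < r then mat_one CG i j \<oplus>\<^bsub>CG\<^esub> c0_smul p G (of_nat p) (m i j) else mat_one CG i j)"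
    using u_mem unfolding one_plus_pM_def by blast
  note m = m0[rule_format] m2
  define P where "P i j = c0_smul p G (of_nat p) (m i j)" for i j
  have P: "P i j \<in> carrier ZG" "nrm (P i j g) \<le> 1 / real p" if "i < r" "j < r" for i j g
    using smul_p_closed[OF m(1)[OF that]] by (auto simp: P_def)
  have one: "mat_one CG i j \<in> carrier ZG" for i j using Z.mat_one_closed mat_one_CG by simp
  have u: "u i j \<in> carrier ZG" for i j
    using one P by (auto simp: m(2) P_def[symmetric] c0Z_add_closed)
  show sup: "supported_below ZG r u" using u by (auto simp: supported_below_def m(2) mat_one_CG)
  have d: "dev i j = (if i < r \<and> j < r then \<ominus>\<^bsub>CG\<^esub> P i j else \<zero>\<^bsub>CG\<^esub>)" for i j
  proof -
    have "x \<in> carrier CG \<Longrightarrow> y \<in> carrier CG \<Longrightarrow> x \<ominus>\<^bsub>CG\<^esub> (x \<oplus>\<^bsub>CG\<^esub> y) = \<ominus>\<^bsub>CG\<^esub> y" for x y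
      by (simp add: a_minus_def C.minus_add flip: C.a_assoc) (simp add: C.r_neg)
    moreover have "x \<in> carrier CG \<Longrightarrow> x \<ominus>\<^bsub>CG\<^esub> x = \<zero>\<^bsub>CG\<^esub>" for x by (simp add: a_minus_def C.r_neg)
    moreover have "mat_one CG i j \<in> carrier CG" using one c0Z_c0 by (simp add: c0_carrier)
    moreover have "P i j \<in> carrier CG" if "i < r" "j < r" using P[OF that] c0Z_c0 by (simp add: c0_carrier)
    moreover have "u i j = (if i < r \<and> j < r then mat_one CG i j \<oplus>\<^bsub>CG\<^esub> P i j else mat_one CG i j)"
      by (subst m2) (simp add: P_def)
    ultimately show ?thesis by (simp add: dev_def)
  qed
  have d_eval: "dev i j g = (if i < r \<and> j < r then \<ominus>\<^bsub>K\<^esub> P i j g else \<zero>\<^bsub>K\<^esub>)" for i j g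
    using P c0Z_c0 by (simp add: d c0_a_inv c0_simps)
  have P_eval: "P i j g \<in> carrier K" if "i < r" "j < r" for i j g using c0Z_closed P[OF that] by blast
  show "nrm (dev i j g) \<le> 1 / real p" for i j g using P P_eval by (simp add: d_eval nrm_uminus)
  have dZ: "dev i j = (if i < r \<and> j < r then \<ominus>\<^bsub>ZG\<^esub> P i j else \<zero>\<^bsub>ZG\<^esub>)" for i j
    using P c0Z_c0 by (simp add: d c0_a_inv c0Z_a_inv c0Z_simps)
  show out: "r \<le> i \<or> r \<le> j \<Longrightarrow> dev i j = \<zero>\<^bsub>ZG\<^esub>" for i j by (auto simp: dZ)
  show W: "dev \<in> carrier (rfm ZG)"
  proof (rule rfmI)
    fix i
    have "{k. dev i k \<noteq> \<zero>\<^bsub>ZG\<^esub>} \<subseteq> {..<r}" using out by (auto simp: not_le[symmetric])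
    thus "finite {k. dev i k \<noteq> \<zero>\<^bsub>ZG\<^esub>}" by (rule finite_subset) simp
  qed (use P in \<open>simp add: dZ\<close>)
  have "u \<oplus>\<^bsub>rfm ZG\<^esub> dev = \<one>\<^bsub>rfm ZG\<^esub>"
    unfolding rfm_simps
  proof (rule ext, rule ext)
    fix i j
    have "x \<in> carrier CG \<Longrightarrow> y \<in> carrier CG \<Longrightarrow> x \<oplus>\<^bsub>CG\<^esub> (y \<ominus>\<^bsub>CG\<^esub> x) = y" for x y
      by (simp add: a_minus_def C.a_comm[of y] C.r_neg1 C.r_neg2)
    hence "u i j \<oplus>\<^bsub>CG\<^esub> dev i j = mat_one CG i j"
      using u one c0Z_c0 by (simp add: dev_def c0_carrier)
    thus "(u i j \<oplus>\<^bsub>ZG\<^esub> dev i j) = mat_one ZG i j" by (simp add: c0Z_simps mat_one_CG)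
  qed
  hence "\<one>\<^bsub>rfm ZG\<^esub> \<ominus>\<^bsub>rfm ZG\<^esub> dev = (u \<oplus>\<^bsub>rfm ZG\<^esub> dev) \<ominus>\<^bsub>rfm ZG\<^esub> dev" by simp
  also have "\<dots> = u" using W Z.supported_below_rfm[OF sup] by (simp add: a_minus_def Z.M.a_assoc Z.M.r_neg)
  finally show "u = \<one>\<^bsub>rfm ZG\<^esub> \<ominus>\<^bsub>rfm ZG\<^esub> dev" ..
qed

definition dev_pow :: "nat \<Rightarrow> nat \<Rightarrow> nat \<Rightarrow> 'g \<Rightarrow> qp" where
  "dev_pow n = dev [^]\<^bsub>rfm ZG\<^esub> n"

lemma dev_pow_rfm: "dev_pow n \<in> carrier (rfm ZG)"
proof -
  interpret Z: matrix_ring ZG by (rule ring.matrix_ring[OF ring_c0Z])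
  show ?thesis unfolding dev_pow_def using dev_rfm by simp
qed

lemma dev_pow_closed: "dev_pow n i j \<in> carrier ZG"
  using rfm_closedD[OF dev_pow_rfm] .

lemma dev_pow_K: "dev_pow n i j g \<in> carrier K"
  using c0Z_closed[OF dev_pow_closed] .

lemma dev_pow_nrm: "nrm (dev_pow n i j g) \<le> 1 / real p ^ n"
proof (induction n arbitrary: i j g)
  case 0
  have "nrm (mat_one ZG i j g) \<le> 1" by (rule c0Z_nrm) (rule ring.mat_one_closed[OF ring_c0Z])
  thus ?case by (simp add: dev_pow_def rfm_simps)
next
  case (Suc n)
  have "nrm (inf_mult ZG (dev_pow n) dev i j g) \<le> 1 / real p ^ n * (1 / real p)"
    by (rule nrm_rfm_mult_le[OF dev_pow_rfm dev_rfm]) (use Suc dev_nrm p_gt_1 in auto)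
  thus ?case by (simp add: dev_pow_def rfm_simps mult.commute)
qed

text \<open>\<open>dev\<close> vanishes outside the block of size \<open>r\<close>, so the product
  truncated to \<open>k < r\<close> agrees with the row-finite one; both zeroth powers are the
  infinite identity.\<close>

lemma mat_pow_eq: "mat_pow CG r dev n = dev_pow n"
proof (induction n)
  case 0 show ?case by (simp add: dev_pow_def rfm_simps mat_one_CG)
next
  case (Suc n)
  interpret Z: matrix_ring ZG by (rule ring.matrix_ring[OF ring_c0Z])
  have "mat_mult CG r (dev_pow n) dev i j = inf_mult ZG (dev_pow n) dev i j" for i j
  proof -
    have "mat_mult CG r (dev_pow n) dev i j = finsum ZG (\<lambda>k. dev_pow n i k \<otimes>\<^bsub>ZG\<^esub> dev k j) {..<r}"
      unfolding mat_mult_def c0Z_simps(4)[symmetric]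
      by (rule finsum_CG_eq) (use dev_pow_closed rfm_closedD[OF dev_rfm] in auto)
    thus ?thesis using Z.inf_mult_rfm[OF dev_pow_rfm[of n] dev_rfm, of "{..<r}" i j] dev_outside by (simp add: not_less)
  qed
  hence "mat_mult CG r (dev_pow n) dev = inf_mult ZG (dev_pow n) dev" by (simp add: fun_eq_iff)
  thus ?case using Suc by (simp add: dev_pow_def rfm_simps)
qed

text \<open>Evaluation at a matrix entry and a group element is the additive map to which the
  binomial theorem is applied; its term \<open>\<nu> = 0\<close> is the identity matrix.\<close>

lemma u_pow_eval:
  assumes "q > 0"
  shows "(u [^]\<^bsub>rfm ZG\<^esub> q) i j g = mat_one ZG i j g \<oplus>\<^bsub>K\<^esub> pow_sum (\<lambda>n. dev_pow n i j g) q"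
proof -
  interpret Z: matrix_ring ZG by (rule ring.matrix_ring[OF ring_c0Z])
  let ?t = "\<lambda>\<nu>. emb ((- 1) ^ \<nu> * of_nat (q choose \<nu>)) \<otimes>\<^bsub>K\<^esub> dev_pow \<nu> i j g"
  have "(u [^]\<^bsub>rfm ZG\<^esub> q) i j g = ((\<one>\<^bsub>rfm ZG\<^esub> \<ominus>\<^bsub>rfm ZG\<^esub> dev) [^]\<^bsub>rfm ZG\<^esub> q) i j g"
    by (rule arg_cong[OF u_eq, of "\<lambda>A. (A [^]\<^bsub>rfm ZG\<^esub> q) i j g"])
  also have "\<dots> = finsum K ?t {..q}"
    unfolding dev_pow_def
  proof (rule additive_one_minus_power[of "rfm ZG" dev "\<lambda>A. A i j g"])
    fix A B assume A: "A \<in> carrier (rfm ZG)" and B: "B \<in> carrier (rfm ZG)"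
    have "A i j \<in> c0_set p G" "B i j \<in> c0_set p G"
      by (rule c0Z_c0[OF rfm_closedD[OF A]], rule c0Z_c0[OF rfm_closedD[OF B]])
    thus "(A \<oplus>\<^bsub>rfm ZG\<^esub> B) i j g = A i j g \<oplus>\<^bsub>K\<^esub> B i j g"
      using c0_set_outside[of "A i j" g] c0_set_outside[of "B i j" g] by (auto simp: rfm_simps c0Z_simps c0_simps)
  next
    fix A assume A: "A \<in> carrier (rfm ZG)"
    show "A i j g \<in> carrier K" by (rule c0Z_closed[OF rfm_closedD[OF A]])
  qed (use dev_rfm Z.M.ring_axioms in auto)
  also have "{..q} = insert 0 {1..q}" by auto
  also have "finsum K ?t (insert 0 {1..q}) = ?t 0 \<oplus>\<^bsub>K\<^esub> finsum K ?t {1..q}"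
    by (rule K.finsum_insert) (use dev_pow_K in auto)
  also have "?t 0 = mat_one ZG i j g"
    using dev_pow_K[of 0 i j g] by (simp add: dev_pow_def rfm_simps)
  finally show ?thesis by (simp add: pow_sum_def)
qed

lemma log_partial_closed:
  shows "log_partial p G r u N i j \<in> c0_set p G"
    and "log_partial p G r u N i j g = log_sum (\<lambda>n. dev_pow n i j g) N"
proof -
  interpret C: abelian_group CG by (rule abelian_group_c0)
  let ?F = "\<lambda>\<nu>. c0_smul p G (1 / of_nat \<nu>) (dev_pow \<nu> i j)"
  have F: "?F \<nu> \<in> c0_set p G" for \<nu> using c0_smul_closed c0Z_c0 dev_pow_closed by blast
  hence fs: "finsum CG ?F {1..N} \<in> carrier CG" by (intro C.finsum_closed) (auto simp: c0_carrier)
  have eq: "log_partial p G r u N i j = \<ominus>\<^bsub>CG\<^esub> finsum CG ?F {1..N}"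
    unfolding log_partial_def dev_def[symmetric] mat_pow_eq ..
  show "log_partial p G r u N i j \<in> c0_set p G" using C.a_inv_closed[OF fs] by (simp add: eq c0_carrier)
  have "finsum CG ?F {1..N} g = finsum K (\<lambda>\<nu>. ?F \<nu> g) {1..N}" by (rule finsum_CG_eval[OF F])
  also have "\<dots> = finsum K (\<lambda>\<nu>. emb (1 / of_nat \<nu>) \<otimes>\<^bsub>K\<^esub> dev_pow \<nu> i j g) {1..N}"
    using c0_smul_eval[OF c0Z_c0[OF dev_pow_closed]] by simp
  finally show "log_partial p G r u N i j g = log_sum (\<lambda>n. dev_pow n i j g) N"
    using fs by (simp add: eq c0_a_inv c0_carrier log_sum_def)
qed

text \<open>\<open>mat_log\<close> is a definite description, so existence and uniqueness of the
  limit come first. The coefficientwise limits have a rate independent of the group element, which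
  puts the limit into \<open>c0\<close> and gives convergence in \<open>c0_norm\<close>.\<close>

lemma mat_log_props:
  shows mat_log_closed: "mat_log p G r u i j \<in> c0_set p G"
    and mat_log_outside: "\<not> (i < r \<and> j < r) \<Longrightarrow> mat_log p G r u i j = \<zero>\<^bsub>CG\<^esub>"
    and mat_log_approx: "i < r \<Longrightarrow> j < r \<Longrightarrow> N \<ge> 1 \<Longrightarrow>
       nrm (log_sum (\<lambda>n. dev_pow n i j g) N \<ominus>\<^bsub>K\<^esub> mat_log p G r u i j g) \<le> real N / real p ^ N"
proof -
  define T where "T N i j g = log_sum (\<lambda>n. dev_pow n i j g) N" for N i j g
  have T: "T N i j g \<in> carrier K" for N i j g unfolding T_def by (rule log_sum_closed) (rule dev_pow_K dev_pow_nrm)+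
  have "\<exists>l. l \<in> carrier K \<and> (\<forall>N\<ge>1. nrm (T N i j g \<ominus>\<^bsub>K\<^esub> l) \<le> real N / real p ^ N)" for i j g
    using log_sum_converges[of "\<lambda>n. dev_pow n i j g", OF dev_pow_K dev_pow_nrm] unfolding T_def by metis
  then obtain L0 where L0: "\<And>i j g. L0 i j g \<in> carrier K"
    "\<And>i j g N. N \<ge> 1 \<Longrightarrow> nrm (T N i j g \<ominus>\<^bsub>K\<^esub> L0 i j g) \<le> real N / real p ^ N" by metis
  \<comment> \<open>Zero off the block is prescribed by the description, zero off
    \<open>carrier G\<close> by \<open>c0_set\<close>.\<close>
  define L where "L i j = (\<lambda>g. if i < r \<and> j < r then if g \<in> carrier G then L0 i j g else \<zero>\<^bsub>K\<^esub> else \<zero>\<^bsub>K\<^esub>)" for i j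
  have LK: "L i j g \<in> carrier K" for i j g using L0(1) by (simp add: L_def)
  have T_out: "T N i j g = \<zero>\<^bsub>K\<^esub>" if "g \<notin> carrier G" for N i j g
    using log_partial_closed(1)[THEN c0_set_outside, OF that, of N i j] log_partial_closed(2) by (simp add: T_def)
  have approx: "nrm (T N i j g \<ominus>\<^bsub>K\<^esub> L i j g) \<le> real N / real p ^ N" if "i < r" "j < r" "N \<ge> 1" for i j g N
    using that L0(2) by (auto simp: L_def T_out a_minus_def)
  have Lc: "L i j \<in> c0_set p G" for i j
  proof (rule c0_setI)
    fix e :: real assume e: "e > 0"
    show "finite {g \<in> carrier G. e \<le> nrm (L i j g)}"
    proof (cases "i < r \<and> j < r")
      case True
      obtain N where N: "N \<ge> 1" "real N / real p ^ N < e" using n_div_p_pow_small[OF e] .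
      \<comment> \<open>The limit differs from the partial sum by less than \<open>e\<close>, so it
        can have norm at least \<open>e\<close> only where the partial sum does.\<close>
      have "e \<le> nrm (T N i j g)" if "e \<le> nrm (L i j g)" for g
      proof (rule ccontr)
        assume "\<not> e \<le> nrm (T N i j g)"
        hence "nrm (T N i j g) < e" "nrm (L i j g \<ominus>\<^bsub>K\<^esub> T N i j g) < e"
          using approx[of i j N g] True N nrm_diff_commute[OF LK T] by auto
        moreover have "L i j g = (L i j g \<ominus>\<^bsub>K\<^esub> T N i j g) \<oplus>\<^bsub>K\<^esub> T N i j g"
          using LK T by (simp add: a_minus_def K.a_assoc K.l_neg)
        ultimately show False using nrm_add[of "L i j g \<ominus>\<^bsub>K\<^esub> T N i j g" "T N i j g"] that LK T by auto
      qed
      hence "{g \<in> carrier G. e \<le> nrm (L i j g)} \<subseteq> {g \<in> carrier G. e \<le> nrm (log_partial p G r u N i j g)}"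
        using log_partial_closed(2) by (auto simp: T_def)
      thus ?thesis using c0_set_finite[OF log_partial_closed(1) e] finite_subset by blast
    qed (use e in \<open>auto simp: L_def\<close>)
  qed (use LK in \<open>auto simp: L_def\<close>)
  let ?P = "\<lambda>L. (\<forall>i j. (i < r \<and> j < r \<longrightarrow> L i j \<in> c0_set p G) \<and>
                                  (\<not> (i < r \<and> j < r) \<longrightarrow> L i j = \<zero>\<^bsub>CG\<^esub>)) \<and>
      (\<forall>i<r. \<forall>j<r. (\<lambda>N. c0_norm p G (log_partial p G r u N i j \<ominus>\<^bsub>CG\<^esub> L i j)) \<longlonglongrightarrow> 0)"
  have diff_closed: "log_partial p G r u N i j \<ominus>\<^bsub>CG\<^esub> L' i j \<in> c0_set p G"
    "(log_partial p G r u N i j \<ominus>\<^bsub>CG\<^esub> L' i j) g = T N i j g \<ominus>\<^bsub>K\<^esub> L' i j g"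
    if "L' i j \<in> c0_set p G" for N i j L' g
  proof -
    note c = log_partial_closed(1)[of N i j]
    show "log_partial p G r u N i j \<ominus>\<^bsub>CG\<^esub> L' i j \<in> c0_set p G"
      using abelian_group.minus_closed[OF abelian_group_c0] c that by (simp only: c0_carrier)
    show "(log_partial p G r u N i j \<ominus>\<^bsub>CG\<^esub> L' i j) g = T N i j g \<ominus>\<^bsub>K\<^esub> L' i j g"
      using c0_minus[OF c that] log_partial_closed(2) by (simp add: T_def)
  qed
  note dL = diff_closed(1)[of L, OF Lc] diff_closed(2)[of L, OF Lc]
  have "?P L"
  proof (intro conjI allI impI)
    fix i j assume ij: "i < r" "j < r"
    show "(\<lambda>N. c0_norm p G (log_partial p G r u N i j \<ominus>\<^bsub>CG\<^esub> L i j)) \<longlonglongrightarrow> 0"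
    proof (rule tendsto_sandwich[of "\<lambda>_. 0" _ _ "\<lambda>N. real N * (1 / real p) ^ N"])
      show "(\<lambda>N. real N * (1 / real p) ^ N) \<longlonglongrightarrow> 0"
        using p_gt_1 by (intro powser_times_n_limit_0) auto
      show "\<forall>\<^sub>F N in sequentially. 0 \<le> c0_norm p G (log_partial p G r u N i j \<ominus>\<^bsub>CG\<^esub> L i j)"
      proof (rule always_eventually, rule allI)
        fix N
        have "nrm ((log_partial p G r u N i j \<ominus>\<^bsub>CG\<^esub> L i j) \<one>) \<le> c0_norm p G (log_partial p G r u N i j \<ominus>\<^bsub>CG\<^esub> L i j)"
          using c0_norm_le_iff[OF dL(1)] one_closed by blast
        moreover have "0 \<le> nrm ((log_partial p G r u N i j \<ominus>\<^bsub>CG\<^esub> L i j) \<one>)"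
          by (rule nrm_nonneg[OF c0_set_closed[OF dL(1)]])
        ultimately show "0 \<le> c0_norm p G (log_partial p G r u N i j \<ominus>\<^bsub>CG\<^esub> L i j)" by linarith
      qed
      show "\<forall>\<^sub>F N in sequentially. c0_norm p G (log_partial p G r u N i j \<ominus>\<^bsub>CG\<^esub> L i j) \<le> real N * (1 / real p) ^ N"
        unfolding eventually_sequentially
      proof (intro exI[of _ 1] allI impI)
        fix N :: nat assume "N \<ge> 1"
        thus "c0_norm p G (log_partial p G r u N i j \<ominus>\<^bsub>CG\<^esub> L i j) \<le> real N * (1 / real p) ^ N"
          unfolding c0_norm_le_iff[OF dL(1)] dL(2)
          using approx[OF ij] by (simp add: power_one_over)
      qed
    qed simp
  qed (auto simp: Lc, auto simp: L_def c0_simps)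
  moreover have "L' = L" if L': "?P L'" for L'
  proof (intro ext)
    fix i j g
    show "L' i j g = L i j g"
    proof (cases "i < r \<and> j < r")
      case True
      hence L'c: "L' i j \<in> c0_set p G" using L' by blast
      note dL' = diff_closed(1)[of L', OF L'c] diff_closed(2)[of L', OF L'c]
      show ?thesis
      proof (rule K_eqI)
        fix e :: real assume e: "e > 0"
        have "(\<lambda>N. c0_norm p G (log_partial p G r u N i j \<ominus>\<^bsub>CG\<^esub> L' i j)) \<longlonglongrightarrow> 0" using L' True by blast
        hence "eventually (\<lambda>N. c0_norm p G (log_partial p G r u N i j \<ominus>\<^bsub>CG\<^esub> L' i j) < e) sequentially"
          using e by (rule order_tendstoD)
        moreover have "(\<lambda>N. c0_norm p G (log_partial p G r u N i j \<ominus>\<^bsub>CG\<^esub> L i j)) \<longlonglongrightarrow> 0" using \<open>?P L\<close> True by blast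
        hence "eventually (\<lambda>N. c0_norm p G (log_partial p G r u N i j \<ominus>\<^bsub>CG\<^esub> L i j) < e) sequentially"
          using e by (rule order_tendstoD)
        ultimately have "eventually (\<lambda>N. c0_norm p G (log_partial p G r u N i j \<ominus>\<^bsub>CG\<^esub> L' i j) < e \<and>
          c0_norm p G (log_partial p G r u N i j \<ominus>\<^bsub>CG\<^esub> L i j) < e) sequentially" by (rule eventually_conj)
        then obtain N where N: "c0_norm p G (log_partial p G r u N i j \<ominus>\<^bsub>CG\<^esub> L' i j) \<le> e"
          "c0_norm p G (log_partial p G r u N i j \<ominus>\<^bsub>CG\<^esub> L i j) \<le> e"
          unfolding eventually_sequentially by (meson less_imp_le order_refl)
        show "nrm (L' i j g \<ominus>\<^bsub>K\<^esub> L i j g) \<le> e"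
        proof (cases "g \<in> carrier G")
          case g: True
          have "nrm (T N i j g \<ominus>\<^bsub>K\<^esub> L' i j g) \<le> e" "nrm (T N i j g \<ominus>\<^bsub>K\<^esub> L i j g) \<le> e"
            using N g unfolding c0_norm_le_iff[OF dL(1)] c0_norm_le_iff[OF dL'(1)]
              dL(2) dL'(2) by auto
          thus ?thesis using nrm_diff_trans[of "L' i j g" "T N i j g" "L i j g"]
              nrm_diff_commute[of "L' i j g" "T N i j g"] T LK c0_set_closed[OF L'c, of g] by auto
        qed (use e c0_set_outside[OF L'c] in \<open>simp add: L_def a_minus_def\<close>)
      qed (use LK c0_set_closed[OF L'c] in auto)
    next
      case False
      hence "L' i j = \<zero>\<^bsub>CG\<^esub>" using L' by blast
      thus ?thesis using False by (auto simp: L_def c0_simps)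
    qed
  qed
  ultimately have "(THE L. ?P L) = L" by (rule the_equality)
  hence eq: "mat_log p G r u = L" unfolding mat_log_def .
  show "mat_log p G r u i j \<in> c0_set p G" for i j using Lc eq by simp
  show "\<not> (i < r \<and> j < r) \<Longrightarrow> mat_log p G r u i j = \<zero>\<^bsub>CG\<^esub>" for i j
    unfolding eq by (auto simp: L_def c0_simps)
  show "nrm (log_sum (\<lambda>n. dev_pow n i j g) N \<ominus>\<^bsub>K\<^esub> mat_log p G r u i j g) \<le> real N / real p ^ N"
    if "i < r" "j < r" "N \<ge> 1" for i j N g using approx[OF that] eq by (simp add: T_def)
qed

end

end

section \<open>The limit on principal units\<close>

context padic begin

text \<open>Raising to the power \<open>p - 1\<close> multiplies the first-order term by
  \<open>p - 1\<close>, modulo the square of \<open>p ^ Suc k\<close>. The factors \<open>d\<close>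
  and \<open>p - 1\<close> cancel against those in \<open>alog\<close>, which leaves
  \<open>\<tau> / p ^ k\<close>.\<close>

lemma alog_one_plus:
  assumes d: "d > 0" and D: "[D ^ p ^ k = 1 + int d * \<tau>] (mod int p ^ (2 * k + 2))" and \<tau>: "int p ^ Suc k dvd \<tau>"
  shows "pabs (alog k d D - of_int \<tau> / of_nat (p ^ k)) \<le> real d / real p ^ k"
proof -
  obtain t where t: "\<tau> = int p ^ Suc k * t" using \<tau> by (auto elim: dvdE)
  have c2: "int p ^ (2 * k + 2) = int p ^ Suc k * int p ^ Suc k" by (simp only: power_add[symmetric]) (simp add: mult_2)
  have "[(D ^ p ^ k) ^ (p - 1) = (1 + int p ^ Suc k * (int d * t)) ^ (p - 1)] (mod int p ^ (2 * k + 2))"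
    using cong_pow[OF D, of "p - 1"] by (simp add: t algebra_simps)
  also have "[(1 + int p ^ Suc k * (int d * t)) ^ (p - 1) = 1 + int p ^ Suc k * (\<Sum>i<p - 1. int d * t)] (mod int p ^ (2 * k + 2))"
    unfolding c2 using prod_one_plus_cong[of "{..<p - 1}" "int p ^ Suc k" "\<lambda>_. int d * t"] by simp
  also have "1 + int p ^ Suc k * (\<Sum>i<p - 1. int d * t) = 1 + int (d * (p - 1)) * \<tau>" by (simp add: t)
  finally have "int p ^ (2 * k + 2) dvd D ^ ((p - 1) * p ^ k) - (1 + int (d * (p - 1)) * \<tau>)"
    by (simp add: cong_iff_dvd_diff mult.commute flip: power_mult)
  from pabs_alog_div[OF d this] have "pabs (of_int (D ^ ((p - 1) * p ^ k) - (1 + int (d * (p - 1)) * \<tau>)) / of_nat (d * (p - 1) * p ^ k))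
     \<le> real d / real p ^ k" .
  moreover have "of_int (D ^ ((p - 1) * p ^ k) - (1 + int (d * (p - 1)) * \<tau>)) / of_nat (d * (p - 1) * p ^ k) =
    alog k d D - of_int \<tau> / (of_nat (p ^ k) :: rat)"
  proof -
    have nz: "of_nat (d * (p - 1)) \<noteq> (0 :: rat)" using d p_gt_1 by simp
    have "of_int (D ^ ((p - 1) * p ^ k) - (1 + int (d * (p - 1)) * \<tau>)) =
      (of_int (D ^ ((p - 1) * p ^ k) - 1) - of_nat (d * (p - 1)) * of_int \<tau> :: rat)" by simp
    hence "of_int (D ^ ((p - 1) * p ^ k) - (1 + int (d * (p - 1)) * \<tau>)) / of_nat (d * (p - 1) * p ^ k) =
      alog k d D - (of_nat (d * (p - 1)) * of_int \<tau>) / (of_nat (d * (p - 1)) * of_nat (p ^ k) :: rat)"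
      by (simp only: alog_def diff_divide_distrib of_nat_mult)
    thus ?thesis by (simp only: mult_divide_mult_cancel_left[OF nz])
  qed
  ultimately show ?thesis by (simp only:)
qed

end

context padic_group begin

lemma fin_index_one: "fin_index N \<Longrightarrow> \<one> \<in> N"
  by (simp add: fin_index_def normal_imp_subgroup subgroup.one_closed)

text \<open>The coset \<open>N\<close> is the identity of the quotient, so \<open>push\<close> sums
  the residues over \<open>N\<close> there. The one at the identity, divided by
  \<open>p ^ k\<close>, approximates \<open>L \<one>\<close>; the finitely many other nonzero ones
  are negligible by \<open>LN\<close>.\<close>

lemma push_red_approx:
  assumes f: "f \<in> carrier ZG" and L: "\<And>g. L g \<in> carrier K" and N: "fin_index N" and e: "e \<ge> 0"
    and approx: "\<And>g. nrm (emb (1 / of_nat (p ^ k)) \<otimes>\<^bsub>K\<^esub> f g \<ominus>\<^bsub>K\<^esub> L g) \<le> e"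
    and small: "1 / real p ^ k \<le> e" and LN: "\<And>g. g \<in> N \<Longrightarrow> g \<noteq> \<one> \<Longrightarrow> nrm (L g) \<le> e"
  shows "nrm (emb (of_int (finite_quotient.push G ((#>) N) (red (2 * k + 2) f) N) / of_nat (p ^ k)) \<ominus>\<^bsub>K\<^esub> L \<one>) \<le> e"
proof -
  let ?M = "2 * k + 2"
  define a where "a = red ?M f"
  have a_fin: "finite {g \<in> carrier G. a g \<noteq> 0}" unfolding a_def by (rule red_finite[OF f])
  have a_close: "close ?M (f g) (a g)" for g unfolding a_def by (rule red_close[OF f])
  interpret Q: finite_quotient G "p ^ ?M" "G Mod N" "(#>) N" by (rule fin_index_finite_quotient[OF N]) simp
  have sub: "subgroup N G" using N by (simp add: fin_index_def normal_imp_subgroup)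
  have coset: "N #> g = N \<longleftrightarrow> g \<in> N" if "g \<in> carrier G" for g
    using coset_join1[OF _ that sub] coset_join2[OF that sub] subgroup.subset[OF sub] by blast
  define T where "T = {g \<in> carrier G. a g \<noteq> 0 \<and> g \<in> N} - {\<one>}"
  have T: "finite T" by (rule finite_subset[OF _ a_fin]) (auto simp: T_def)
  have "Q.push a N = (\<Sum>g\<in>Q.supp a. if N #> g = N then a g else 0)" by (rule Q.push_def)
  also have "\<dots> = (\<Sum>g\<in>insert \<one> T. a g)"
    by (rule sum.mono_neutral_cong) (use T a_fin fin_index_one[OF N] coset in \<open>auto simp: T_def\<close>)
  also have "\<dots> = a \<one> + sum a T" using T by (subst sum.insert) (auto simp: T_def)
  finally have push: "of_int (Q.push a N) / of_nat (p ^ k) =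
    (of_int (a \<one>) / of_nat (p ^ k) + (\<Sum>g\<in>T. of_int (a g) / of_nat (p ^ k)) :: rat)"
    by (simp add: add_divide_distrib sum_divide_distrib)
  have fK: "f g \<in> carrier K" for g using f by (rule c0Z_closed)
  have near: "nrm (emb (of_int (a g) / of_nat (p ^ k)) \<ominus>\<^bsub>K\<^esub> L g) \<le> e" for g
  proof -
    let ?c = "emb (1 / of_nat (p ^ k))"
    have eq: "emb (of_int (a g) / of_nat (p ^ k)) = ?c \<otimes>\<^bsub>K\<^esub> emb (of_int (a g))"
      by (simp flip: emb_mult)
    have "?c \<otimes>\<^bsub>K\<^esub> f g \<ominus>\<^bsub>K\<^esub> ?c \<otimes>\<^bsub>K\<^esub> emb (of_int (a g)) = ?c \<otimes>\<^bsub>K\<^esub> (f g \<ominus>\<^bsub>K\<^esub> emb (of_int (a g)))"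
      using fK by (simp add: a_minus_def K.r_distr K.r_minus)
    hence "nrm (?c \<otimes>\<^bsub>K\<^esub> f g \<ominus>\<^bsub>K\<^esub> ?c \<otimes>\<^bsub>K\<^esub> emb (of_int (a g))) = real p ^ k * nrm (f g \<ominus>\<^bsub>K\<^esub> emb (of_int (a g)))"
      using fK by (simp add: nrm_mult pabs_divide pabs_power pabs_p power_one_over)
    \<comment> \<open>Of the precision \<open>p ^ (2 * k + 2)\<close> of a residue, the division by
      \<open>p ^ k\<close> leaves \<open>p ^ (k + 2)\<close>.\<close>
    also have "\<dots> \<le> real p ^ k * (1 / real p ^ ?M)"
      using a_close[of g] by (intro mult_left_mono) (auto simp: close_def)
    also have "\<dots> = 1 / real p ^ (k + 2)"
    proof -
      have "real p ^ ?M = real p ^ k * real p ^ (k + 2)" by (simp only: power_add[symmetric]) (simp add: mult_2)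
      thus ?thesis using p_gt_1 by simp
    qed
    also have "\<dots> \<le> 1 / real p ^ k" using p_gt_1 by (intro divide_left_mono power_increasing) auto
    finally have "nrm (?c \<otimes>\<^bsub>K\<^esub> f g \<ominus>\<^bsub>K\<^esub> ?c \<otimes>\<^bsub>K\<^esub> emb (of_int (a g))) \<le> e" using small by linarith
    thus ?thesis unfolding eq using approx[of g]
        nrm_diff_trans[of "?c \<otimes>\<^bsub>K\<^esub> emb (of_int (a g))" "?c \<otimes>\<^bsub>K\<^esub> f g" "L g"]
        nrm_diff_commute[of "?c \<otimes>\<^bsub>K\<^esub> emb (of_int (a g))" "?c \<otimes>\<^bsub>K\<^esub> f g"] fK L by fastforce
  qed
  have "nrm (emb (of_int (a g) / of_nat (p ^ k))) \<le> e" if "g \<in> T" for g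
  proof -
    have "emb (of_int (a g) / of_nat (p ^ k)) = (emb (of_int (a g) / of_nat (p ^ k)) \<ominus>\<^bsub>K\<^esub> L g) \<oplus>\<^bsub>K\<^esub> L g"
      using L by (simp add: a_minus_def K.a_assoc K.l_neg)
    thus ?thesis using near[of g] LN[of g] that L nrm_add[of "emb (of_int (a g) / of_nat (p ^ k)) \<ominus>\<^bsub>K\<^esub> L g" "L g"]
      by (fastforce simp: T_def)
  qed
  hence T_le: "nrm (finsum K (\<lambda>g. emb (of_int (a g) / of_nat (p ^ k))) T) \<le> e"
    by (intro nrm_finsum_le[OF e]) auto
  let ?s = "finsum K (\<lambda>g. emb (of_int (a g) / of_nat (p ^ k))) T"
  have sK: "?s \<in> carrier K" by (intro K.finsum_closed) auto
  have "emb (of_int (Q.push a N) / of_nat (p ^ k)) \<ominus>\<^bsub>K\<^esub> L \<one> = (emb (of_int (a \<one>) / of_nat (p ^ k)) \<ominus>\<^bsub>K\<^esub> L \<one>) \<oplus>\<^bsub>K\<^esub> ?s"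
    unfolding push emb_add emb_sum using sK L by (simp add: a_minus_def K.a_ac)
  thus ?thesis unfolding a_def[symmetric] using nrm_add[of "emb (of_int (a \<one>) / of_nat (p ^ k)) \<ominus>\<^bsub>K\<^esub> L \<one>" ?s] near[of \<one>] T_le sK L by simp
qed

text \<open>This is \<open>reg_det_one_plus\<close> with \<open>c = p ^ Suc k\<close>, whose square
  is exactly the modulus of \<open>qdet\<close>; it is meant for
  \<open>U = u ^ (p ^ k)\<close>.\<close>

lemma qdet_one_plus:
  fixes U k N
  assumes N: "fin_index N" and U: "supported_below ZG r U" and Z: "\<And>i j g. nrm (U i j g \<ominus>\<^bsub>K\<^esub> mat_one ZG i j g) \<le> 1 / real p ^ Suc k"
  defines "\<tau> \<equiv> (\<Sum>i<r. finite_quotient.push G ((#>) N) (red (2 * k + 2) (U i i \<ominus>\<^bsub>ZG\<^esub> mat_one ZG i i)) N)"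
  shows "[qdet r N k U = 1 + int (idx N) * \<tau>] (mod int p ^ (2 * k + 2))" "int p ^ Suc k dvd \<tau>"
proof -
  let ?M = "2 * k + 2"
  interpret Q: finite_quotient G "p ^ ?M" "G Mod N" "(#>) N" by (rule fin_index_finite_quotient[OF N]) simp
  interpret Zr: ring ZG by (rule ring_c0Z)
  interpret h: matrix_ring_hom ZG "FpG (p ^ ?M) G" "red ?M" by (rule red_matrix_hom) simp
  have M1: "?M \<ge> 1" by simp
  define Y where "Y i j = U i j \<ominus>\<^bsub>ZG\<^esub> mat_one ZG i j" for i j
  have cl: "U i j \<in> carrier ZG" "mat_one ZG i j \<in> carrier ZG" for i j
    using U Zr.mat_one_closed by (auto simp: supported_below_def)
  have Y: "Y i j \<in> carrier ZG" for i j using cl by (simp add: Y_def)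
  have UY: "U i j = mat_one ZG i j \<oplus>\<^bsub>ZG\<^esub> Y i j" for i j
    using cl[of i j] by (simp add: Y_def a_minus_def Zr.a_lcomm Zr.r_neg)
  have Yle: "nrm (Y i j g) \<le> 1 / real p ^ Suc k" for i j g
    using Z c0Z_minus[OF cl(1) cl(2)] by (simp add: Y_def)
  have dvd: "int p ^ Suc k dvd red ?M (Y i j) g" for i j g
  proof -
    have c: "close ?M (Y i j g) (red ?M (Y i j) g)" by (rule red_close[OF Y])
    have YK: "Y i j g \<in> carrier K" by (rule c0Z_closed[OF Y])
    have "1 / real p ^ ?M \<le> 1 / real p ^ Suc k" using p_gt_1 by (intro divide_left_mono power_increasing) auto
    hence "nrm (emb (of_int (red ?M (Y i j) g)) \<ominus>\<^bsub>K\<^esub> Y i j g) \<le> 1 / real p ^ Suc k"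
      using c nrm_diff_commute[OF YK emb_closed] by (simp add: close_def)
    moreover have "emb (of_int (red ?M (Y i j) g)) = (emb (of_int (red ?M (Y i j) g)) \<ominus>\<^bsub>K\<^esub> Y i j g) \<oplus>\<^bsub>K\<^esub> Y i j g"
      using YK by (simp add: a_minus_def K.a_assoc K.l_neg)
    ultimately have "nrm (emb (of_int (red ?M (Y i j) g))) \<le> 1 / real p ^ Suc k"
      using Yle[of i j g] nrm_add[of "emb (of_int (red ?M (Y i j) g)) \<ominus>\<^bsub>K\<^esub> Y i j g" "Y i j g"] YK by fastforce
    thus ?thesis unfolding nrm_emb pabs_int_le_iff .
  qed
  have \<tau>: "\<tau> = (\<Sum>i<r. Q.push (red ?M (Y i i)) \<one>\<^bsub>G Mod N\<^esub>)" by (simp add: \<tau>_def Y_def FactGroup_def)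
  show "int p ^ Suc k dvd \<tau>" unfolding \<tau> by (intro dvd_sum Q.push_dvd dvd)
  have c2: "int p ^ Suc k * int p ^ Suc k = int p ^ ?M" by (simp only: power_add[symmetric]) (simp add: mult_2)
  have "[Q.reg_det r (map_entries (red ?M) U) = 1 + int Q.qcard * (\<Sum>i<r. Q.push (red ?M (Y i i)) \<one>\<^bsub>G Mod N\<^esub>)]
    (mod int p ^ Suc k * int p ^ Suc k)"
  proof (rule Q.reg_det_one_plus[where Z = "\<lambda>i j. red ?M (Y i j)"])
    show "red ?M (Y i j) \<in> carrier (FpG (p ^ ?M) G)" for i j by (rule red_closed[OF M1 Y])
    show "int p ^ Suc k dvd red ?M (Y i j) g" for i j g by (rule dvd)
    show "map_entries (red ?M) U i j = mat_one (FpG (p ^ ?M) G) i j \<oplus>\<^bsub>FpG (p ^ ?M) G\<^esub> red ?M (Y i j)" for i j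
    proof -
      have "map_entries (red ?M) U i j = red ?M (mat_one ZG i j \<oplus>\<^bsub>CG\<^esub> Y i j)"
        by (simp add: map_entries_def UY[of i j] c0Z_simps)
      also have "\<dots> = red ?M (mat_one ZG i j) \<oplus>\<^bsub>FpG (p ^ ?M) G\<^esub> red ?M (Y i j)"
        by (rule red_add[OF M1 cl(2) Y])
      also have "red ?M (mat_one ZG i j) = mat_one (FpG (p ^ ?M) G) i j"
        using fun_cong[OF fun_cong[OF h.map_entries_one], of i j] by (simp add: map_entries_def)
      finally show ?thesis .
    qed
    show "int p ^ Suc k * int p ^ Suc k dvd int (p ^ ?M)" unfolding c2 by simp
  qed
  moreover have "Q.qcard = idx N" unfolding Q.qcard_def idx_def by (simp add: FactGroup_def)
  ultimately show "[qdet r N k U = 1 + int (idx N) * \<tau>] (mod int p ^ (2 * k + 2))"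
    unfolding c2 \<tau> qdet_def by (simp only:)
qed

text \<open>Two comparisons are chained: \<open>qlog\<close> of \<open>u\<close> with
  \<open>\<tau> / p ^ k\<close>, through the power \<open>u ^ (p ^ k)\<close>, and
  \<open>\<tau> / p ^ k\<close> with the trace of the logarithm, through \<open>pow_sum\<close> and
  \<open>log_sum\<close> on the diagonal.\<close>

lemma ldet_lim_one_plus:
  assumes u: "u \<in> one_plus_pM p G r"
  shows "ldet_lim u (tr_Gamma p G r (mat_log p G r u))"
proof -
  interpret Z: matrix_ring ZG by (rule ring.matrix_ring[OF ring_c0Z])
  define L where "L i = mat_log p G r u i i" for i
  note usup = u_supported[OF u]
  have Lc: "L i \<in> c0_set p G" for i unfolding L_def by (rule mat_log_closed[OF u])
  have LK: "L i g \<in> carrier K" for i g by (rule c0_set_closed[OF Lc])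
  have L0: "L i g = \<zero>\<^bsub>K\<^esub>" if "r \<le> i" for i g
    using mat_log_outside[OF u, of i i] that by (simp add: L_def c0_simps)
  have tr: "tr_Gamma p G r (mat_log p G r u) = finsum K (\<lambda>i. L i \<one>) {..<R}" if "R \<ge> r" for R
    unfolding tr_Gamma_def L_def[symmetric]
    by (rule K.add.finprod_mono_neutral_cong_left) (use that L0 LK in auto)
  show ?thesis
  proof (rule ldet_limI[of _ r])
    show "tr_Gamma p G r (mat_log p G r u) \<in> carrier K" unfolding tr[OF order_refl] using LK by (auto intro!: K.finsum_closed)
    fix R :: nat and e :: real assume R: "R \<ge> r" and e: "e > 0"
    have uR: "supported_below ZG R u" by (rule supported_below_mono[OF usup R])
    \<comment> \<open>Most estimates below are non-strict; the smaller \<open>e'\<close> makes the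
      final one strict.\<close>
    define e' where "e' = e / 2"
    have e': "e' > 0" using e by (simp add: e'_def)
    obtain n where n: "n \<ge> 1" "real n / real p ^ n < e'" using n_div_p_pow_small[OF e'] .
    \<comment> \<open>The nontrivial elements at which the diagonal of the logarithm is not yet
      small: finitely many by decay, and \<open>N\<close> has to miss them.\<close>
    define S where "S = (\<Union>i<r. {g \<in> carrier G. e' \<le> nrm (L i g)}) - {\<one>}"
    have S: "finite S" "S \<subseteq> carrier G - {\<one>}" using c0_set_finite[OF Lc e'] by (auto simp: S_def)
    have large: "ev_index (\<lambda>N k. B / real p ^ k < e')" for B by (rule ev_index_large) (rule eventually_small[OF e'])
    \<comment> \<open>\<open>fact n / real p ^ k\<close> pays for the denominators in the binomial
      comparison, \<open>1 / real p ^ k\<close> for the passage to residues, and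
      \<open>n \<le> k\<close> ensures \<open>n \<le> p ^ k\<close>.\<close>
    have "ev_index (\<lambda>N k. fact n / real p ^ k < e' \<and> 1 / real p ^ k < e' \<and> n \<le> k)"
      by (intro ev_index_conj large ev_index_k_ge)
    from ev_index_conj[OF this ev_index_conj[OF ev_index_avoid[OF S] ev_index_small[OF e, of 1]]]
    have "ev_index (\<lambda>N k. (fact n / real p ^ k < e' \<and> 1 / real p ^ k < e' \<and> n \<le> k) \<and>
       (N \<inter> S = {} \<and> real 1 * (real (idx N) / real p ^ k) < e))" .
    thus "ev_index (\<lambda>N k. coprime (qdet R N k u) (int p) \<and>
      nrm (emb (qlog R N k u) \<ominus>\<^bsub>K\<^esub> tr_Gamma p G r (mat_log p G r u)) < e)"
    proof (rule ev_index_mono, elim conjE)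
      fix N k assume N: "fin_index N" and k: "fact n / real p ^ k < e'" "1 / real p ^ k < e'" "n \<le> k"
        and NS: "N \<inter> S = {}" and small: "real 1 * (real (idx N) / real p ^ k) < e"
      define U where "U = u [^]\<^bsub>rfm ZG\<^esub> (p ^ k)"
      have pk: "p ^ k > 0" by simp
      have US: "supported_below ZG R U" unfolding U_def by (rule Z.supported_below_pow[OF uR])
      have cl: "U i j \<in> carrier ZG" "mat_one ZG i j \<in> carrier ZG" for i j
        using US Z.mat_one_closed by (auto simp: supported_below_def)
      let ?v = "\<lambda>i j g n. dev_pow u n i j g"
      have vK: "?v i j g n \<in> carrier K" and vn: "nrm (?v i j g n) \<le> 1 / real p ^ n" for i j g n
        by (rule dev_pow_K[OF u], rule dev_pow_nrm[OF u])
      have psK: "pow_sum (?v i j g) q \<in> carrier K" for i j g q by (rule pow_sum_closed[OF vK vn])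
      have one_K: "mat_one ZG i j g \<in> carrier K" for i j g by (rule c0Z_closed[OF cl(2)])
      have UK: "U i j g \<ominus>\<^bsub>K\<^esub> mat_one ZG i j g = pow_sum (?v i j g) (p ^ k)" for i j g
        unfolding U_def u_pow_eval[OF u pk] using one_K[of i j g] psK[of i j g "p ^ k"]
        by (simp add: a_minus_def K.a_comm[of "mat_one ZG i j g"] K.a_assoc K.r_neg)
      have Ule: "nrm (U i j g \<ominus>\<^bsub>K\<^esub> mat_one ZG i j g) \<le> 1 / real p ^ Suc k" for i j g
        unfolding UK by (rule pow_sum_le[OF vK vn])
      define s where "s i = finite_quotient.push G ((#>) N) (red (2 * k + 2) (U i i \<ominus>\<^bsub>ZG\<^esub> mat_one ZG i i)) N" for i
      define \<tau> where "\<tau> = (\<Sum>i<R. s i)"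
      note q = qdet_one_plus[OF N US Ule, folded s_def, folded \<tau>_def]
      have "[qdet R N k u ^ p ^ k = qdet R N k U] (mod int p ^ (2 * k + 2))"
        unfolding U_def by (rule cong_sym[OF qdet_power[OF N uR]])
      from cong_trans[OF this q(1)] have D: "[qdet R N k u ^ p ^ k = 1 + int (idx N) * \<tau>] (mod int p ^ (2 * k + 2))" .
      have "int p dvd \<tau>" using q(2) by (metis dvd_trans dvd_triv_left power_Suc)
      hence "coprime (1 + int (idx N) * \<tau>) (int p)"
      proof -
        have "\<not> int p dvd 1 + int (idx N) * \<tau>"
        proof
          assume "int p dvd 1 + int (idx N) * \<tau>"
          from dvd_diff[OF this dvd_mult[OF \<open>int p dvd \<tau>\<close>, of "int (idx N)"]] have "int p dvd 1" by simp
          thus False using p_gt_1 by simp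
        qed
        from prime_imp_coprime[OF prime_int_p this] show ?thesis by (rule coprime_commute[THEN iffD1])
      qed
      from cong_coprime_p[OF D this] have cop: "coprime (qdet R N k u) (int p)" using p_gt_1 by auto
      have sL: "nrm (emb (of_int (s i) / of_nat (p ^ k)) \<ominus>\<^bsub>K\<^esub> L i \<one>) \<le> e'" for i
        unfolding s_def
      proof (rule push_red_approx[OF _ LK N])
        show "U i i \<ominus>\<^bsub>ZG\<^esub> mat_one ZG i i \<in> carrier ZG" using cl by simp
        fix g
        have ev: "(U i i \<ominus>\<^bsub>ZG\<^esub> mat_one ZG i i) g = pow_sum (?v i i g) (p ^ k)"
          unfolding c0Z_minus[OF cl(1) cl(2)] UK ..
        show "nrm (emb (1 / of_nat (p ^ k)) \<otimes>\<^bsub>K\<^esub> (U i i \<ominus>\<^bsub>ZG\<^esub> mat_one ZG i i) g \<ominus>\<^bsub>K\<^esub> L i g) \<le> e'"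
        proof (cases "i < r")
          case True
          have nk: "n \<le> p ^ k"
          proof -
            have "k < 2 ^ k" by (rule less_exp)
            also have "\<dots> \<le> p ^ k" using p_gt_1 by (intro power_mono) auto
            finally show ?thesis using k(3) by simp
          qed
          have 1: "nrm (emb (1 / of_nat (p ^ k)) \<otimes>\<^bsub>K\<^esub> pow_sum (?v i i g) (p ^ k) \<ominus>\<^bsub>K\<^esub> log_sum (?v i i g) n) \<le> e'"
            by (rule pow_sum_log_sum_le[OF vK vn n(1) nk]) (use n(2) k(1) in auto)
          have 2: "nrm (log_sum (?v i i g) n \<ominus>\<^bsub>K\<^esub> L i g) \<le> e'"
            using mat_log_approx[OF u True True n(1), of g] n(2) unfolding L_def by linarith
          have lsK: "log_sum (?v i i g) n \<in> carrier K" by (rule log_sum_closed[OF vK vn])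
          have "emb (1 / of_nat (p ^ k)) \<otimes>\<^bsub>K\<^esub> pow_sum (?v i i g) (p ^ k) \<in> carrier K" using psK by simp
          from nrm_diff_trans[OF this lsK LK[of i g]] 1 2 show ?thesis unfolding ev by linarith
        next
          \<comment> \<open>\<open>R\<close> may exceed \<open>r\<close>; the extra diagonal entries
            are those of the identity and contribute nothing.\<close>
          case False
          have "U i i = mat_one ZG i i"
            using Z.supported_below_pow[OF usup] False unfolding U_def by (auto simp: supported_below_def)
          hence "(U i i \<ominus>\<^bsub>ZG\<^esub> mat_one ZG i i) g = \<zero>\<^bsub>K\<^esub>"
            unfolding c0Z_minus[OF cl(1) cl(2)] using one_K[of i i g] by (simp add: a_minus_def K.r_neg)
          thus ?thesis using L0[of i g] False e' by (simp add: a_minus_def)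
        qed
      next
        fix g assume g: "g \<in> N" "g \<noteq> \<one>"
        have gG: "g \<in> carrier G" using g(1) N normal_imp_subgroup[of N G] subgroup.subset[of N G] by (auto simp: fin_index_def)
        show "nrm (L i g) \<le> e'"
        proof (cases "i < r")
          case True thus ?thesis using NS g gG by (force simp: S_def)
        qed (use L0 e' in auto)
      qed (use e' k in auto)
      have tau: "emb (of_int \<tau> / of_nat (p ^ k)) = finsum K (\<lambda>i. emb (of_int (s i) / of_nat (p ^ k))) {..<R}"
        unfolding \<tau>_def by (simp add: sum_divide_distrib flip: emb_sum)
      have "nrm (emb (of_int \<tau> / of_nat (p ^ k)) \<ominus>\<^bsub>K\<^esub> tr_Gamma p G r (mat_log p G r u)) \<le> e'"
        unfolding tau tr[OF R] by (subst K_finsum_diff) (use LK e' sL in \<open>auto intro!: nrm_finsum_le\<close>)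
      moreover have "nrm (emb (qlog R N k u) \<ominus>\<^bsub>K\<^esub> emb (of_int \<tau> / of_nat (p ^ k))) < e"
        using alog_one_plus[OF idx_pos[OF N] D q(2)] small by (simp flip: emb_diff)
      moreover have trK: "tr_Gamma p G r (mat_log p G r u) \<in> carrier K" unfolding tr[OF order_refl] using LK by (auto intro!: K.finsum_closed)
      moreover have "e' < e" using e by (simp add: e'_def)
      ultimately have "nrm (emb (qlog R N k u) \<ominus>\<^bsub>K\<^esub> tr_Gamma p G r (mat_log p G r u)) < e"
        using nrm_diff_trans[OF emb_closed emb_closed trK, of "qlog R N k u" "of_int \<tau> / of_nat (p ^ k)"] by linarith
      thus "coprime (qdet R N k u) (int p) \<and> nrm (emb (qlog R N k u) \<ominus>\<^bsub>K\<^esub> tr_Gamma p G r (mat_log p G r u)) < e"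
        using cop by blast
    qed
  qed
qed

end

section \<open>Existence and uniqueness\<close>

text \<open>\<open>H\<close> is not assumed to be normal, so the product in \<open>G Mod H\<close> is only a product of sets.\<close>
lemma power_in_Mod_power:
  assumes "group G" "x \<in> carrier G" "\<one>\<^bsub>G\<^esub> \<in> H"
  shows "x [^]\<^bsub>G\<^esub> n \<in> (H #>\<^bsub>G\<^esub> x) [^]\<^bsub>G Mod H\<^esub> (n::nat)"
proof (induction n)
  case 0 show ?case using assms by (simp add: FactGroup_def)
next
  case (Suc n)
  interpret group G by fact
  have "x \<in> H #>\<^bsub>G\<^esub> x" using assms by (auto simp: r_coset_def intro!: bexI[of _ "\<one>\<^bsub>G\<^esub>"])
  with Suc.IH have "x [^]\<^bsub>G\<^esub> n \<otimes>\<^bsub>G\<^esub> x \<in> (H #>\<^bsub>G\<^esub> x) [^]\<^bsub>G Mod H\<^esub> n <#>\<^bsub>G\<^esub> (H #>\<^bsub>G\<^esub> x)"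
    unfolding set_mult_def by blast
  thus ?case by (simp add: FactGroup_def)
qed

context padic_group begin

lemma one_by_one_GL:
  assumes "g \<in> carrier G" shows "one_by_one ZG (delta K g) \<in> carrier (GLinf ZG)"
proof -
  interpret Z: matrix_ring ZG by (rule ring.matrix_ring[OF ring_c0Z])
  have fin: "finitary ZG (one_by_one ZG (delta K h))" if "h \<in> carrier G" for h
    unfolding finitary_iff using Z.one_by_one_supported[OF delta_closed[OF that], of 1] by auto
  have m: "inf_mult ZG (one_by_one ZG (delta K h)) (one_by_one ZG (delta K (inv h))) = mat_one ZG"
    if h: "h \<in> carrier G" for h
  proof -
    have "delta K h \<otimes>\<^bsub>ZG\<^esub> delta K (inv h) = \<one>\<^bsub>ZG\<^esub>"
      unfolding c0Z_simps c0_simps(2) using delta_mult[of h "inv h"] h by simp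
    thus ?thesis using Z.one_by_one_mult[OF delta_closed delta_closed, of h "inv h"] Z.one_by_one_one h by simp
  qed
  show ?thesis
    by (rule Z.GLinf_I[OF fin fin m]) (use assms m[of "inv g"] in auto)
qed

text \<open>The coefficients of \<open>u - 1\<close> have norm at most \<open>1 / real p\<close>, so
  dividing them by \<open>p\<close> stays integral.\<close>

lemma red_one_imp_one_plus_pM:
  assumes u: "u \<in> carrier (GLinf ZG)" and red: "map_entries (red 1) u = mat_one (FpG p G)"
  obtains r where "r \<ge> 1" "u \<in> one_plus_pM p G r"
proof -
  interpret Z: matrix_ring ZG by (rule ring.matrix_ring[OF ring_c0Z])
  interpret h: matrix_ring_hom ZG "FpG (p ^ 1) G" "red 1" by (rule red_matrix_hom) simp
  obtain r0 where r0: "supported_below ZG r0 u" using Z.GLinf_finitary[OF u] unfolding finitary_iff by blast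
  \<comment> \<open>\<open>Suc\<close> secures \<open>r \<ge> 1\<close> even when the block of
    \<open>u\<close> is empty.\<close>
  define r where "r = Suc r0"
  have r: "supported_below ZG r u" "r \<ge> 1" using supported_below_mono[OF r0] by (auto simp: r_def)
  have cl: "u i j \<in> carrier ZG" "mat_one ZG i j \<in> carrier ZG" for i j
    using r Z.mat_one_closed by (auto simp: supported_below_def)
  define m where "m i j = c0_smul p G (1 / of_nat p) (u i j \<ominus>\<^bsub>CG\<^esub> mat_one ZG i j)" for i j
  have d: "u i j \<ominus>\<^bsub>CG\<^esub> mat_one ZG i j \<in> c0_set p G" for i j
    using abelian_group.minus_closed[OF abelian_group_c0] cl[of i j] c0Z_c0 by (simp add: c0_carrier)
  have d_eval: "(u i j \<ominus>\<^bsub>CG\<^esub> mat_one ZG i j) g = u i j g \<ominus>\<^bsub>K\<^esub> mat_one ZG i j g" for i j g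
    using c0_minus[OF c0Z_c0[OF cl(1)] c0Z_c0[OF cl(2)], of i j i j] by simp
  have uK: "u i j g \<in> carrier K" "mat_one ZG i j g \<in> carrier K" for i j g using c0Z_closed cl by auto
  have m_eval: "m i j g = emb (1 / of_nat p) \<otimes>\<^bsub>K\<^esub> (u i j g \<ominus>\<^bsub>K\<^esub> mat_one ZG i j g)" for i j g
    unfolding m_def c0_smul_eval[OF d] d_eval ..
  have small: "nrm (u i j g \<ominus>\<^bsub>K\<^esub> mat_one ZG i j g) \<le> 1 / real p" for i j g
  proof -
    have "red 1 (u i j) = red 1 (mat_one ZG i j)"
      using fun_cong[OF fun_cong[OF red]] fun_cong[OF fun_cong[OF h.map_entries_one]] by (simp add: map_entries_def)
    hence c: "close 1 (u i j g) (red 1 (u i j) g)" "close 1 (mat_one ZG i j g) (red 1 (u i j) g)"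
      using red_close[OF cl(1)] red_close[OF cl(2)] by metis+
    thus ?thesis using nrm_diff_trans[of "u i j g" "emb (of_int (red 1 (u i j) g))" "mat_one ZG i j g"]
        nrm_diff_commute[of "mat_one ZG i j g" "emb (of_int (red 1 (u i j) g))"] uK by (auto simp: close_def)
  qed
  have mZ: "m i j \<in> carrier ZG" for i j
  proof -
    have "nrm (m i j g) \<le> 1" for g
      unfolding m_eval using small[of i j g] uK p_gt_1 by (simp add: nrm_mult pabs_divide pabs_p field_simps)
    thus ?thesis using c0_smul_closed[OF d] by (simp add: c0Z_iff m_def)
  qed
  have eq: "u i j = mat_one CG i j \<oplus>\<^bsub>CG\<^esub> c0_smul p G (of_nat p) (m i j)" for i j
  proof
    fix g
    have "emb (of_nat p) \<otimes>\<^bsub>K\<^esub> m i j g = u i j g \<ominus>\<^bsub>K\<^esub> mat_one ZG i j g"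
    proof -
      have "emb (of_nat p) \<otimes>\<^bsub>K\<^esub> emb (1 / of_nat p) = \<one>\<^bsub>K\<^esub>" using p_gt_1 by (simp flip: emb_mult)
      thus ?thesis unfolding m_eval using uK by (simp flip: K.m_assoc)
    qed
    moreover have "a \<oplus>\<^bsub>K\<^esub> (b \<ominus>\<^bsub>K\<^esub> a) = b" if "a \<in> carrier K" "b \<in> carrier K" for a b
      using that by (simp add: a_minus_def K.a_comm[of b] K.r_neg2 K.r_neg1)
    ultimately show "u i j g = (mat_one CG i j \<oplus>\<^bsub>CG\<^esub> c0_smul p G (of_nat p) (m i j)) g"
      using uK[of i j g] c0_set_outside[OF c0Z_c0[OF cl(1)], of g i j]
      by (simp add: c0_simps c0_smul_eval c0Z_c0 mZ mat_one_CG)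
  qed
  have "u i j = (if i < r \<and> j < r then mat_one CG i j \<oplus>\<^bsub>CG\<^esub> c0_smul p G (of_nat p) (m i j) else mat_one CG i j)" for i j
  proof (cases "i < r \<and> j < r")
    case False
    thus ?thesis using r(1) by (auto simp: supported_below_def mat_one_CG)
  qed (use eq in simp)
  hence "u = (\<lambda>i j. if i < r \<and> j < r then mat_one CG i j \<oplus>\<^bsub>CG\<^esub> c0_smul p G (of_nat p) (m i j) else mat_one CG i j)"
    by (simp add: fun_eq_iff)
  hence "u \<in> one_plus_pM p G r" unfolding one_plus_pM_def using mZ by blast
  thus ?thesis using that r(2) by blast
qed

text \<open>An equality in \<open>K1\<close> of the residue ring provides an elementary matrix
  there. Its lift, times the matrix of \<open>g\<close>, agrees modulo \<open>p\<close> with the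
  power of \<open>A\<close>, and the quotient of the two is the principal unit.\<close>

lemma torsion_decomposition:
  assumes tors: "torsion_group (Wh_Fp p G)" and A: "A \<in> carrier (GLinf ZG)"
  obtains m g E u r where "m > 0" "g \<in> carrier G" "E \<in> Einf ZG" "u \<in> carrier (GLinf ZG)" "r \<ge> 1" "u \<in> one_plus_pM p G r"
    "A [^]\<^bsub>GLinf ZG\<^esub> (m::nat) = inf_mult ZG (inf_mult ZG E (one_by_one ZG (delta K g))) u"
proof -
  interpret Z: matrix_ring ZG by (rule ring.matrix_ring[OF ring_c0Z])
  interpret h: matrix_ring_hom ZG "FpG p G" "red 1" using red_matrix_hom[of 1] by simp
  interpret F: group_ring_mod G p using group_ring_mod_p_pow[of 1] by simp
  let ?F = "FpG p G"
  let ?H = "Gamma_image ?F G Fp_elt"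
  define B where "B = map_entries (red 1) A"
  have B: "B \<in> carrier (GLinf ?F)" unfolding B_def by (rule h.map_entries_GL[OF A])
  interpret K1: group "K1 ?F" by (rule h.S.group_K1)
  interpret cls: group_hom "GLinf ?F" "K1 ?F" "K1_class ?F"
    by (intro group_hom.intro group_hom_axioms.intro h.S.group_GLinf K1.is_group h.S.K1_class_hom)
  have one_H: "\<one>\<^bsub>K1 ?F\<^esub> \<in> ?H"
  proof -
    have "one_by_one ?F (Fp_elt \<one>) = mat_one ?F" using h.S.one_by_one_one unfolding F.FpG_simps(2) .
    hence "K1_class ?F (one_by_one ?F (Fp_elt \<one>)) = \<one>\<^bsub>K1 ?F\<^esub>" using cls.hom_one by (simp add: h.S.GLinf_simps)
    thus ?thesis unfolding Gamma_image_def using one_closed by force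
  qed
  let ?x = "?H #>\<^bsub>K1 ?F\<^esub> K1_class ?F B"
  have "?x \<in> carrier (Wh_Fp p G)" using B cls.hom_closed by (auto simp: Wh_Fp_def FactGroup_def RCOSETS_def)
  then obtain m :: nat where m: "m > 0" "?x [^]\<^bsub>Wh_Fp p G\<^esub> m = \<one>\<^bsub>Wh_Fp p G\<^esub>"
    using tors unfolding torsion_group_def by blast
  have "K1_class ?F B [^]\<^bsub>K1 ?F\<^esub> m \<in> ?x [^]\<^bsub>K1 ?F Mod ?H\<^esub> m"
    by (rule power_in_Mod_power[OF K1.is_group cls.hom_closed[OF B] one_H])
  \<comment> \<open>The unit of \<open>Wh_Fp\<close> is the set \<open>?H\<close> itself, so
    triviality of the power of the coset puts the power of the class into \<open>?H\<close>.\<close>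
  hence "K1_class ?F B [^]\<^bsub>K1 ?F\<^esub> m \<in> ?H" using m(2) by (simp add: Wh_Fp_def FactGroup_def)
  moreover have "K1_class ?F B [^]\<^bsub>K1 ?F\<^esub> m = K1_class ?F (B [^]\<^bsub>GLinf ?F\<^esub> m)" using cls.hom_nat_pow[OF B] by simp
  ultimately obtain g where g: "g \<in> carrier G" "K1_class ?F (B [^]\<^bsub>GLinf ?F\<^esub> m) = K1_class ?F (one_by_one ?F (Fp_elt g))"
    unfolding Gamma_image_def by auto
  have Bm: "B [^]\<^bsub>GLinf ?F\<^esub> m \<in> carrier (GLinf ?F)" using B by simp
  have "B [^]\<^bsub>GLinf ?F\<^esub> m \<in> K1_class ?F (B [^]\<^bsub>GLinf ?F\<^esub> m)"
    unfolding K1_class_def by (rule h.S.GL.rcos_self[OF Bm h.S.Einf_subgroup])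
  then obtain e where e: "e \<in> Einf ?F" "B [^]\<^bsub>GLinf ?F\<^esub> m = inf_mult ?F e (one_by_one ?F (Fp_elt g))"
    unfolding g(2) h.S.mem_K1_class by blast
  obtain E where E: "E \<in> Einf ZG" "map_entries (red 1) E = e"
    using h.Einf_lift[OF _ e(1)] red_surj[of 1] by auto
  have EGL: "E \<in> carrier (GLinf ZG)" using subgroup.subset[OF Z.Einf_subgroup] E by blast
  note gGL = one_by_one_GL[OF g(1)]
  interpret mh: group_hom "GLinf ZG" "GLinf ?F" "map_entries (red 1)"
    by (intro group_hom.intro group_hom_axioms.intro Z.group_GLinf h.S.group_GLinf h.map_entries_hom)
  define y where "y = E \<otimes>\<^bsub>GLinf ZG\<^esub> one_by_one ZG (delta K g)"
  have y: "y \<in> carrier (GLinf ZG)" using EGL gGL by (simp add: y_def)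
  define u where "u = inv\<^bsub>GLinf ZG\<^esub> y \<otimes>\<^bsub>GLinf ZG\<^esub> A [^]\<^bsub>GLinf ZG\<^esub> m"
  have Am: "A [^]\<^bsub>GLinf ZG\<^esub> m \<in> carrier (GLinf ZG)" using A by simp
  have u: "u \<in> carrier (GLinf ZG)" using y Am by (simp add: u_def)
  have "map_entries (red 1) y = e \<otimes>\<^bsub>GLinf ?F\<^esub> one_by_one ?F (Fp_elt g)"
    unfolding y_def using mh.hom_mult[OF EGL gGL] E(2) map_one_by_one[of 1 g] g(1) by simp
  also have "\<dots> = map_entries (red 1) (A [^]\<^bsub>GLinf ZG\<^esub> m)"
    using e(2) mh.hom_nat_pow[OF A, of m] by (simp add: B_def h.S.GLinf_simps)
  finally have ey: "map_entries (red 1) (A [^]\<^bsub>GLinf ZG\<^esub> m) = map_entries (red 1) y" by simp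
  have "map_entries (red 1) u = inv\<^bsub>GLinf ?F\<^esub> map_entries (red 1) y \<otimes>\<^bsub>GLinf ?F\<^esub> map_entries (red 1) y"
    unfolding u_def using mh.hom_mult[OF Z.GL.inv_closed[OF y] Am] mh.hom_inv[OF y] ey by simp
  also have "\<dots> = mat_one ?F" using mh.hom_closed[OF y] by (simp add: h.S.GLinf_simps(2)[symmetric])
  finally obtain r where r: "r \<ge> 1" "u \<in> one_plus_pM p G r"
    using red_one_imp_one_plus_pM[OF u] by auto
  have "A [^]\<^bsub>GLinf ZG\<^esub> m = y \<otimes>\<^bsub>GLinf ZG\<^esub> u"
    using y Am unfolding u_def by (simp flip: Z.GL.m_assoc)
  hence "A [^]\<^bsub>GLinf ZG\<^esub> m = inf_mult ZG (inf_mult ZG E (one_by_one ZG (delta K g))) u"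
    by (simp add: y_def Z.GLinf_simps)
  thus ?thesis using that[OF m(1) g(1) E(1) u r] by blast
qed

text \<open>One element at a time, intersecting with a subgroup that misses it; the whole group
  serves for the empty set.\<close>

lemma fin_index_avoiding:
  assumes rf: "residually_finite G" and "finite S" "S \<subseteq> carrier G - {\<one>}"
  obtains N where "fin_index N" "N \<inter> S = {}"
proof -
  have "\<exists>N. fin_index N \<and> N \<inter> S = {}" using assms(2,3)
  proof (induction S rule: finite_induct)
    case empty
    have "subgroup (carrier G) G" by (rule subgroup_self)
    hence "carrier G \<lhd> G" unfolding normal_inv_iff by auto
    moreover have "rcosets (carrier G) \<subseteq> {carrier G}" using coset_join2[OF _ subgroup_self] by (auto simp: RCOSETS_def)
    hence "finite (rcosets (carrier G))" by (rule finite_subset) simp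
    ultimately show ?case by (auto simp: fin_index_def)
  next
    case (insert x S)
    then obtain N where N: "fin_index N" "N \<inter> S = {}" by auto
    obtain N' where N': "N' \<lhd> G" "finite (rcosets N')" "x \<notin> N'"
      using rf insert.prems unfolding residually_finite_def by auto
    have "fin_index (N \<inter> N')" using N(1) N' finite_index_Int[of N N'] normal_subgroup_intersect[of N N']
      by (simp add: fin_index_def)
    thus ?case using N(2) N'(3) by (intro exI[of _ "N \<inter> N'"]) auto
  qed
  thus ?thesis using that by blast
qed

text \<open>Residual finiteness enters here: a condition that holds eventually is satisfied
  somewhere, so limits in the sense of \<open>ldet_lim\<close> are unique.\<close>

lemma ev_index_nontrivial:
  assumes "residually_finite G" "ev_index P" shows "\<exists>N k. P N k"
proof -
  obtain S where S: "finite S" "S \<subseteq> carrier G - {\<one>}" "\<And>N. fin_index N \<Longrightarrow> N \<inter> S = {} \<Longrightarrow> \<exists>k0. \<forall>k\<ge>k0. P N k"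
    using assms(2) unfolding ev_index_def by blast
  obtain N where "fin_index N" "N \<inter> S = {}" using fin_index_avoiding[OF assms(1) S(1,2)] .
  thus ?thesis using S(3) by blast
qed

lemma ldet_lim_unique:
  assumes rf: "residually_finite G" and "ldet_lim A l" "ldet_lim A l'" shows "l = l'"
proof -
  obtain r1 where r1: "l \<in> carrier K" "\<And>r e. r \<ge> r1 \<Longrightarrow> e > 0 \<Longrightarrow>
    ev_index (\<lambda>N k. coprime (qdet r N k A) (int p) \<and> nrm (emb (qlog r N k A) \<ominus>\<^bsub>K\<^esub> l) < e)" by (rule ldet_limE[OF assms(2)]) blast
  obtain r2 where r2: "l' \<in> carrier K" "\<And>r e. r \<ge> r2 \<Longrightarrow> e > 0 \<Longrightarrow>
    ev_index (\<lambda>N k. coprime (qdet r N k A) (int p) \<and> nrm (emb (qlog r N k A) \<ominus>\<^bsub>K\<^esub> l') < e)" by (rule ldet_limE[OF assms(3)]) blast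
  show ?thesis
  proof (rule K_eqI[OF r1(1) r2(1)])
    fix e :: real assume e: "e > 0"
    obtain N k where "nrm (emb (qlog (max r1 r2) N k A) \<ominus>\<^bsub>K\<^esub> l) < e" "nrm (emb (qlog (max r1 r2) N k A) \<ominus>\<^bsub>K\<^esub> l') < e"
      using ev_index_nontrivial[OF rf ev_index_conj[OF r1(2)[of "max r1 r2" e] r2(2)[of "max r1 r2" e]]] e by auto
    thus "nrm (l \<ominus>\<^bsub>K\<^esub> l') \<le> e"
      using nrm_diff_trans[OF r1(1) emb_closed r2(1), of "qlog (max r1 r2) N k A"]
        nrm_diff_commute[OF r1(1) emb_closed, of "qlog (max r1 r2) N k A"] by linarith
  qed
qed

text \<open>The value is the trace of the logarithm of the principal unit divided by
  \<open>m\<close>; the elementary and the group factor contribute zero.\<close>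

lemma ldet_lim_exists:
  assumes tors: "torsion_group (Wh_Fp p G)" and A: "A \<in> carrier (GLinf ZG)"
  shows "\<exists>l. ldet_lim A l"
proof -
  interpret Z: matrix_ring ZG by (rule ring.matrix_ring[OF ring_c0Z])
  obtain m g E u r where d: "m > 0" "g \<in> carrier G" "E \<in> Einf ZG" "u \<in> carrier (GLinf ZG)" "r \<ge> 1" "u \<in> one_plus_pM p G r"
    "A [^]\<^bsub>GLinf ZG\<^esub> (m::nat) = inf_mult ZG (inf_mult ZG E (one_by_one ZG (delta K g))) u"
    using torsion_decomposition[OF tors A] .
  let ?t = "tr_Gamma p G r (mat_log p G r u)"
  note t = ldet_lim_one_plus[OF d(6)]
  have tK: "?t \<in> carrier K" using t by (simp add: ldet_lim_def)
  have fin: "finitary ZG E" "finitary ZG (one_by_one ZG (delta K g))" "finitary ZG u"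
    using subgroup.subset[OF Z.Einf_subgroup] d one_by_one_GL Z.GLinf_finitary by auto
  have "ldet_lim (A [^]\<^bsub>GLinf ZG\<^esub> m) (\<zero>\<^bsub>K\<^esub> \<oplus>\<^bsub>K\<^esub> \<zero>\<^bsub>K\<^esub> \<oplus>\<^bsub>K\<^esub> ?t)" unfolding d(7)
    by (intro ldet_lim_mult ldet_lim_Einf[OF d(3)] ldet_lim_group_elt[OF d(2)] t fin Z.finitary_mult)
  hence lim: "ldet_lim (A [^]\<^bsub>rfm ZG\<^esub> m) ?t" using tK by (simp add: Z.GL_pow)
  have "emb (of_nat m) \<otimes>\<^bsub>K\<^esub> (emb (1 / of_nat m) \<otimes>\<^bsub>K\<^esub> ?t) = ?t"
    using d(1) tK by (simp flip: K.m_assoc emb_mult)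
  hence "ldet_lim A (emb (1 / of_nat m) \<otimes>\<^bsub>K\<^esub> ?t)"
    using lim tK by (intro ldet_lim_root[OF A d(1)]) simp_all
  thus ?thesis ..
qed

lemma emb_nat_cancel:
  assumes "m > 0" "x \<in> carrier K" "y \<in> carrier K" "emb (of_nat m) \<otimes>\<^bsub>K\<^esub> x = emb (of_nat m) \<otimes>\<^bsub>K\<^esub> y"
  shows "x = y"
proof -
  have "emb (1 / of_nat m) \<otimes>\<^bsub>K\<^esub> (emb (of_nat m) \<otimes>\<^bsub>K\<^esub> z) = z" if "z \<in> carrier K" for z
    using that assms(1) by (simp flip: K.m_assoc emb_mult)
  thus ?thesis using assms by metis
qed

lemma hom_add_power:
  assumes H: "group H" and f: "f \<in> hom H (add_monoid K)" and x: "x \<in> carrier H"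
  shows "f (x [^]\<^bsub>H\<^esub> (m::nat)) = emb (of_nat m) \<otimes>\<^bsub>K\<^esub> f x"
proof -
  interpret H: group H by fact
  have add: "f (a \<otimes>\<^bsub>H\<^esub> b) = f a \<oplus>\<^bsub>K\<^esub> f b" "f a \<in> carrier K" if "a \<in> carrier H" "b \<in> carrier H" for a b
    using f that by (auto simp: hom_def)
  show ?thesis
  proof (induction m)
    case 0
    have "f \<one>\<^bsub>H\<^esub> \<oplus>\<^bsub>K\<^esub> f \<one>\<^bsub>H\<^esub> = f \<one>\<^bsub>H\<^esub>" using add[of "\<one>\<^bsub>H\<^esub>" "\<one>\<^bsub>H\<^esub>"] by simp
    hence "f \<one>\<^bsub>H\<^esub> = \<zero>\<^bsub>K\<^esub>" using add(2)[of "\<one>\<^bsub>H\<^esub>" "\<one>\<^bsub>H\<^esub>"] by simp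
    thus ?case using add(2)[OF x x] by simp
  next
    case (Suc m)
    thus ?case using add x by (simp add: emb_add K.l_distr K.a_comm)
  qed
qed

end

theorem theorem5p1:
  fixes p :: nat and G :: "'g monoid"
  assumes "Factorial_Ring.prime p"
    and "group G"
    and "countable (carrier G)"
    and "residually_finite G"
    and "torsion_group (Wh_Fp p G)"
  shows "\<exists>logdet. logdet \<in> hom (K1 (c0Z p G)) (add_monoid (Qp p))
           \<and> (\<forall>r\<ge>1. \<forall>u\<in>one_plus_pM p G r.
                 logdet (K1_class (c0Z p G) u) = tr_Gamma p G r (mat_log p G r u))
           \<and> (\<forall>x\<in>Gamma_image (c0Z p G) G (c0_elt p). logdet x = \<zero>\<^bsub>Qp p\<^esub>)
           \<and> (\<forall>logdet'. logdet' \<in> hom (K1 (c0Z p G)) (add_monoid (Qp p))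
                 \<and> (\<forall>r\<ge>1. \<forall>u\<in>one_plus_pM p G r.
                       logdet' (K1_class (c0Z p G) u) = tr_Gamma p G r (mat_log p G r u))
                 \<and> (\<forall>x\<in>Gamma_image (c0Z p G) G (c0_elt p). logdet' x = \<zero>\<^bsub>Qp p\<^esub>)
                 \<longrightarrow> (\<forall>x\<in>carrier (K1 (c0Z p G)). logdet' x = logdet x))"
proof -
  interpret padic p by unfold_locales (rule assms(1))
  interpret group G by (rule assms(2))
  interpret padic_group p G by unfold_locales
  interpret Z: matrix_ring ZG by (rule ring.matrix_ring[OF ring_c0Z])
  interpret K1: group "K1 ZG" by (rule Z.group_K1)
  interpret cls: group_hom "GLinf ZG" "K1 ZG" "K1_class ZG"
    by (intro group_hom.intro group_hom_axioms.intro Z.group_GLinf K1.is_group Z.K1_class_hom)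
  \<comment> \<open>The representative is left to \<open>SOME\<close>; \<open>logdet_eq\<close>
    shows that the choice is immaterial, because two representatives differ by an element of
    \<open>Einf ZG\<close>, where the limit is zero.\<close>
  define logdet where "logdet Y = (THE l. ldet_lim (SOME A. A \<in> Y) l)" for Y
  have logdet_eq: "logdet (K1_class ZG A) = l" if l: "ldet_lim A l" and A: "finitary ZG A" for A l
  proof -
    have "A = inf_mult ZG (mat_one ZG) A" using A by (simp add: Z.inf_mult_one_left Z.finitary_rfm)
    hence "A \<in> K1_class ZG A"
      unfolding Z.mem_K1_class using subgroup.one_closed[OF Z.Einf_subgroup] by (auto simp: Z.GLinf_simps)
    hence "(SOME B. B \<in> K1_class ZG A) \<in> K1_class ZG A" by (rule someI[where P = "\<lambda>B. B \<in> K1_class ZG A"])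
    then obtain E where E: "E \<in> Einf ZG" "(SOME B. B \<in> K1_class ZG A) = inf_mult ZG E A"
      unfolding Z.mem_K1_class by blast
    have "finitary ZG E" using E(1) subgroup.subset[OF Z.Einf_subgroup] Z.GLinf_finitary by blast
    from ldet_lim_mult[OF ldet_lim_Einf[OF E(1)] this l A] have L: "ldet_lim (SOME B. B \<in> K1_class ZG A) l"
      using l by (simp add: E(2) ldet_lim_def)
    show ?thesis unfolding logdet_def
      by (rule the_equality[where P = "ldet_lim _", OF L]) (rule ldet_lim_unique[OF assms(4) _ L])
  qed
  have hom: "logdet \<in> hom (K1 ZG) (add_monoid K)"
  proof (rule homI)
    fix x assume "x \<in> carrier (K1 ZG)"
    then obtain A where A: "A \<in> carrier (GLinf ZG)" "x = K1_class ZG A" by (rule Z.K1_cases)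
    obtain l where l: "ldet_lim A l" using ldet_lim_exists[OF assms(5) A(1)] ..
    show "logdet x \<in> carrier (add_monoid K)"
      unfolding A(2) logdet_eq[OF l Z.GLinf_finitary[OF A(1)]] using l by (simp add: ldet_lim_def)
  next
    fix x y assume x: "x \<in> carrier (K1 ZG)" and y: "y \<in> carrier (K1 ZG)"
    obtain A where A: "A \<in> carrier (GLinf ZG)" "x = K1_class ZG A" using x by (rule Z.K1_cases)
    obtain B where B: "B \<in> carrier (GLinf ZG)" "y = K1_class ZG B" using y by (rule Z.K1_cases)
    obtain l where l: "ldet_lim A l" using ldet_lim_exists[OF assms(5) A(1)] ..
    obtain l' where l': "ldet_lim B l'" using ldet_lim_exists[OF assms(5) B(1)] ..
    note fin = Z.GLinf_finitary[OF A(1)] Z.GLinf_finitary[OF B(1)]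
    have "x \<otimes>\<^bsub>K1 ZG\<^esub> y = K1_class ZG (inf_mult ZG A B)" using A B cls.hom_mult by (simp add: Z.GLinf_simps)
    thus "logdet (x \<otimes>\<^bsub>K1 ZG\<^esub> y) = logdet x \<otimes>\<^bsub>add_monoid K\<^esub> logdet y"
      using logdet_eq[OF ldet_lim_mult[OF l fin(1) l' fin(2)] Z.finitary_mult[OF fin]]
        logdet_eq[OF l fin(1)] logdet_eq[OF l' fin(2)] A B by simp
  qed
  have a: "logdet (K1_class ZG u) = tr_Gamma p G r (mat_log p G r u)" if "u \<in> one_plus_pM p G r" for r u
    by (rule logdet_eq[OF ldet_lim_one_plus[OF that] finitary_iff[THEN iffD2, OF exI, OF u_supported[OF that]]])
  have b: "logdet x = \<zero>\<^bsub>K\<^esub>" if x: "x \<in> Gamma_image ZG G (c0_elt p)" for x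
  proof -
    obtain g where g: "g \<in> carrier G" "x = K1_class ZG (one_by_one ZG (delta K g))"
      using x by (auto simp: Gamma_image_def c0_elt_def)
    show ?thesis unfolding g(2)
      by (rule logdet_eq[OF ldet_lim_group_elt[OF g(1)] Z.GLinf_finitary[OF one_by_one_GL[OF g(1)]]])
  qed
  \<comment> \<open>Some power of \<open>x\<close> is the product of a class from \<open>G\<close>
    and the class of a principal unit, and on both the values are prescribed; the exponent
    \<open>m\<close> cancels in the p-adic field.\<close>
  have unique: "f x = f' x"
    if f: "f \<in> hom (K1 ZG) (add_monoid K)" "\<And>r u. r \<ge> 1 \<Longrightarrow> u \<in> one_plus_pM p G r \<Longrightarrow> f (K1_class ZG u) = tr_Gamma p G r (mat_log p G r u)"
      "\<And>x. x \<in> Gamma_image ZG G (c0_elt p) \<Longrightarrow> f x = \<zero>\<^bsub>K\<^esub>"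
    and f': "f' \<in> hom (K1 ZG) (add_monoid K)" "\<And>r u. r \<ge> 1 \<Longrightarrow> u \<in> one_plus_pM p G r \<Longrightarrow> f' (K1_class ZG u) = tr_Gamma p G r (mat_log p G r u)"
      "\<And>x. x \<in> Gamma_image ZG G (c0_elt p) \<Longrightarrow> f' x = \<zero>\<^bsub>K\<^esub>"
    and x: "x \<in> carrier (K1 ZG)" for f f' x
  proof -
    obtain A where A: "A \<in> carrier (GLinf ZG)" "x = K1_class ZG A" using x by (rule Z.K1_cases)
    obtain m g E u r where d: "m > 0" "g \<in> carrier G" "E \<in> Einf ZG" "u \<in> carrier (GLinf ZG)" "r \<ge> 1" "u \<in> one_plus_pM p G r"
      "A [^]\<^bsub>GLinf ZG\<^esub> (m::nat) = inf_mult ZG (inf_mult ZG E (one_by_one ZG (delta K g))) u"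
      using torsion_decomposition[OF assms(5) A(1)] .
    let ?y = "K1_class ZG (one_by_one ZG (delta K g))" and ?z = "K1_class ZG u"
    have EGL: "E \<in> carrier (GLinf ZG)" using d(3) subgroup.subset[OF Z.Einf_subgroup] by blast
    note gGL = one_by_one_GL[OF d(2)]
    have y: "?y \<in> carrier (K1 ZG)" "?z \<in> carrier (K1 ZG)" using gGL d(4) by simp_all
    have "x [^]\<^bsub>K1 ZG\<^esub> m = K1_class ZG (A [^]\<^bsub>GLinf ZG\<^esub> m)" using cls.hom_nat_pow[OF A(1), of m] A(2) by simp
    also have "\<dots> = K1_class ZG E \<otimes>\<^bsub>K1 ZG\<^esub> ?y \<otimes>\<^bsub>K1 ZG\<^esub> ?z"
      unfolding d(7) using EGL gGL d(4) by (simp flip: Z.GLinf_simps(1))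
    also have "\<dots> = ?y \<otimes>\<^bsub>K1 ZG\<^esub> ?z" using y Z.K1_class_Einf[OF d(3)] by simp
    finally have xm: "x [^]\<^bsub>K1 ZG\<^esub> m = ?y \<otimes>\<^bsub>K1 ZG\<^esub> ?z" .
    have yG: "?y \<in> Gamma_image ZG G (c0_elt p)" using d(2) by (auto simp: Gamma_image_def c0_elt_def)
    have "f ?y = f' ?y" using f(3) f'(3) yG by simp
    moreover have "f ?z = f' ?z" using f(2) f'(2) d(5,6) by simp
    ultimately have "f (x [^]\<^bsub>K1 ZG\<^esub> m) = f' (x [^]\<^bsub>K1 ZG\<^esub> m)"
      unfolding xm using hom_mult[OF f(1) y] hom_mult[OF f'(1) y] by simp
    hence "emb (of_nat m) \<otimes>\<^bsub>K\<^esub> f x = emb (of_nat m) \<otimes>\<^bsub>K\<^esub> f' x"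
      using hom_add_power[OF K1.is_group f(1) x] hom_add_power[OF K1.is_group f'(1) x] by simp
    moreover have "f x \<in> carrier K" "f' x \<in> carrier K"
      using hom_in_carrier[OF f(1) x] hom_in_carrier[OF f'(1) x] by simp_all
    ultimately show ?thesis using emb_nat_cancel[OF d(1)] by blast
  qed
  show ?thesis
  proof (intro exI[of _ logdet] conjI allI impI ballI)
    fix logdet' x
    assume *: "logdet' \<in> hom (K1 ZG) (add_monoid K) \<and>
       (\<forall>r\<ge>1. \<forall>u\<in>one_plus_pM p G r. logdet' (K1_class ZG u) = tr_Gamma p G r (mat_log p G r u)) \<and>
       (\<forall>x\<in>Gamma_image ZG G (c0_elt p). logdet' x = \<zero>\<^bsub>K\<^esub>)" and x: "x \<in> carrier (K1 ZG)"
    show "logdet' x = logdet x"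
      by (rule unique[OF _ _ _ hom _ _ x]) (use * a b in auto)
  qed (use hom a b in auto)
qed

end
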